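(* Under the standing assumption and Assumptions 2 and 3, $$\sup_{x\in\mathbb R}\big|\Pr(W_n\le x)-\Pr(W_n^*\le x)\big|\to0\quad\text{and}\quad \sup_{x\in\mathbb R}\big|\Pr(W_n\le x)-\Pr(W_n^{U}\le x)\big|\to0,$$ where $W_n=\sup_{u\in[h,1-h]}|Z_n(u)|$, $W_n^*=\sup_{u\in[h,1-h]}|Z_n^*(u)|$, and $W_n^{U}=\sup_{u\in[h,1-h]}|Z_n^{U}(u)|$. The same conclusions hold with the absolute values removed (i.e. for $\sup Z_n$, $\sup Z_n^*$, $\sup Z_n^{U}$).
   Context: Standing assumption: $b_1,\dots,b_n$ are i.i.d. bids with continuous CDF $F$, quantile function $Q=F^{-1}$ twice continuously differentiable on $[0,1]$, $q=Q'>0$ on $[0,1]$. $p_1,\dots,p_M$ fixed known nonnegative numbers, $A_1(u)=\sum_{m=1}^Mp_mu^{m-1}$ with $A_1'\ne0$ on $[0,1]$, $A=A_1/A_1'$. Value quantile function $v(u)=Q(u)+A(u)q(u)$. Estimators: $\hat Q(u)=b_{(\lfloor nu\rfloor+1)}$ ($u<1$), $\hat Q(1)=b_{(n)}$; $K_h(z)=h^{-1}K(z/h)$; $\hat q_h(u)=\sum_{i=1}^{n-1}K_h(u-i/n)(b_{(i+1)}-b_{(i)})$; $\hat v_h=\hat Q+A\hat q_h$. $Z_n(u)=\sqrt{nh}(\hat v_h(u)-v(u))/\hat q_h(u)$; $Z_n^*(u)=-A(u)\mathbb G_{n,h}(u)$ with $\mathbb G_{n,h}(u)=\sqrt{nh}\,\frac1n\sum_{i=1}^n[K_h(u-F(b_i))-\mathbb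 EK_h(u-F(b_i))]$ (note $F(b_i)$ are i.i.d. Uniform$[0,1]$, so $Z_n^*$ has a known distribution). $Z_n^U$ is the process $Z_n$ computed from an independent pseudo-sample $\tilde b_1,\dots,\tilde b_n$ i.i.d. Uniform$[0,1]$, for which $Q(u)=u$, $q\equiv1$, $v(u)=u+A(u)$. Assumption 2: $K$ nonnegative, $\int K=1$, $\int K^2<\infty$, $K$ Lipschitz, supported on $[-1,1]$. Assumption 3: $h=h_n\to0$ and there are $c,\alpha,C,\beta>0$ with $cn^{-1/2+\alpha}\le h_n\le Cn^{-1/3-\beta}$ for all $n$. *)

theory Defs
  imports "HOL-Probability.Probability"
begin

definition A1 :: "(nat \<Rightarrow> real) \<Rightarrow> nat \<Rightarrow> real \<Rightarrow> real" where
  "A1 p M u = (\<Sum>m=1..M. p m * u ^ (m - 1))"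

definition A1d :: "(nat \<Rightarrow> real) \<Rightarrow> nat \<Rightarrow> real \<Rightarrow> real" where
  "A1d p M u = (\<Sum>m=2..M. real (m - 1) * p m * u ^ (m - 2))"

definition Afun :: "(nat \<Rightarrow> real) \<Rightarrow> nat \<Rightarrow> real \<Rightarrow> real" where
  "Afun p M u = A1 p M u / A1d p M u"

text \<open>Order statistics b_(k), k = 1..n, of the sample b 0, ..., b (n-1).\<close>
definition ordstat :: "nat \<Rightarrow> (nat \<Rightarrow> real) \<Rightarrow> nat \<Rightarrow> real" where
  "ordstat n b k = sort (map b [0..<n]) ! (k - 1)"

definition Kh :: "(real \<Rightarrow> real) \<Rightarrow> real \<Rightarrow> real \<Rightarrow> real" where
  "Kh K h z = K (z / h) / h"

definition hatQ :: "nat \<Rightarrow> (nat \<Rightarrow> real) \<Rightarrow> real \<Rightarrow> real" where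
  "hatQ n b u = (if u < 1 then ordstat n b (nat \<lfloor>real n * u\<rfloor> + 1) else ordstat n b n)"

definition hatq :: "(real \<Rightarrow> real) \<Rightarrow> real \<Rightarrow> nat \<Rightarrow> (nat \<Rightarrow> real) \<Rightarrow> real \<Rightarrow> real" where
  "hatq K h n b u = (\<Sum>i=1..n-1. Kh K h (u - real i / real n) * (ordstat n b (i + 1) - ordstat n b i))"

definition hatv :: "(real \<Rightarrow> real) \<Rightarrow> (real \<Rightarrow> real) \<Rightarrow> real \<Rightarrow> nat \<Rightarrow> (nat \<Rightarrow> real) \<Rightarrow> real \<Rightarrow> real" where
  "hatv A K h n b u = hatQ n b u + A u * hatq K h n b u"

definition Zn :: "(real \<Rightarrow> real) \<Rightarrow> (real \<Rightarrow> real) \<Rightarrow> (real \<Rightarrow> real) \<Rightarrow> (real \<Rightarrow> real)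
    \<Rightarrow> real \<Rightarrow> nat \<Rightarrow> (nat \<Rightarrow> real) \<Rightarrow> real \<Rightarrow> real" where
  "Zn Q q A K h n b u = sqrt (real n * h) * (hatv A K h n b u - (Q u + A u * q u)) / hatq K h n b u"

text \<open>G_{n,h}(u) for a uniform sample U 0..U (n-1); E K_h(u - U) = integral over [0,1].\<close>
definition Gnh :: "(real \<Rightarrow> real) \<Rightarrow> real \<Rightarrow> nat \<Rightarrow> (nat \<Rightarrow> real) \<Rightarrow> real \<Rightarrow> real" where
  "Gnh K h n U u = sqrt (real n * h) * (1 / real n) *
     (\<Sum>i<n. Kh K h (u - U i) - integral {0..1} (\<lambda>t. Kh K h (u - t)))"

definition Zstar :: "(real \<Rightarrow> real) \<Rightarrow> (real \<Rightarrow> real) \<Rightarrow> real \<Rightarrow> nat \<Rightarrow> (nat \<Rightarrow> real) \<Rightarrow> real \<Rightarrow> real" where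
  "Zstar A K h n U u = - A u * Gnh K h n U u"

definition Wabs :: "(real \<Rightarrow> real) \<Rightarrow> real \<Rightarrow> ereal" where
  "Wabs Z h = (SUP u\<in>{h..1-h}. ereal \<bar>Z u\<bar>)"

definition Wsup :: "(real \<Rightarrow> real) \<Rightarrow> real \<Rightarrow> ereal" where
  "Wsup Z h = (SUP u\<in>{h..1-h}. ereal (Z u))"

definition PrLe :: "real measure \<Rightarrow> nat \<Rightarrow> ((nat \<Rightarrow> real) \<Rightarrow> ereal) \<Rightarrow> real \<Rightarrow> real" where
  "PrLe D n W x = measure (PiM {..<n} (\<lambda>_. D)) {b \<in> space (PiM {..<n} (\<lambda>_. D)). W b \<le> ereal x}"

definition unif01 :: "real measure" where
  "unif01 = uniform_measure lborel {0..1}"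

end

theory Submission
  imports Defs "HOL-Real_Asymp.Real_Asymp"
begin

text \<open>
  Writing the bids as \<open>Q\<close> applied to a uniform sample, a Bahadur--Kiefer expansion of the order statistics
  and summation by parts show that \<open>Z_n\<close> and \<open>Z_n*\<close> differ uniformly by a negative power of \<open>n\<close>, outside an
  event of vanishing probability. The same applies to \<open>Z_n^U\<close>, so it remains to see that the maximum \<open>W\<close> of
  \<open>Z_n*\<close> puts vanishing mass on every interval \<open>[x, x + \<epsilon>]\<close> with \<open>\<epsilon>\<close> polynomially small, uniformly in \<open>x\<close>.

  Instead of a Gaussian approximation, a local transport of the sample is used. Moving the points by \<open>\<theta>\<close> times
  a tent function of width \<open>\<Lambda>\<close>, slightly larger than the bandwidth \<open>h\<close>, raises the process by a prescribed
  amount \<open>s\<close> on one side of the tent, changes it nowhere by more than that, and not at all away from the tent. Its Jacobian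
  is bounded below as long as \<open>s\<^sup>2 \<Lambda> / h\<close> is small. Applied where the maximum is attained, it sends
  \<open>W \<in> [x, x + \<epsilon>]\<close> to \<open>W \<approx> x + s\<close> for each of the \<open>N\<close> levels \<open>s = 2k\<epsilon>\<close>. The image events overlap boundedly,
  hence the original event has probability \<open>O(1/N)\<close>.

  Points where the weight \<open>A\<close> is small do not matter unless \<open>W\<close> is close to \<open>0\<close>. This is excluded by the same
  argument, since the spatial average of the process, and with it \<open>- W\<close>, is at most of order \<open>sqrt h\<close>.
\<close>

section \<open>Uniform samples\<close>

text \<open>The two bounds on the bandwidth serve different remainders. The bias of
  \<open>hatq\<close> contributes \<open>h * sqrt (n * h)\<close>, which asks for h below n^(-1/3);
  the Bahadur remainder contributes n^(-1/4) / sqrt h, which asks for h above n^(-1/2). Both leave a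
  polynomial margin. Hence every tail may be as crude as exp (-\<nu>) with \<nu> a small power of n,
  and no constant has to be optimised. The tent is chosen because its slope is constant on each
  flank: a kernel window that fits into one flank sees a constant density, and the new mean comes
  out exactly. The logarithm of the Jacobian has variance of order \<theta>^2 n \<Lambda>, while the
  shift is of order \<theta> sqrt (n h); this is the origin of the condition relating s, \<Lambda>
  and h. The obstacle is the weight: \<open>Afun p M 0\<close> vanishes when \<open>p 1 = 0\<close>,
  and where the weight is tiny the process cannot be raised by a moderate transport. The argument
  therefore runs twice, once over points whose weight exceeds a fixed \<open>a0\<close> and once
  over points whose weight exceeds \<nu>^(-5).\<close>

lemma prob_space_unif01: "prob_space unif01"
  unfolding unif01_def by (rule prob_space_uniform_measure) auto

lemma sets_unif01 [measurable_cong, simp]: "sets unif01 = sets borel"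
  by (simp add: unif01_def)

lemma space_unif01 [simp]: "space unif01 = UNIV"
  by (simp add: unif01_def)

lemma AE_unif01: "AE t in unif01. t \<in> {0..1}"
  unfolding unif01_def by (rule AE_uniform_measureI) auto

lemma nn_integral_unif01:
  assumes [measurable]: "f \<in> borel_measurable borel"
  shows "(\<integral>\<^sup>+t. f t \<partial>unif01) = (\<integral>\<^sup>+t. f t * indicator {0..1} t \<partial>lborel)"
  unfolding unif01_def by (subst nn_integral_uniform_measure) (auto simp: divide_ennreal_def)

lemma emeasure_unif01:
  assumes [measurable]: "B \<in> sets borel"
  shows "emeasure unif01 B = emeasure lborel ({0..1} \<inter> B)"
  unfolding unif01_def by (subst emeasure_uniform_measure) (auto simp: divide_ennreal_def)

lemma measure_unif01_Icc:
  assumes "0 \<le> a" "a \<le> b" "b \<le> 1"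
  shows "measure unif01 {a..b} = b - a"
proof -
  have "{0..1} \<inter> {a..b} = {a..b}" using assms by auto
  then show ?thesis using assms emeasure_unif01[of "{a..b}"] by (simp add: measure_def)
qed

lemma measure_unif01_Ico:
  assumes "0 \<le> a" "a \<le> b" "b \<le> 1"
  shows "measure unif01 {a..<b} = b - a"
proof -
  have "{0..1} \<inter> {a..<b} = {a..<b}" using assms by auto
  then show ?thesis using assms emeasure_unif01[of "{a..<b}"] by (simp add: measure_def)
qed

lemma measure_unif01_Ioc:
  assumes "0 \<le> a" "a \<le> b" "b \<le> 1"
  shows "measure unif01 {a<..b} = b - a"
proof -
  have "{0..1} \<inter> {a<..b} = {a<..b}" using assms by auto
  then show ?thesis using assms emeasure_unif01[of "{a<..b}"] by (simp add: measure_def)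
qed

lemma real_distribution_unif01: "real_distribution unif01"
  using prob_space_unif01 by (simp add: real_distribution_def real_distribution_axioms_def)

lemma cdf_unif01: "cdf unif01 x = max 0 (min 1 x)"
proof -
  have "{0..1} \<inter> {..x} = {0..min 1 x}" by auto
  then have "emeasure unif01 {..x} = ennreal (max 0 (min 1 x))"
    using emeasure_unif01[of "{..x}"] by (cases "x < 0") (auto simp: min_def max_def)
  then show ?thesis unfolding cdf_def measure_def by (simp only: enn2real_ennreal max.cobounded1)
qed

section \<open>A Bernstein-type tail bound\<close>

lemma exp_le_quadratic:
  fixes x :: real
  assumes "\<bar>x\<bar> \<le> 1"
  shows "exp x \<le> 1 + x + x\<^sup>2"
proof (cases "x \<ge> 0")
  case True
  then show ?thesis using assms exp_bound[of x] by auto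
next
  case False
  define y where "y = - x"
  have y: "0 \<le> y" using False by (auto simp: y_def)
  \<comment> \<open>In the product of \<open>1 - y + y\<^sup>2\<close> with the quadratic Taylor
    polynomial of \<open>exp y\<close> the first-order terms cancel and all remaining coefficients
    are nonnegative.\<close>
  have "1 \<le> 1 + y\<^sup>2/2 + y^3/2 + y^4/2" using y by simp
  also have "\<dots> = (1 - y + y\<^sup>2) * (1 + y + y\<^sup>2/2)"
    by (simp add: field_simps power2_eq_square power3_eq_cube power4_eq_xxxx)
  also have "\<dots> \<le> (1 - y + y\<^sup>2) * exp y"
  proof (rule mult_left_mono)
    show "1 + y + y\<^sup>2/2 \<le> exp y" using exp_lower_Taylor_quadratic[OF y] .
    have "0 \<le> (1 - y)\<^sup>2 + y" using y by (intro add_nonneg_nonneg) auto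
    also have "\<dots> = 1 - y + y\<^sup>2" by (simp add: power2_eq_square algebra_simps)
    finally show "0 \<le> 1 - y + y\<^sup>2" .
  qed
  finally have "exp (- y) \<le> 1 - y + y\<^sup>2"
    by (simp add: exp_minus field_simps)
  then show ?thesis by (simp add: y_def)
qed

text \<open>The exponential moment is taken at the single point \<open>1 / sqrt V\<close>. The
  condition \<open>b\<^sup>2 \<le> V\<close> keeps the exponent in the range of
  \<open>exp_le_quadratic\<close>, and the moment of the sum is then at most e. The tail is
  exponential rather than Gaussian in \<nu>, which suffices for \<nu> a power of n.\<close>

lemma chernoff_upper:
  fixes f :: "real \<Rightarrow> real"
  assumes D: "prob_space D" and sets: "sets D = sets borel"
    and f[measurable]: "f \<in> borel_measurable borel"
    and bd: "\<And>y. \<bar>f y\<bar> \<le> b" and mean: "integral\<^sup>L D f = 0"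
    and var: "integral\<^sup>L D (\<lambda>y. (f y)\<^sup>2) \<le> v"
    and V: "real n * v \<le> V" "b\<^sup>2 \<le> V" "0 < V"
  shows "measure (PiM {..<n} (\<lambda>_. D)) {y \<in> space (PiM {..<n} (\<lambda>_. D)). \<nu> * sqrt V \<le> (\<Sum>i<n. f (y i))}
    \<le> exp (1 - \<nu>)"
proof -
  interpret D: prob_space D by fact
  note sets[measurable_cong, simp]
  let ?M = "PiM {..<n} (\<lambda>_. D)"
  interpret P: prob_space ?M by (rule prob_space_PiM) (rule D)
  interpret S: product_sigma_finite "\<lambda>_::nat. D" ..
  define l where "l = 1 / sqrt V"
  have l: "0 < l" using V by (simp add: l_def)
  have b0: "0 \<le> b" using bd[of 0] by auto
  have "b = sqrt (b\<^sup>2)" using b0 by simp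
  also have "\<dots> \<le> sqrt V" using V by (simp only: real_sqrt_le_iff)
  finally have lb: "l * b \<le> 1" using V by (simp add: l_def)
  have intf: "integrable D f" "integrable D (\<lambda>y. (f y)\<^sup>2)" "integrable D (\<lambda>y. exp (l * f y))"
  proof -
    show "integrable D f"
      by (rule D.integrable_const_bound[of _ b]) (use bd in auto)
    have "(f y)\<^sup>2 \<le> b\<^sup>2" for y using bd[of y] by (metis abs_ge_zero power_mono power2_abs)
    then show "integrable D (\<lambda>y. (f y)\<^sup>2)"
      by (intro D.integrable_const_bound[of _ "b\<^sup>2"]) auto
    have "exp (l * f y) \<le> exp (l * b)" for y using bd[of y] l by (auto simp: abs_le_iff)
    then show "integrable D (\<lambda>y. exp (l * f y))"
      by (intro D.integrable_const_bound[of _ "exp (l * b)"]) auto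
  qed
  have "integral\<^sup>L D (\<lambda>y. exp (l * f y)) \<le> integral\<^sup>L D (\<lambda>y. 1 + l * f y + l\<^sup>2 * (f y)\<^sup>2)"
  proof (rule integral_mono)
    fix y
    have "\<bar>l * f y\<bar> \<le> l * b" using bd[of y] l by (simp add: abs_mult)
    also have "\<dots> \<le> 1" by (rule lb)
    finally show "exp (l * f y) \<le> 1 + l * f y + l\<^sup>2 * (f y)\<^sup>2"
      using exp_le_quadratic[of "l * f y"] by (simp add: power_mult_distrib)
  qed (use intf in auto)
  also have "\<dots> = 1 + l\<^sup>2 * integral\<^sup>L D (\<lambda>y. (f y)\<^sup>2)"
    using intf mean by (simp add: D.prob_space)
  also have "\<dots> \<le> 1 + l\<^sup>2 * v" using var by (auto intro: mult_left_mono)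
  also have "\<dots> \<le> exp (l\<^sup>2 * v)" by (rule exp_ge_add_one_self)
  finally have mgf1: "integral\<^sup>L D (\<lambda>y. exp (l * f y)) \<le> exp (l\<^sup>2 * v)" .
  have int: "integrable ?M (\<lambda>y. \<Prod>i<n. exp (l * f (y i)))"
    by (rule S.product_integrable_prod) (use intf in auto)
  have "(\<integral>y. (\<Prod>i<n. exp (l * f (y i))) \<partial>?M) = (\<Prod>i<n. integral\<^sup>L D (\<lambda>y. exp (l * f y)))"
    by (rule S.product_integral_prod) (use intf in auto)
  also have "\<dots> = integral\<^sup>L D (\<lambda>y. exp (l * f y)) ^ n" by simp
  also have "\<dots> \<le> exp (l\<^sup>2 * v) ^ n" by (rule power_mono[OF mgf1]) auto
  also have "\<dots> = exp (l\<^sup>2 * (real n * v))" by (simp add: exp_of_nat_mult[symmetric] algebra_simps)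
  also have "\<dots> \<le> exp (l\<^sup>2 * V)" using V by (auto intro: mult_left_mono)
  also have "l\<^sup>2 * V = 1" using V by (simp add: l_def power_divide)
  finally have mgf: "(\<integral>y. (\<Prod>i<n. exp (l * f (y i))) \<partial>?M) \<le> exp 1" .
  have "measure ?M {y \<in> space ?M. \<nu> * sqrt V \<le> (\<Sum>i<n. f (y i))}
      = measure ?M {y \<in> space ?M. exp \<nu> \<le> (\<Prod>i<n. exp (l * f (y i)))}"
  proof -
    have "\<nu> * sqrt V \<le> s \<longleftrightarrow> \<nu> \<le> l * s" for s
      using V by (simp add: l_def field_simps)
    then show ?thesis by (simp add: exp_sum[symmetric] sum_distrib_left[symmetric])
  qed
  also have "\<dots> \<le> (\<integral>y. (\<Prod>i<n. exp (l * f (y i))) \<partial>?M) / exp \<nu>"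
    by (rule integral_Markov_inequality_measure[where A = "{}", simplified]) (use int in \<open>auto intro!: prod_nonneg\<close>)
  also have "\<dots> \<le> exp 1 / exp \<nu>" using mgf by (simp add: divide_right_mono)
  finally show ?thesis by (simp add: exp_diff)
qed

text \<open>Centring at most doubles the sup bound, hence the factor 4 in front of
  \<open>b\<^sup>2\<close>. The variance is dominated by the raw second moment, which is easier to
  bound for kernels.\<close>

lemma chernoff:
  fixes f :: "real \<Rightarrow> real"
  assumes D: "prob_space D" and sets: "sets D = sets borel"
    and f[measurable]: "f \<in> borel_measurable borel"
    and bd: "\<And>y. \<bar>f y\<bar> \<le> b"
    and var: "integral\<^sup>L D (\<lambda>y. (f y)\<^sup>2) \<le> v"
    and V: "real n * v \<le> V" "4 * b\<^sup>2 \<le> V" "0 < V"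
  shows "measure (PiM {..<n} (\<lambda>_. D))
      {y \<in> space (PiM {..<n} (\<lambda>_. D)). \<nu> * sqrt V \<le> \<bar>(\<Sum>i<n. f (y i)) - real n * integral\<^sup>L D f\<bar>}
    \<le> 2 * exp (1 - \<nu>)"
proof -
  interpret D: prob_space D by fact
  note sets[measurable_cong, simp]
  let ?M = "PiM {..<n} (\<lambda>_. D)"
  interpret P: prob_space ?M by (rule prob_space_PiM) (rule D)
  let ?m = "integral\<^sup>L D f"
  have f1: "integrable D f" by (rule D.integrable_const_bound[of _ b]) (use bd in auto)
  have sq: "(f y)\<^sup>2 \<le> b\<^sup>2" for y using bd[of y] by (metis abs_ge_zero power_mono power2_abs)
  have f2: "integrable D (\<lambda>y. (f y)\<^sup>2)"
    by (rule D.integrable_const_bound[of _ "b\<^sup>2"]) (use sq in auto)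
  have "\<bar>?m\<bar> \<le> integral\<^sup>L D (\<lambda>y. \<bar>f y\<bar>)" by (rule integral_abs_bound)
  also have "\<dots> \<le> integral\<^sup>L D (\<lambda>y. b)" by (rule integral_mono) (use bd f1 in auto)
  finally have m: "\<bar>?m\<bar> \<le> b" by (simp add: D.prob_space)
  have bd': "\<bar>f y - ?m\<bar> \<le> 2 * b" "\<bar>?m - f y\<bar> \<le> 2 * b" for y using m bd[of y] by auto
  have "integral\<^sup>L D (\<lambda>y. (f y - ?m)\<^sup>2) = integral\<^sup>L D (\<lambda>y. (f y)\<^sup>2) - ?m\<^sup>2"
    by (rule D.variance_eq) (use f1 f2 in auto)
  also have "\<dots> \<le> v" using var zero_le_power2[of ?m] by linarith
  finally have var1: "integral\<^sup>L D (\<lambda>y. (f y - ?m)\<^sup>2) \<le> v" .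
  then have var2: "integral\<^sup>L D (\<lambda>y. (?m - f y)\<^sup>2) \<le> v" by (simp add: power2_commute)
  have b2: "(2 * b)\<^sup>2 \<le> V" using V by (simp add: power_mult_distrib)
  have mean: "integral\<^sup>L D (\<lambda>y. f y - ?m) = 0" "integral\<^sup>L D (\<lambda>y. ?m - f y) = 0"
    using f1 by (simp_all add: D.prob_space)
  have U: "measure ?M {y \<in> space ?M. \<nu> * sqrt V \<le> (\<Sum>i<n. f (y i) - ?m)} \<le> exp (1 - \<nu>)"
    by (rule chernoff_upper[OF D sets _ bd'(1) mean(1) var1 V(1) b2 V(3)]) simp
  have L: "measure ?M {y \<in> space ?M. \<nu> * sqrt V \<le> (\<Sum>i<n. ?m - f (y i))} \<le> exp (1 - \<nu>)"
    by (rule chernoff_upper[OF D sets _ bd'(2) mean(2) var2 V(1) b2 V(3)]) simp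
  have "measure ?M {y \<in> space ?M. \<nu> * sqrt V \<le> \<bar>(\<Sum>i<n. f (y i)) - real n * ?m\<bar>}
     \<le> measure ?M ({y \<in> space ?M. \<nu> * sqrt V \<le> (\<Sum>i<n. f (y i) - ?m)} \<union> {y \<in> space ?M. \<nu> * sqrt V \<le> (\<Sum>i<n. ?m - f (y i))})"
    by (rule P.finite_measure_mono) (auto simp: sum_subtractf)
  also have "\<dots> \<le> measure ?M {y \<in> space ?M. \<nu> * sqrt V \<le> (\<Sum>i<n. f (y i) - ?m)} + measure ?M {y \<in> space ?M. \<nu> * sqrt V \<le> (\<Sum>i<n. ?m - f (y i))}"
    by (rule measure_subadditive) auto
  finally show ?thesis using U L by linarith
qed

section \<open>Transporting the uniform law by a tent\<close>

definition tent :: "real \<Rightarrow> real \<Rightarrow> real \<Rightarrow> real" where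
  "tent c \<Lambda> t = max 0 (\<Lambda> - \<bar>t - c\<bar>)"

definition tent_map :: "real \<Rightarrow> real \<Rightarrow> real \<Rightarrow> real \<Rightarrow> real" where
  "tent_map c \<Lambda> \<theta> t = t + \<theta> * tent c \<Lambda> t"

text \<open>The derivative of \<open>tent_map\<close> away from its three kinks. Being constant on
  each flank, it turns \<open>mean_tm_core\<close> into an exact computation.\<close>

definition tent_dens :: "real \<Rightarrow> real \<Rightarrow> real \<Rightarrow> real \<Rightarrow> real" where
  "tent_dens c \<Lambda> \<theta> t = 1 + \<theta> * (indicator {c - \<Lambda>..<c} t - indicator {c..<c + \<Lambda>} t)"

lemma tent_map_measurable [measurable]: "tent_map c \<Lambda> \<theta> \<in> borel_measurable borel"
  unfolding tent_map_def[abs_def] tent_def by measurable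

lemma tent_dens_measurable [measurable]: "tent_dens c \<Lambda> \<theta> \<in> borel_measurable borel"
  unfolding tent_dens_def[abs_def] by measurable

lemma tent_map_continuous: "continuous_on S (tent_map c \<Lambda> \<theta>)"
  unfolding tent_map_def[abs_def] tent_def by (intro continuous_intros)

lemma tent_lipschitz: "\<bar>tent c \<Lambda> s - tent c \<Lambda> t\<bar> \<le> \<bar>s - t\<bar>"
  unfolding tent_def by (auto simp: max_def abs_if)

lemma tent_map_strict_mono:
  assumes "\<bar>\<theta>\<bar> < 1" "s < t" shows "tent_map c \<Lambda> \<theta> s < tent_map c \<Lambda> \<theta> t"
proof -
  have "\<bar>\<theta> * (tent c \<Lambda> s - tent c \<Lambda> t)\<bar> \<le> \<bar>\<theta>\<bar> * \<bar>s - t\<bar>"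
    using tent_lipschitz[of c \<Lambda> s t] by (simp add: abs_mult mult_left_mono)
  also have "\<dots> < 1 * \<bar>s - t\<bar>" using assms by (intro mult_strict_right_mono) auto
  finally show ?thesis using assms unfolding tent_map_def by (auto simp: abs_if algebra_simps split: if_splits)
qed

lemma tent_dens_integral:
  assumes "0 \<le> \<Lambda>" "0 \<le> c - \<Lambda>" "0 \<le> s"
  shows "(tent_dens c \<Lambda> \<theta> has_integral tent_map c \<Lambda> \<theta> s) {0..s}"
proof -
  have "(tent_dens c \<Lambda> \<theta> has_integral (tent_map c \<Lambda> \<theta> s - tent_map c \<Lambda> \<theta> 0)) {0..s}"
  proof (rule fundamental_theorem_of_calculus_interior_strong[where S = "{c - \<Lambda>, c, c + \<Lambda>}"])
    fix t assume t: "t \<in> {0<..<s} - {c - \<Lambda>, c, c + \<Lambda>}"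
    have ev: "(tent_map c \<Lambda> \<theta> has_real_derivative d) (at t)"
      if "open S" "t \<in> S" "\<And>z. z \<in> S \<Longrightarrow> tent_map c \<Lambda> \<theta> z = g z" "(g has_real_derivative d) (at t)" for S g d
      by (rule has_field_derivative_transform_within_open[OF that(4,1,2)]) (use that(3) in auto)
    consider "t < c - \<Lambda>" | "c - \<Lambda> < t" "t < c" | "c < t" "t < c + \<Lambda>" | "c + \<Lambda> < t" using t by force
    then have "(tent_map c \<Lambda> \<theta> has_real_derivative tent_dens c \<Lambda> \<theta> t) (at t)"
    proof cases
      case 1 then show ?thesis
        by (intro ev[where S = "{..<c - \<Lambda>}" and g = "\<lambda>z. z"])
          (use assms in \<open>auto simp: tent_map_def tent_def tent_dens_def indicator_def max_def abs_if intro!: derivative_eq_intros\<close>)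
    next
      case 2 then show ?thesis
        by (intro ev[where S = "{c - \<Lambda><..<c}" and g = "\<lambda>z. z + \<theta> * (\<Lambda> + z - c)"])
          (use assms in \<open>auto simp: tent_map_def tent_def tent_dens_def indicator_def max_def abs_if intro!: derivative_eq_intros\<close>)
    next
      case 3 then show ?thesis
        by (intro ev[where S = "{c<..<c + \<Lambda>}" and g = "\<lambda>z. z + \<theta> * (\<Lambda> - z + c)"])
          (use assms in \<open>auto simp: tent_map_def tent_def tent_dens_def indicator_def max_def abs_if intro!: derivative_eq_intros\<close>)
    next
      case 4 then show ?thesis
        by (intro ev[where S = "{c + \<Lambda><..}" and g = "\<lambda>z. z"])
          (use assms in \<open>auto simp: tent_map_def tent_def tent_dens_def indicator_def max_def abs_if intro!: derivative_eq_intros\<close>)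
    qed
    then show "(tent_map c \<Lambda> \<theta> has_vector_derivative tent_dens c \<Lambda> \<theta> t) (at t)"
      by (simp add: has_real_derivative_iff_has_vector_derivative)
  qed (use assms tent_map_continuous in auto)
  moreover have "tent_map c \<Lambda> \<theta> 0 = 0" using assms by (simp add: tent_map_def tent_def)
  ultimately show ?thesis by simp
qed

lemma tent_dens_bounds:
  assumes "\<bar>\<theta>\<bar> \<le> 1"
  shows "1 - \<bar>\<theta>\<bar> \<le> tent_dens c \<Lambda> \<theta> t" "tent_dens c \<Lambda> \<theta> t \<le> 1 + \<bar>\<theta>\<bar>" "0 \<le> tent_dens c \<Lambda> \<theta> t"
  using assms unfolding tent_dens_def by (auto simp: indicator_def)

lemma emeasure_tent_dens:
  assumes "0 \<le> \<Lambda>" "0 \<le> c - \<Lambda>" "0 \<le> s" "s \<le> 1" "\<bar>\<theta>\<bar> \<le> 1"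
  shows "emeasure (density unif01 (tent_dens c \<Lambda> \<theta>)) {..s} = ennreal (tent_map c \<Lambda> \<theta> s)"
proof -
  have "emeasure (density unif01 (tent_dens c \<Lambda> \<theta>)) {..s}
      = (\<integral>\<^sup>+t. ennreal (tent_dens c \<Lambda> \<theta> t) * indicator {..s} t \<partial>unif01)"
    by (subst emeasure_density) auto
  also have "\<dots> = (\<integral>\<^sup>+t. ennreal (tent_dens c \<Lambda> \<theta> t) * indicator {..s} t * indicator {0..1} t \<partial>lborel)"
    by (rule nn_integral_unif01) measurable
  also have "\<dots> = (\<integral>\<^sup>+t. ennreal (tent_dens c \<Lambda> \<theta> t * indicator {0..s} t) \<partial>lborel)"
    using assms by (intro nn_integral_cong) (auto simp: indicator_def)
  also have "\<dots> = ennreal (tent_map c \<Lambda> \<theta> s)"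
  proof (rule nn_integral_has_integral_lborel)
    show "((\<lambda>t. tent_dens c \<Lambda> \<theta> t * indicator {0..s} t) has_integral tent_map c \<Lambda> \<theta> s) UNIV"
    proof -
      have "((\<lambda>t. if t \<in> {0..s} then tent_dens c \<Lambda> \<theta> t else 0) has_integral tent_map c \<Lambda> \<theta> s) UNIV"
        by (subst has_integral_restrict_UNIV) (rule tent_dens_integral[OF assms(1-3)])
      moreover have "(\<lambda>t. if t \<in> {0..s} then tent_dens c \<Lambda> \<theta> t else 0) = (\<lambda>t. tent_dens c \<Lambda> \<theta> t * indicator {0..s} t)"
        by (auto simp: fun_eq_iff indicator_def)
      ultimately show ?thesis by simp
    qed
  qed (use tent_dens_bounds[OF assms(5)] in auto)
  finally show ?thesis .
qed

lemma prob_space_tent_dens: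
  assumes "0 \<le> \<Lambda>" "0 \<le> c - \<Lambda>" "c + \<Lambda> \<le> 1" "\<bar>\<theta>\<bar> \<le> 1"
  shows "prob_space (density unif01 (tent_dens c \<Lambda> \<theta>))"
proof
  let ?D = "density unif01 (tent_dens c \<Lambda> \<theta>)"
  have "AE t in ?D. t \<in> {..1}"
    by (subst AE_density, simp, rule eventually_mono[OF AE_unif01]) auto
  then have "emeasure ?D (space ?D) = emeasure ?D {..1}"
    by (intro emeasure_eq_AE) (auto elim!: eventually_mono)
  also have "\<dots> = ennreal (tent_map c \<Lambda> \<theta> 1)" by (rule emeasure_tent_dens) (use assms in auto)
  also have "tent_map c \<Lambda> \<theta> 1 = 1" using assms by (simp add: tent_map_def tent_def)
  finally show "emeasure ?D (space ?D) = 1" by simp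
qed

text \<open>The density is the derivative of the map, so it gives \<open>{..s}\<close> the mass
  \<open>tent_map c \<Lambda> \<theta> s\<close>. Taking for \<open>s\<close> the preimage of
  \<open>x\<close> yields the uniform distribution function.\<close>

lemma distr_tent_map:
  assumes "0 \<le> \<Lambda>" "0 \<le> c - \<Lambda>" "c + \<Lambda> \<le> 1" "\<bar>\<theta>\<bar> < 1"
  shows "distr (density unif01 (tent_dens c \<Lambda> \<theta>)) borel (tent_map c \<Lambda> \<theta>) = unif01"
proof -
  let ?D = "density unif01 (tent_dens c \<Lambda> \<theta>)" and ?f = "tent_map c \<Lambda> \<theta>"
  let ?N = "distr ?D borel ?f"
  interpret D: prob_space ?D by (rule prob_space_tent_dens) (use assms in auto)
  have mono: "?f s \<le> ?f t \<longleftrightarrow> s \<le> t" for s t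
    using tent_map_strict_mono[OF assms(4), of s t c \<Lambda>] tent_map_strict_mono[OF assms(4), of t s c \<Lambda>]
    by (cases s t rule: linorder_cases) auto
  have f01: "?f 0 = 0" "?f 1 = 1" using assms by (auto simp: tent_map_def tent_def)
  have "prob_space ?N" by (rule D.prob_space_distr) simp
  then have rd: "real_distribution ?N"
    by (simp add: real_distribution_def real_distribution_axioms_def)
  have "cdf ?N x = cdf unif01 x" for x
  proof -
    have "cdf ?N x = measure ?D {t. ?f t \<le> x}"
      unfolding cdf_def by (subst measure_distr) (auto simp: vimage_def)
    also have "\<dots> = max 0 (min 1 x)"
    proof (cases "x < 0")
      case True
      have "AE t in ?D. \<not> ?f t \<le> x"
      proof (subst AE_density, simp, rule eventually_mono[OF AE_unif01], intro impI notI)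
        fix t assume t: "t \<in> {0..1::real}" "?f t \<le> x"
        then show False using mono[of 0 t] f01 True by auto
      qed
      then have "measure ?D {t. ?f t \<le> x} = 0"
        by (subst D.prob_eq_0) auto
      then show ?thesis using True by simp
    next
      case False
      define x' where "x' = min 1 x"
      have x': "0 \<le> x'" "x' \<le> 1" using False by (auto simp: x'_def)
      obtain s where s: "0 \<le> s" "s \<le> 1" "?f s = x'"
        using IVT'[of ?f 0 x' 1] f01 x' tent_map_continuous by auto
      have "AE t in ?D. ?f t \<le> x \<longleftrightarrow> t \<le> s"
      proof (subst AE_density, simp, rule eventually_mono[OF AE_unif01], intro impI)
        fix t assume t: "t \<in> {0..1::real}"
        then show "?f t \<le> x \<longleftrightarrow> t \<le> s" using mono[of t 1] mono[of t s] s(3) f01 by (auto simp: x'_def)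
      qed
      then have "measure ?D {t. ?f t \<le> x} = measure ?D {..s}"
        by (intro measure_eq_AE) auto
      also have "\<dots> = ?f s" using emeasure_tent_dens[OF assms(1,2) s(1,2), of \<theta>] assms x' s(3)
        by (simp add: measure_def)
      finally show ?thesis using s x' by (simp add: x'_def)
    qed
    finally show ?thesis by (simp add: cdf_unif01)
  qed
  then show ?thesis by (intro cdf_unique[OF rd real_distribution_unif01]) auto
qed

section \<open>Product densities and the change of variables for whole samples\<close>

lemma PiM_density_finite:
  assumes I: "finite I" and D: "prob_space D"
    and w[measurable]: "w \<in> borel_measurable D" and Dw: "prob_space (density D w)"
  shows "PiM I (\<lambda>_. density D w) = density (PiM I (\<lambda>_. D)) (\<lambda>y. \<Prod>i\<in>I. w (y i))"
proof -
  interpret D: prob_space D by fact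
  interpret Dw: prob_space "density D w" by fact
  interpret S: product_sigma_finite "\<lambda>_. D" ..
  interpret Sw: product_sigma_finite "\<lambda>_. density D w" ..
  show ?thesis
  proof (rule Sw.PiM_eqI[symmetric])
    show "sets (density (PiM I (\<lambda>_. D)) (\<lambda>y. \<Prod>i\<in>I. w (y i))) = sets (PiM I (\<lambda>_. density D w))"
      by (simp cong: sets_PiM_cong)
    fix B assume B: "\<And>i. i \<in> I \<Longrightarrow> B i \<in> sets (density D w)"
    have [measurable]: "Pi\<^sub>E I B \<in> sets (PiM I (\<lambda>_. D))"
      using B I by (intro sets_PiM_I_finite) auto
    have "emeasure (density (PiM I (\<lambda>_. D)) (\<lambda>y. \<Prod>i\<in>I. w (y i))) (Pi\<^sub>E I B)
        = (\<integral>\<^sup>+y. (\<Prod>i\<in>I. w (y i)) * indicator (Pi\<^sub>E I B) y \<partial>PiM I (\<lambda>_. D))"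
      by (rule emeasure_density) auto
    also have "\<dots> = (\<integral>\<^sup>+y. (\<Prod>i\<in>I. w (y i) * indicator (B i) (y i)) \<partial>PiM I (\<lambda>_. D))"
    proof (rule nn_integral_cong)
      fix y assume "y \<in> space (PiM I (\<lambda>_. D))"
      then have "(indicator (Pi\<^sub>E I B) y :: ennreal) = (\<Prod>i\<in>I. indicator (B i) (y i))"
        using I by (auto simp: indicator_def space_PiM PiE_iff)
      then show "(\<Prod>i\<in>I. w (y i)) * indicator (Pi\<^sub>E I B) y = (\<Prod>i\<in>I. w (y i) * indicator (B i) (y i))"
        by (simp add: prod.distrib)
    qed
    also have "\<dots> = (\<Prod>i\<in>I. \<integral>\<^sup>+t. w t * indicator (B i) t \<partial>D)"
      by (rule S.product_nn_integral_prod) (use I B in auto)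
    also have "\<dots> = (\<Prod>i\<in>I. emeasure (density D w) (B i))"
      by (rule prod.cong) (use B in \<open>auto simp: emeasure_density\<close>)
    finally show "emeasure (density (PiM I (\<lambda>_. D)) (\<lambda>y. \<Prod>i\<in>I. w (y i))) (Pi\<^sub>E I B)
        = (\<Prod>i\<in>I. emeasure (density D w) (B i))" .
  qed (use I in auto)
qed

text \<open>Applied with \<open>g\<close> the indicator of a target event: if a source event is
  mapped into the target and the Jacobian is at least 1/2 there, the source has at most twice the
  probability of the target.\<close>

lemma tent_map_change_of_variables:
  fixes n :: nat
  assumes "0 \<le> \<Lambda>" "0 \<le> c - \<Lambda>" "c + \<Lambda> \<le> 1" "\<bar>\<theta>\<bar> < 1"
    and g[measurable]: "g \<in> borel_measurable (PiM {..<n} (\<lambda>_. unif01))"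
  shows "(\<integral>\<^sup>+y. g y \<partial>PiM {..<n} (\<lambda>_. unif01))
    = (\<integral>\<^sup>+y. ennreal (\<Prod>i<n. tent_dens c \<Lambda> \<theta> (y i)) * g (compose {..<n} (tent_map c \<Lambda> \<theta>) y) \<partial>PiM {..<n} (\<lambda>_. unif01))"
proof -
  let ?D = "density unif01 (tent_dens c \<Lambda> \<theta>)" and ?f = "tent_map c \<Lambda> \<theta>"
  let ?M = "PiM {..<n} (\<lambda>_. unif01)"
  have pD: "prob_space ?D" by (rule prob_space_tent_dens) (use assms in auto)
  have d: "PiM {..<n} (\<lambda>_. ?D) = density ?M (\<lambda>y. \<Prod>i<n. ennreal (tent_dens c \<Lambda> \<theta> (y i)))"
    by (rule PiM_density_finite) (use pD prob_space_unif01 in auto)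
  have cs: "sets (PiM {..<n} (\<lambda>_. ?D)) = sets ?M" by (simp cong: sets_PiM_cong)
  have [measurable]: "compose {..<n} ?f \<in> measurable ?M ?M"
    unfolding compose_def by measurable
  have "?M = PiM {..<n} (\<lambda>_. distr ?D unif01 ?f)"
  proof (rule PiM_cong)
    have "distr ?D unif01 ?f = distr ?D borel ?f" by (rule distr_cong) auto
    then show "unif01 = distr ?D unif01 ?f" using distr_tent_map[OF assms(1-4)] by simp
  qed simp
  also have "\<dots> = distr (PiM {..<n} (\<lambda>_. ?D)) ?M (compose {..<n} ?f)"
    by (rule distr_PiM_finite_prob_space'[symmetric]) (use pD prob_space_unif01 in auto)
  finally have "(\<integral>\<^sup>+y. g y \<partial>?M) = (\<integral>\<^sup>+y. g y \<partial>distr (PiM {..<n} (\<lambda>_. ?D)) ?M (compose {..<n} ?f))" by simp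
  also have "\<dots> = (\<integral>\<^sup>+y. g (compose {..<n} ?f y) \<partial>PiM {..<n} (\<lambda>_. ?D))"
    by (rule nn_integral_distr) (use cs in \<open>auto cong: measurable_cong_sets\<close>)
  also have "\<dots> = (\<integral>\<^sup>+y. (\<Prod>i<n. ennreal (tent_dens c \<Lambda> \<theta> (y i))) * g (compose {..<n} ?f y) \<partial>?M)"
    unfolding d by (rule nn_integral_density) auto
  also have "\<dots> = (\<integral>\<^sup>+y. ennreal (\<Prod>i<n. tent_dens c \<Lambda> \<theta> (y i)) * g (compose {..<n} ?f y) \<partial>?M)"
    using tent_dens_bounds(3)[of \<theta> c \<Lambda>] assms(4) by (simp add: prod_ennreal)
  finally show ?thesis .
qed

section \<open>The kernel process\<close>

locale kernel_process =
  fixes K :: "real \<Rightarrow> real" and C h :: real and n :: nat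
  assumes K_nonneg: "\<And>z. 0 \<le> K z"
    and K_int: "(K has_integral 1) UNIV"
    and K_lip: "\<And>x y. \<bar>K x - K y\<bar> \<le> C * \<bar>x - y\<bar>"
    and K_supp: "\<And>z. \<bar>z\<bar> > 1 \<Longrightarrow> K z = 0"
    and C1: "1 \<le> C" and h0: "0 < h" and h_le: "h \<le> 1/4" and nh1: "4 * C \<le> real n * h"
begin

abbreviation kh :: "real \<Rightarrow> real" where "kh \<equiv> Kh K h"
abbreviation "UM \<equiv> PiM {..<n} (\<lambda>_. unif01)"

sublocale UM: prob_space UM
  by (rule prob_space_PiM) (rule prob_space_unif01)

lemma n0: "0 < n" "0 < real n"
  using nh1 C1 h0 by (auto intro: gr0I)

text \<open>The support condition says nothing at \<open>\<bar>z\<bar> = 1\<close>; the Lipschitz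
  bound carries the value 0 over from points just outside.\<close>

lemma K_zero:
  assumes "\<bar>z\<bar> \<ge> 1" shows "K z = 0"
proof (cases "\<bar>z\<bar> > 1")
  case True then show ?thesis by (rule K_supp)
next
  case False
  then have z: "\<bar>z\<bar> = 1" using assms by simp
  have "K z \<le> 0 + e" if e: "e > 0" for e
  proof -
    define d where "d = e / C"
    have d: "d > 0" "C * d = e" using e C1 by (auto simp: d_def)
    have "\<bar>z * (1 + d)\<bar> = 1 + d" unfolding abs_mult z using d by simp
    then have "K (z * (1 + d)) = 0" using d by (intro K_supp) linarith
    then have "K z \<le> C * \<bar>z - z * (1 + d)\<bar>" using K_lip[of z "z * (1 + d)"] by linarith
    also have "z - z * (1 + d) = - (z * d)" by (simp add: distrib_left)
    also have "\<bar>- (z * d)\<bar> = d" unfolding abs_minus_cancel abs_mult z using d by simp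
    finally show ?thesis using d by simp
  qed
  then have "K z \<le> 0" by (rule field_le_epsilon)
  then show ?thesis using K_nonneg[of z] by auto
qed

text \<open>The endpoint \<open>sgn z\<close> on the side of \<open>z\<close> lies at distance at
  most 1 and \<open>K\<close> vanishes there. At \<open>z = 0\<close> the sign is 0, so the endpoint
  1 is used instead.\<close>

lemma K_le: "K z \<le> C"
proof (cases "\<bar>z\<bar> < 1")
  case True
  have "K (sgn z) = 0 \<or> z = 0" by (cases "z = 0") (auto intro!: K_zero simp: sgn_if)
  moreover have "K z \<le> C * \<bar>z - sgn z\<bar>" if "K (sgn z) = 0" using K_lip[of z "sgn z"] that by auto
  moreover have "\<bar>z - sgn z\<bar> \<le> 1" using True by (auto simp: sgn_if)
  moreover have "C * \<bar>z - sgn z\<bar> \<le> C * 1" using C1 \<open>\<bar>z - sgn z\<bar> \<le> 1\<close> by (intro mult_left_mono) auto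
  moreover have "K 0 \<le> C" using K_lip[of 0 1] K_zero[of 1] by auto
  ultimately show ?thesis by auto
qed (use K_zero[of z] C1 in auto)

lemma K_cont: "continuous_on UNIV K"
proof (rule continuous_onI)
  fix x e :: real assume e: "0 < e"
  have "dist (K y) (K x) \<le> e" if "dist y x < e / C" for y
  proof -
    have "\<bar>K y - K x\<bar> \<le> C * \<bar>y - x\<bar>" by (rule K_lip)
    also have "\<dots> \<le> C * (e / C)" using that C1 by (intro mult_left_mono) (auto simp: dist_real_def)
    finally show ?thesis using C1 by (simp add: dist_real_def)
  qed
  then show "\<exists>d>0. \<forall>y\<in>UNIV. dist y x < d \<longrightarrow> dist (K y) (K x) \<le> e"
    using e C1 by (intro exI[of _ "e / C"]) auto
qed

lemma K_measurable [measurable]: "K \<in> borel_measurable borel"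
  by (rule borel_measurable_continuous_onI) (rule K_cont)

lemma kh_measurable [measurable]: "kh \<in> borel_measurable borel"
  unfolding Kh_def[abs_def] by measurable

lemma kh_nonneg: "0 \<le> kh z"
  using K_nonneg h0 by (simp add: Kh_def)

lemma kh_le: "kh z \<le> C / h"
  using K_le h0 by (simp add: Kh_def divide_right_mono)

lemma kh_abs_le: "\<bar>kh z\<bar> \<le> C / h"
  using kh_le kh_nonneg[of z] by simp

lemma kh_zero: "\<bar>z\<bar> \<ge> h \<Longrightarrow> kh z = 0"
  using h0 by (simp add: Kh_def K_zero)

lemma kh_lip: "\<bar>kh x - kh y\<bar> \<le> C / h\<^sup>2 * \<bar>x - y\<bar>"
proof -
  have "kh x - kh y = (K (x / h) - K (y / h)) / h" by (simp add: Kh_def diff_divide_distrib)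
  then have "\<bar>kh x - kh y\<bar> = \<bar>K (x / h) - K (y / h)\<bar> / h" using h0 by (simp only: abs_divide abs_of_pos)
  also have "\<dots> \<le> C * \<bar>x / h - y / h\<bar> / h" using K_lip h0 by (intro divide_right_mono) auto
  also have "\<bar>x / h - y / h\<bar> = \<bar>x - y\<bar> / h"
    using h0 by (simp only: diff_divide_distrib[symmetric] abs_divide abs_of_pos)
  finally show ?thesis by (simp add: power2_eq_square)
qed

text \<open>At distance at least \<open>h\<close> from both ends the kernel window lies inside the
  unit interval, so restricting to \<open>{0..1}\<close> loses no mass.\<close>

lemma kh_nn_integral:
  assumes "u \<in> {h..1-h}"
  shows "(\<integral>\<^sup>+t. ennreal (kh (u - t) * indicator {0..1} t) \<partial>lborel) = 1"
proof -
  have "(\<integral>\<^sup>+z. ennreal (K z) \<partial>lborel) = ennreal 1"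
    by (rule nn_integral_has_integral_lborel) (use K_nonneg K_int in auto)
  also have "(\<integral>\<^sup>+z. ennreal (K z) \<partial>lborel) = ennreal \<bar>- 1 / h\<bar> * (\<integral>\<^sup>+t. ennreal (K (u / h + (- 1 / h) * t)) \<partial>lborel)"
    by (rule nn_integral_real_affine) (use h0 in auto)
  also have "\<dots> = (\<integral>\<^sup>+t. ennreal \<bar>- 1 / h\<bar> * ennreal (K (u / h + (- 1 / h) * t)) \<partial>lborel)"
    by (rule nn_integral_cmult[symmetric]) measurable
  also have "\<dots> = (\<integral>\<^sup>+t. ennreal (kh (u - t) * indicator {0..1} t) \<partial>lborel)"
  proof (rule nn_integral_cong)
    fix t
    have "ennreal \<bar>- 1 / h\<bar> * ennreal (K (u / h + (- 1 / h) * t)) = ennreal (kh (u - t))"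
      using h0 K_nonneg by (simp add: ennreal_mult[symmetric] Kh_def diff_divide_distrib)
    also have "kh (u - t) = kh (u - t) * indicator {0..1} t"
      using assms kh_zero[of "u - t"] by (cases "h \<le> \<bar>u - t\<bar>") (auto simp: indicator_def)
    finally show "ennreal \<bar>- 1 / h\<bar> * ennreal (K (u / h + (- 1 / h) * t)) = ennreal (kh (u - t) * indicator {0..1} t)" .
  qed
  finally show ?thesis by simp
qed

lemma kh_integral_unif:
  assumes "u \<in> {h..1-h}" shows "(\<integral>t. kh (u - t) \<partial>unif01) = 1"
proof -
  have "(\<integral>\<^sup>+t. ennreal (kh (u - t)) \<partial>unif01) = (\<integral>\<^sup>+t. ennreal (kh (u - t)) * indicator {0..1} t \<partial>lborel)"
    by (rule nn_integral_unif01) measurable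
  also have "\<dots> = (\<integral>\<^sup>+t. ennreal (kh (u - t) * indicator {0..1} t) \<partial>lborel)"
    by (intro nn_integral_cong) (auto simp: indicator_def)
  also have "\<dots> = 1" by (rule kh_nn_integral[OF assms])
  finally show ?thesis
    by (subst integral_eq_nn_integral) (auto simp: kh_nonneg)
qed

lemma kh_integral_HK:
  assumes "u \<in> {h..1-h}" shows "integral {0..1} (\<lambda>t. kh (u - t)) = 1"
proof -
  have "((\<lambda>t. kh (u - t) * indicator {0..1} t) has_integral 1) UNIV"
    by (rule nn_integral_has_integral) (use kh_nn_integral[OF assms] kh_nonneg in auto)
  moreover have "(\<lambda>t. kh (u - t) * indicator {0..1} t) = (\<lambda>t. if t \<in> {0..1} then kh (u - t) else 0)"
    by (auto simp: fun_eq_iff indicator_def)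
  ultimately have "((\<lambda>t. kh (u - t)) has_integral 1) {0..1}" by (simp only: has_integral_restrict_UNIV)
  then show ?thesis by (rule integral_unique)
qed

text \<open>Centred by \<open>n\<close> rather than by the integral occurring in \<open>Gnh\<close>.
  The two agree exactly when the window stays in the unit interval, which is the only range of
  \<open>u\<close> considered.\<close>

definition Gp :: "real \<Rightarrow> (nat \<Rightarrow> real) \<Rightarrow> real" where
  "Gp u y = sqrt (real n * h) / real n * ((\<Sum>i<n. kh (u - y i)) - real n)"

lemma Gnh_eq_Gp: "u \<in> {h..1-h} \<Longrightarrow> Gnh K h n y u = Gp u y"
  by (simp add: Gnh_def Gp_def kh_integral_HK sum_subtractf)

lemma Gp_measurable [measurable]: "Gp u \<in> borel_measurable UM"
  unfolding Gp_def[abs_def] by measurable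

lemma integrable_unif01:
  fixes f :: "real \<Rightarrow> real"
  assumes [measurable]: "f \<in> borel_measurable borel" and "\<And>t. \<bar>f t\<bar> \<le> B"
  shows "integrable unif01 f"
proof -
  interpret prob_space unif01 by (rule prob_space_unif01)
  show ?thesis by (rule integrable_const_bound[of _ B]) (use assms in auto)
qed

text \<open>A kernel bounded by \<open>C / h\<close> with mean 1 has second moment at most
  \<open>C / h\<close>. After normalisation the deviations have order \<open>sqrt C\<close>, free of
  \<open>n\<close> and \<open>h\<close>.\<close>

lemma Gp_tail:
  assumes u: "u \<in> {h..1-h}"
  shows "measure UM {y \<in> space UM. \<nu> * sqrt C \<le> \<bar>Gp u y\<bar>} \<le> 2 * exp (1 - \<nu>)"
proof -
  let ?f = "\<lambda>t. kh (u - t)"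
  have i1: "integrable unif01 ?f" by (rule integrable_unif01[of _ "C / h"]) (auto simp: kh_abs_le)
  have "(\<integral>t. (?f t)\<^sup>2 \<partial>unif01) \<le> (\<integral>t. C / h * ?f t \<partial>unif01)"
  proof (rule integral_mono)
    have *: "(?f t)\<^sup>2 \<le> (C / h)\<^sup>2" for t using kh_nonneg kh_le by (rule power_mono[rotated])
    show "integrable unif01 (\<lambda>t. (?f t)\<^sup>2)"
      by (rule integrable_unif01[of _ "(C / h)\<^sup>2"]) (use * in auto)
    show "(?f t)\<^sup>2 \<le> C / h * ?f t" for t
      unfolding power2_eq_square by (intro mult_right_mono kh_le kh_nonneg)
  qed (use i1 in auto)
  also have "\<dots> = C / h" using kh_integral_unif[OF u] by simp
  finally have var: "(\<integral>t. (?f t)\<^sup>2 \<partial>unif01) \<le> C / h" .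
  let ?V = "real n * (C / h)"
  have V0: "0 < ?V" using n0 C1 h0 by simp
  have "4 * (C / h)\<^sup>2 = (4 * C) * (C / h\<^sup>2)" by (simp add: power2_eq_square)
  also have "\<dots> \<le> (real n * h) * (C / h\<^sup>2)" using nh1 C1 by (intro mult_right_mono) auto
  also have "\<dots> = ?V" using h0 by (simp add: power2_eq_square)
  finally have V1: "4 * (C / h)\<^sup>2 \<le> ?V" .
  have "measure UM {y \<in> space UM. \<nu> * sqrt ?V \<le> \<bar>(\<Sum>i<n. ?f (y i)) - real n * integral\<^sup>L unif01 ?f\<bar>} \<le> 2 * exp (1 - \<nu>)"
    by (rule chernoff[OF prob_space_unif01 _ _ kh_abs_le var order_refl V1 V0]) auto
  moreover have "\<nu> * sqrt ?V \<le> \<bar>(\<Sum>i<n. ?f (y i)) - real n * integral\<^sup>L unif01 ?f\<bar> \<longleftrightarrow> \<nu> * sqrt C \<le> \<bar>Gp u y\<bar>" for y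
  proof -
    have e: "sqrt (real n * h) / real n * sqrt ?V = sqrt C"
    proof -
      have "sqrt (real n * h) * sqrt ?V = sqrt ((real n)\<^sup>2 * C)"
        using h0 by (simp add: real_sqrt_mult[symmetric] power2_eq_square)
      then show ?thesis using n0 by (simp add: real_sqrt_mult)
    qed
    have p: "0 < sqrt (real n * h) / real n" using n0 h0 by simp
    have "\<nu> * sqrt ?V \<le> \<bar>(\<Sum>i<n. ?f (y i)) - real n\<bar> \<longleftrightarrow>
       sqrt (real n * h) / real n * (\<nu> * sqrt ?V) \<le> sqrt (real n * h) / real n * \<bar>(\<Sum>i<n. ?f (y i)) - real n\<bar>"
      using p by (simp only: mult_le_cancel_left_pos)
    also have "sqrt (real n * h) / real n * (\<nu> * sqrt ?V) = \<nu> * sqrt C"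
      using e by (metis mult.left_commute)
    also have "sqrt (real n * h) / real n * \<bar>(\<Sum>i<n. ?f (y i)) - real n\<bar> = \<bar>Gp u y\<bar>"
      using p by (simp only: Gp_def abs_mult abs_of_pos)
    finally show ?thesis using kh_integral_unif[OF u] by simp
  qed
  ultimately show ?thesis by simp
qed

end

section \<open>Effect of the transport on the kernel process\<close>

locale kernel_transport = kernel_process +
  fixes c \<Lambda> \<theta> :: real
  assumes \<Lambda>0: "0 < \<Lambda>" and c0: "0 \<le> c - \<Lambda>" and c1: "c + \<Lambda> \<le> 1"
    and \<theta>_half: "\<bar>\<theta>\<bar> \<le> 1/2" and \<theta>0: "\<theta> \<noteq> 0" and \<theta>\<Lambda>: "\<bar>\<theta>\<bar> * \<Lambda> \<le> h"
begin

abbreviation "tm \<equiv> tent_map c \<Lambda> \<theta>"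
abbreviation "td \<equiv> tent_dens c \<Lambda> \<theta>"

text \<open>The expected kernel value when the points are moved while the underlying law stays
  uniform. Its distance from 1 is the drift caused by the transport.\<close>

definition mean_tm :: "real \<Rightarrow> real" where
  "mean_tm u = (\<integral>t. kh (u - tm t) \<partial>unif01)"

lemma tm_outside: "\<bar>t - c\<bar> \<ge> \<Lambda> \<Longrightarrow> tm t = t"
  by (simp add: tent_map_def tent_def)

lemma tm_less_iff: "tm s < tm t \<longleftrightarrow> s < t"
  using tent_map_strict_mono[of \<theta> s t c \<Lambda>] tent_map_strict_mono[of \<theta> t s c \<Lambda>] \<theta>_half
  by (cases s t rule: linorder_cases) auto

lemma tm_inside: "\<bar>t - c\<bar> < \<Lambda> \<Longrightarrow> \<bar>tm t - c\<bar> < \<Lambda>"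
  using tm_less_iff[of "c - \<Lambda>" t] tm_less_iff[of t "c + \<Lambda>"] tm_outside[of "c - \<Lambda>"] tm_outside[of "c + \<Lambda>"] \<Lambda>0
  by (auto simp: abs_less_iff)

lemma tm_near: "\<bar>tm t - t\<bar> \<le> \<bar>\<theta>\<bar> * \<Lambda>"
proof -
  have "0 \<le> tent c \<Lambda> t" "tent c \<Lambda> t \<le> \<Lambda>" using \<Lambda>0 by (auto simp: tent_def)
  then show ?thesis by (simp add: tent_map_def abs_mult mult_left_mono)
qed

lemma kh_tm_far: "\<bar>u - c\<bar> \<ge> \<Lambda> + h \<Longrightarrow> kh (u - tm t) = kh (u - t)"
  using tm_outside[of t] tm_inside[of t] kh_zero[of "u - t"] kh_zero[of "u - tm t"]
  by (cases "\<bar>t - c\<bar> < \<Lambda>") auto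

lemma integrable_kh_tm: "integrable unif01 (\<lambda>t. kh (u - tm t))"
  by (rule integrable_unif01[of _ "C / h"]) (auto simp: kh_abs_le)

lemma td_bounds: "1 - \<bar>\<theta>\<bar> \<le> td t" "td t \<le> 1 + \<bar>\<theta>\<bar>" "0 \<le> td t"
  using tent_dens_bounds[of \<theta> c \<Lambda> t] \<theta>_half by auto

lemma integrable_kh_tm_td: "integrable unif01 (\<lambda>t. kh (u - tm t) * td t)"
proof (rule integrable_unif01[of _ "C / h * 2"])
  fix t
  have "\<bar>td t\<bar> \<le> 2" using td_bounds[of t] \<theta>_half by auto
  then show "\<bar>kh (u - tm t) * td t\<bar> \<le> C / h * 2"
    unfolding abs_mult by (intro mult_mono kh_abs_le) (use C1 h0 in auto)
qed measurable

text \<open>Under the tent density the moved points are uniform again, so weighting with the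
  Jacobian restores the mean 1. Both estimates of \<open>mean_tm\<close> rest on this
  identity.\<close>

lemma kh_tm_weighted:
  assumes u: "u \<in> {h..1-h}"
  shows "(\<integral>t. kh (u - tm t) * td t \<partial>unif01) = 1"
proof -
  have "1 = (\<integral>t. kh (u - t) \<partial>unif01)" using kh_integral_unif[OF u] by simp
  also have "\<dots> = (\<integral>t. kh (u - t) \<partial>distr (density unif01 td) borel tm)"
    using distr_tent_map[of \<Lambda> c \<theta>] \<Lambda>0 c0 c1 \<theta>_half by simp
  also have "\<dots> = (\<integral>t. kh (u - tm t) \<partial>density unif01 td)"
    by (rule integral_distr) auto
  also have "\<dots> = (\<integral>t. td t *\<^sub>R kh (u - tm t) \<partial>unif01)"
    by (rule integral_density) (auto simp: td_bounds(3))
  finally show ?thesis by (simp add: mult.commute)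
qed

lemma mean_tm_nonneg: "0 \<le> mean_tm u"
  unfolding mean_tm_def by (rule integral_nonneg_AE) (auto simp: kh_nonneg)

text \<open>Comparison with the weighted mean gives \<open>\<bar>mean_tm u - 1\<bar> \<le>
  \<bar>\<theta>\<bar> * mean_tm u\<close>, and feeding the crude bound
  \<open>mean_tm u \<le> 2\<close> back in improves the right-hand side. The leading coefficient
  must be exactly 1: no point may be raised noticeably more than the points on the chosen
  flank.\<close>

lemma mean_tm_diff:
  assumes u: "u \<in> {h..1-h}"
  shows "\<bar>mean_tm u - 1\<bar> \<le> \<bar>\<theta>\<bar> + 2 * \<theta>\<^sup>2"
proof -
  let ?g = "\<lambda>t. kh (u - tm t) - kh (u - tm t) * td t"
  have i1: "integrable unif01 ?g"
    by (rule Bochner_Integration.integrable_diff[OF integrable_kh_tm integrable_kh_tm_td])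
  have i2: "integrable unif01 (\<lambda>t. \<bar>\<theta>\<bar> * kh (u - tm t))"
    by (rule integrable_mult_right[OF integrable_kh_tm])
  have i3: "integrable unif01 (\<lambda>t. \<bar>?g t\<bar>)" by (rule integrable_abs[OF i1])
  have "integral\<^sup>L unif01 ?g = mean_tm u - 1"
    unfolding mean_tm_def kh_tm_weighted[OF u, symmetric]
    by (rule Bochner_Integration.integral_diff[OF integrable_kh_tm integrable_kh_tm_td])
  then have "\<bar>mean_tm u - 1\<bar> \<le> (\<integral>t. \<bar>?g t\<bar> \<partial>unif01)"
    using integral_abs_bound[of unif01 ?g] by (simp only:)
  also have "\<dots> \<le> (\<integral>t. \<bar>\<theta>\<bar> * kh (u - tm t) \<partial>unif01)"
  proof (rule integral_mono[OF i3 i2])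
    fix t
    have "?g t = kh (u - tm t) * (1 - td t)" by (simp add: algebra_simps)
    then have "\<bar>?g t\<bar> = kh (u - tm t) * \<bar>1 - td t\<bar>" using kh_nonneg[of "u - tm t"] by (simp only: abs_mult abs_of_nonneg)
    also have "\<dots> \<le> kh (u - tm t) * \<bar>\<theta>\<bar>" using td_bounds[of t] kh_nonneg[of "u - tm t"] by (intro mult_left_mono) auto
    finally show "\<bar>?g t\<bar> \<le> \<bar>\<theta>\<bar> * kh (u - tm t)" by (simp only: mult.commute)
  qed
  also have "\<dots> = \<bar>\<theta>\<bar> * mean_tm u" by (simp add: mean_tm_def)
  finally have 1: "\<bar>mean_tm u - 1\<bar> \<le> \<bar>\<theta>\<bar> * mean_tm u" .
  have "\<bar>\<theta>\<bar> * mean_tm u \<le> 1/2 * mean_tm u" using \<theta>_half mean_tm_nonneg[of u] by (intro mult_right_mono) auto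
  then have "mean_tm u \<le> 2" using 1 by linarith
  then have "\<bar>mean_tm u - 1\<bar> \<le> \<bar>\<theta>\<bar> * 2" using 1 mult_left_mono[of "mean_tm u" 2 "\<bar>\<theta>\<bar>"] by linarith
  then have "\<bar>\<theta>\<bar> * mean_tm u \<le> \<bar>\<theta>\<bar> * (1 + \<bar>\<theta>\<bar> * 2)" by (intro mult_left_mono) auto
  moreover have "\<bar>\<theta>\<bar> * (1 + \<bar>\<theta>\<bar> * 2) = \<bar>\<theta>\<bar> + 2 * \<bar>\<theta>\<bar>\<^sup>2" unfolding power2_eq_square by algebra
  ultimately show ?thesis using 1 by simp
qed

text \<open>When the window around \<open>u\<close> is reached only from one flank, the density
  equals \<open>1 + \<zeta> * \<theta>\<close> wherever the kernel is nonzero, so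
  \<open>mean_tm u * (1 + \<zeta> * \<theta>) = 1\<close>. The sign \<open>\<zeta>\<close> is 1 on
  the left flank and -1 on the right one.\<close>

lemma mean_tm_core:
  assumes u: "u \<in> {h..1-h}" and \<zeta>: "\<zeta> \<in> {1, -1}" and core: "2 * h \<le> \<zeta> * (c - u)" "\<zeta> * (c - u) \<le> \<Lambda> - h"
  shows "\<bar>mean_tm u - 1 + \<zeta> * \<theta>\<bar> \<le> 2 * \<theta>\<^sup>2"
proof -
  have td: "td t = 1 + \<zeta> * \<theta>" if "kh (u - tm t) \<noteq> 0" for t
  proof -
    have 1: "\<bar>u - tm t\<bar> < h" using that kh_zero[of "u - tm t"] by force
    \<comment> \<open>The centre moves by at most \<open>h\<close> and the window has radius
      \<open>h\<close>; together they account for the margin \<open>2 * h\<close> in the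
      hypothesis.\<close>
    have tc: "\<bar>tm c - c\<bar> \<le> h" using tm_near[of c] \<theta>\<Lambda> by linarith
    show ?thesis
    proof (cases "\<zeta> = 1")
      case True
      have "tm (c - \<Lambda>) < tm t" "tm t < tm c"
        using 1 core tc tm_outside[of "c - \<Lambda>"] True \<Lambda>0 by (auto simp: abs_less_iff)
      then have "c - \<Lambda> < t" "t < c" by (simp_all add: tm_less_iff)
      then show ?thesis using True by (simp add: tent_dens_def)
    next
      case False
      then have z: "\<zeta> = -1" using \<zeta> by simp
      have "tm c < tm t" "tm t < tm (c + \<Lambda>)"
        using 1 core tc tm_outside[of "c + \<Lambda>"] z \<Lambda>0 by (auto simp: abs_less_iff)
      then have "c < t" "t < c + \<Lambda>" by (simp_all add: tm_less_iff)
      then show ?thesis using z by (simp add: tent_dens_def)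
    qed
  qed
  have "kh (u - tm t) * td t = kh (u - tm t) * (1 + \<zeta> * \<theta>)" for t
    using td[of t] by (cases "kh (u - tm t) = 0") auto
  then have "1 = (\<integral>t. kh (u - tm t) * (1 + \<zeta> * \<theta>) \<partial>unif01)" using kh_tm_weighted[OF u] by (simp only:)
  also have "\<dots> = mean_tm u * (1 + \<zeta> * \<theta>)" by (simp add: mean_tm_def)
  finally have e: "mean_tm u * (1 + \<zeta> * \<theta>) = 1" by simp
  define x where "x = \<zeta> * \<theta>"
  have x: "\<bar>x\<bar> \<le> 1/2" "x\<^sup>2 = \<theta>\<^sup>2" using \<zeta> \<theta>_half by (auto simp: x_def abs_mult)
  then have p: "1 + x > 0" by (auto simp: abs_le_iff)
  have m: "mean_tm u = 1 / (1 + x)" using e p by (simp add: x_def field_simps)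
  have "mean_tm u - 1 + x = x\<^sup>2 / (1 + x)" unfolding m using p by (simp add: field_simps power2_eq_square)
  then have "\<bar>mean_tm u - 1 + x\<bar> = x\<^sup>2 / (1 + x)" using p by simp
  also have "\<dots> \<le> x\<^sup>2 / (1/2)" using x by (intro divide_left_mono) (auto simp: abs_le_iff)
  finally have "\<bar>mean_tm u - 1 + x\<bar> \<le> 2 * x\<^sup>2" by simp
  then show ?thesis using x by (simp add: x_def)
qed

definition Gshift :: "real \<Rightarrow> real" where "Gshift u = sqrt (real n * h) * (mean_tm u - 1)"

lemma Gp_compose: "Gp u (compose {..<n} tm y) = sqrt (real n * h) / real n * ((\<Sum>i<n. kh (u - tm (y i))) - real n)"
  by (simp add: Gp_def compose_def)

lemma Gp_far: "\<bar>u - c\<bar> \<ge> \<Lambda> + h \<Longrightarrow> Gp u (compose {..<n} tm y) = Gp u y"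
  unfolding Gp_compose by (simp add: Gp_def kh_tm_far)

text \<open>Each summand changes by at most
  \<open>C * \<bar>\<theta>\<bar> * \<Lambda> / h\<^sup>2\<close>, and only for points within
  \<open>2 * h\<close> of \<open>u\<close>. The random part of the change is thus of order \<theta>
  \<Lambda> / h, whereas the drift \<open>Gshift\<close> is of order \<theta> sqrt (n h).\<close>

lemma transport_deviation:
  assumes u: "u \<in> {h..1-h}"
  shows "measure UM {y \<in> space UM. \<nu> * (2 * C * \<bar>\<theta>\<bar> * \<Lambda> / h) \<le> \<bar>Gp u (compose {..<n} tm y) - Gp u y - Gshift u\<bar>}
    \<le> 2 * exp (1 - \<nu>)"
proof -
  let ?f = "\<lambda>t. kh (u - tm t) - kh (u - t)"
  define b where "b = C * \<bar>\<theta>\<bar> * \<Lambda> / h\<^sup>2"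
  have b0: "0 < b" using C1 \<theta>0 \<Lambda>0 h0 by (simp add: b_def)
  have bd: "\<bar>?f t\<bar> \<le> b" for t
  proof -
    have "\<bar>?f t\<bar> \<le> C / h\<^sup>2 * \<bar>tm t - t\<bar>" using kh_lip[of "u - tm t" "u - t"] by (simp add: abs_minus_commute)
    also have "\<dots> \<le> C / h\<^sup>2 * (\<bar>\<theta>\<bar> * \<Lambda>)" using C1 by (intro mult_left_mono tm_near) auto
    finally show ?thesis by (simp add: b_def mult.assoc)
  qed
  have supp: "?f t = 0" if "t \<notin> {max 0 (u - 2*h)..min 1 (u + 2*h)}" "t \<in> {0..1}" for t
  proof -
    have "\<bar>u - t\<bar> \<ge> 2 * h" using that by auto
    then have "\<bar>u - t\<bar> \<ge> h" "\<bar>u - tm t\<bar> \<ge> h" using tm_near[of t] \<theta>\<Lambda> h0 by auto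
    then show ?thesis by (simp add: kh_zero)
  qed
  have "(\<integral>t. (?f t)\<^sup>2 \<partial>unif01) \<le> (\<integral>t. b\<^sup>2 * indicator {max 0 (u - 2*h)..min 1 (u + 2*h)} t \<partial>unif01)"
  proof (rule integral_mono_AE)
    have *: "(?f t)\<^sup>2 \<le> b\<^sup>2" for t using bd[of t] by (metis abs_ge_zero power_mono power2_abs)
    show "integrable unif01 (\<lambda>t. (?f t)\<^sup>2)"
      by (rule integrable_unif01[of _ "b\<^sup>2"]) (use * in auto)
    show "integrable unif01 (\<lambda>t. b\<^sup>2 * indicator {max 0 (u - 2*h)..min 1 (u + 2*h)} t)"
      by (rule integrable_unif01[of _ "b\<^sup>2"]) (auto simp: indicator_def)
    show "AE t in unif01. (?f t)\<^sup>2 \<le> b\<^sup>2 * indicator {max 0 (u - 2*h)..min 1 (u + 2*h)} t"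
      by (rule eventually_mono[OF AE_unif01]) (use supp * in \<open>auto simp: indicator_def\<close>)
  qed
  also have "\<dots> = b\<^sup>2 * (min 1 (u + 2*h) - max 0 (u - 2*h))"
    using u h0 by (simp add: measure_unif01_Icc)
  also have "\<dots> \<le> b\<^sup>2 * (4 * h)" by (intro mult_left_mono) auto
  finally have var: "(\<integral>t. (?f t)\<^sup>2 \<partial>unif01) \<le> b\<^sup>2 * (4 * h)" .
  let ?V = "real n * (b\<^sup>2 * (4 * h))"
  have V0: "0 < ?V" using n0 b0 h0 by simp
  have "4 * b\<^sup>2 * 1 \<le> 4 * b\<^sup>2 * (real n * h)" using nh1 C1 by (intro mult_left_mono) auto
  then have V1: "4 * b\<^sup>2 \<le> ?V" by (simp add: algebra_simps)
  have mean: "integral\<^sup>L unif01 ?f = mean_tm u - 1"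
    unfolding mean_tm_def kh_integral_unif[OF u, symmetric]
    by (rule Bochner_Integration.integral_diff[OF integrable_kh_tm]) (rule integrable_unif01[of _ "C / h"], auto simp: kh_abs_le)
  have "measure UM {y \<in> space UM. \<nu> * sqrt ?V \<le> \<bar>(\<Sum>i<n. ?f (y i)) - real n * integral\<^sup>L unif01 ?f\<bar>} \<le> 2 * exp (1 - \<nu>)"
    by (rule chernoff[OF prob_space_unif01 _ _ bd var order_refl V1 V0]) auto
  moreover have "\<nu> * sqrt ?V \<le> \<bar>(\<Sum>i<n. ?f (y i)) - real n * integral\<^sup>L unif01 ?f\<bar> \<longleftrightarrow>
      \<nu> * (2 * C * \<bar>\<theta>\<bar> * \<Lambda> / h) \<le> \<bar>Gp u (compose {..<n} tm y) - Gp u y - Gshift u\<bar>" for y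
  proof -
    let ?s = "sqrt (real n * h) / real n"
    have p: "0 < ?s" using n0 h0 by simp
    have e: "?s * sqrt ?V = 2 * C * \<bar>\<theta>\<bar> * \<Lambda> / h"
    proof -
      have "?V = (real n * h) * (2 * b)\<^sup>2" by (simp add: power2_eq_square)
      then have "sqrt ?V = sqrt (real n * h) * (2 * b)" using b0 by (simp only: real_sqrt_mult real_sqrt_abs)
      then have "?s * sqrt ?V = (sqrt (real n * h))\<^sup>2 / real n * (2 * b)" by (simp add: power2_eq_square)
      also have "\<dots> = h * (2 * b)" using n0 h0 by simp
      finally show ?thesis using h0 by (simp add: b_def power2_eq_square)
    qed
    have f: "?s * ((\<Sum>i<n. ?f (y i)) - real n * integral\<^sup>L unif01 ?f) = Gp u (compose {..<n} tm y) - Gp u y - Gshift u"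
      unfolding mean Gp_compose Gshift_def unfolding Gp_def sum_subtractf using n0 by (simp add: field_simps)
    have "\<nu> * sqrt ?V \<le> \<bar>(\<Sum>i<n. ?f (y i)) - real n * integral\<^sup>L unif01 ?f\<bar> \<longleftrightarrow>
       ?s * (\<nu> * sqrt ?V) \<le> ?s * \<bar>(\<Sum>i<n. ?f (y i)) - real n * integral\<^sup>L unif01 ?f\<bar>"
      using p by (simp only: mult_le_cancel_left_pos)
    also have "?s * (\<nu> * sqrt ?V) = \<nu> * (2 * C * \<bar>\<theta>\<bar> * \<Lambda> / h)" using e by (metis mult.left_commute)
    also have "?s * \<bar>(\<Sum>i<n. ?f (y i)) - real n * integral\<^sup>L unif01 ?f\<bar> = \<bar>Gp u (compose {..<n} tm y) - Gp u y - Gshift u\<bar>"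
      unfolding f[symmetric] using p by (simp only: abs_mult abs_of_pos)
    finally show ?thesis .
  qed
  ultimately show ?thesis by simp
qed

text \<open>Since ln (1 + x) is at least x - 2 x^2, the logarithm of the Jacobian is at least
  \<open>\<theta> * S - 2 * \<theta>\<^sup>2 * S2\<close>, where \<open>S\<close> is the signed and
  \<open>S2\<close> the total number of sample points on the two flanks. Both counts concentrate
  with variance proxy \<open>n * (2 * \<Lambda>)\<close>.\<close>

lemma jacobian_tail:
  assumes \<nu>: "1 \<le> \<nu>" and n\<Lambda>: "4 \<le> real n * (2 * \<Lambda>)" and small: "\<bar>\<theta>\<bar> * \<nu> * sqrt (real n * (2 * \<Lambda>)) \<le> 1/20"
  shows "measure UM {y \<in> space UM. (\<Prod>i<n. td (y i)) < 1/2} \<le> 4 * exp (1 - \<nu>)"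
proof -
  let ?s = "\<lambda>t. indicator {c - \<Lambda>..<c} t - indicator {c..<c + \<Lambda>} t :: real"
  let ?V = "real n * (2 * \<Lambda>)"
  have intI: "integrable unif01 (indicator {a..<b} :: real \<Rightarrow> real)" for a b :: real
    by (rule integrable_unif01[of _ 1]) (auto simp: indicator_def)
  have sq: "(?s t)\<^sup>2 = indicator {c - \<Lambda>..<c} t + indicator {c..<c + \<Lambda>} t" "((?s t)\<^sup>2)\<^sup>2 = (?s t)\<^sup>2" for t
    by (auto simp: indicator_def)
  have m1: "integral\<^sup>L unif01 ?s = 0"
    using intI c0 c1 \<Lambda>0 by (subst Bochner_Integration.integral_diff) (auto simp: measure_unif01_Ico)
  have m2: "integral\<^sup>L unif01 (\<lambda>t. (?s t)\<^sup>2) = 2 * \<Lambda>"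
    unfolding sq using intI c0 c1 \<Lambda>0 by (subst Bochner_Integration.integral_add) (auto simp: measure_unif01_Ico)
  have V: "real n * (2 * \<Lambda>) \<le> ?V" "4 * 1\<^sup>2 \<le> ?V" "0 < ?V" using n\<Lambda> by auto
  have b1: "\<bar>?s t\<bar> \<le> 1" for t by (auto simp: indicator_def)
  have b2: "\<bar>(?s t)\<^sup>2\<bar> \<le> 1" for t by (auto simp: indicator_def)
  have t1: "measure UM {y \<in> space UM. \<nu> * sqrt ?V \<le> \<bar>(\<Sum>i<n. ?s (y i)) - real n * integral\<^sup>L unif01 ?s\<bar>} \<le> 2 * exp (1 - \<nu>)"
    by (rule chernoff[OF prob_space_unif01 _ _ b1 _ V]) (auto simp: m2)
  have t2: "measure UM {y \<in> space UM. \<nu> * sqrt ?V \<le> \<bar>(\<Sum>i<n. (?s (y i))\<^sup>2) - real n * integral\<^sup>L unif01 (\<lambda>t. (?s t)\<^sup>2)\<bar>} \<le> 2 * exp (1 - \<nu>)"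
    by (rule chernoff[OF prob_space_unif01 _ _ b2 _ V], simp, simp, subst sq(2), simp add: m2)
  have sub: "1/2 \<le> (\<Prod>i<n. td (y i))"
    if y1: "\<bar>(\<Sum>i<n. ?s (y i))\<bar> < \<nu> * sqrt ?V" and y2: "\<bar>(\<Sum>i<n. (?s (y i))\<^sup>2) - ?V\<bar> < \<nu> * sqrt ?V" for y :: "nat \<Rightarrow> real"
  proof -
    define S where "S = (\<Sum>i<n. ?s (y i))"
    define S2 where "S2 = (\<Sum>i<n. (?s (y i))\<^sup>2)"
    define \<tau> where "\<tau> = \<bar>\<theta>\<bar> * \<nu> * sqrt ?V"
    have \<tau>0: "0 \<le> \<tau>" "\<tau> \<le> 1/20" using small \<nu> n\<Lambda> by (auto simp: \<tau>_def)
    have "exp (\<theta> * S - 2 * \<theta>\<^sup>2 * S2) = (\<Prod>i<n. exp (\<theta> * ?s (y i) - 2 * \<theta>\<^sup>2 * (?s (y i))\<^sup>2))"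
      unfolding S_def S2_def exp_sum[OF finite_lessThan, symmetric] sum_subtractf[of "\<lambda>i. \<theta> * ?s (y i)"] sum_distrib_left by simp
    also have "\<dots> \<le> (\<Prod>i<n. td (y i))"
    proof (rule prod_mono, intro conjI)
      fix i
      define x where "x = \<theta> * ?s (y i)"
      have x: "\<bar>x\<bar> \<le> 1/2" using \<theta>_half b1[of "y i"] mult_mono[of "\<bar>\<theta>\<bar>" "1/2" "\<bar>?s (y i)\<bar>" 1] by (simp add: x_def abs_mult)
      then have "x - 2 * x\<^sup>2 \<le> ln (1 + x)" using abs_ln_one_plus_x_minus_x_bound[of x] by auto
      then have "exp (x - 2 * x\<^sup>2) \<le> 1 + x" using x by (subst (asm) ln_ge_iff) (auto simp: abs_le_iff)
      then show "exp (\<theta> * ?s (y i) - 2 * \<theta>\<^sup>2 * (?s (y i))\<^sup>2) \<le> td (y i)"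
        unfolding x_def tent_dens_def power_mult_distrib by (simp only: mult.assoc)
    qed auto
    finally have J: "exp (\<theta> * S - 2 * \<theta>\<^sup>2 * S2) \<le> (\<Prod>i<n. td (y i))" .
    have a1: "\<bar>\<theta> * S\<bar> \<le> \<tau>"
      using y1 mult_left_mono[of "\<bar>S\<bar>" "\<nu> * sqrt ?V" "\<bar>\<theta>\<bar>"] by (simp add: \<tau>_def abs_mult S_def mult.assoc)
    have "\<theta>\<^sup>2 * S2 \<le> \<theta>\<^sup>2 * (?V + \<nu> * sqrt ?V)" using y2 by (intro mult_left_mono) (auto simp: S2_def)
    also have "\<dots> = (\<bar>\<theta>\<bar> * sqrt ?V)\<^sup>2 + \<bar>\<theta>\<bar> * \<tau>"
    proof -
      have "(\<bar>\<theta>\<bar> * sqrt ?V)\<^sup>2 = \<theta>\<^sup>2 * ?V" using V by (simp only: power_mult_distrib power2_abs real_sqrt_pow2 less_imp_le)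
      moreover have "\<bar>\<theta>\<bar> * \<tau> = \<theta>\<^sup>2 * (\<nu> * sqrt ?V)" by (simp add: \<tau>_def power2_eq_square)
      ultimately show ?thesis by (simp only: distrib_left)
    qed
    also have "\<dots> \<le> \<tau>\<^sup>2 + 1/2 * \<tau>"
    proof (intro add_mono power_mono mult_right_mono)
      have "\<bar>\<theta>\<bar> * sqrt ?V * 1 \<le> \<bar>\<theta>\<bar> * sqrt ?V * \<nu>" using \<nu> n\<Lambda> by (intro mult_left_mono) auto
      then show "\<bar>\<theta>\<bar> * sqrt ?V \<le> \<tau>" by (simp add: \<tau>_def algebra_simps)
    qed (use \<theta>_half n\<Lambda> \<tau>0 in auto)
    also have "\<dots> \<le> 1/20 * \<tau> + 1/2 * \<tau>" using \<tau>0 mult_right_mono[of \<tau> "1/20" \<tau>] by (simp add: power2_eq_square)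
    finally have a2: "\<theta>\<^sup>2 * S2 \<le> 11/20 * \<tau>" by simp
    \<comment> \<open>The two terms cost at most \<open>\<tau>\<close> and
      \<open>2 * (11/20) * \<tau>\<close>, well below 1/2 because
      \<open>\<tau> \<le> 1/20\<close>.\<close>
    have "- (1/2) \<le> \<theta> * S - 2 * \<theta>\<^sup>2 * S2" using a1 a2 \<tau>0 by (auto simp: abs_le_iff)
    then have "exp (- (1/2)) \<le> exp (\<theta> * S - 2 * \<theta>\<^sup>2 * S2)" by simp
    moreover have "(1/2::real) \<le> exp (- (1/2))" using exp_ge_add_one_self[of "-(1/2)::real"] by simp
    ultimately show ?thesis using J by linarith
  qed
  have "measure UM {y \<in> space UM. (\<Prod>i<n. td (y i)) < 1/2} \<le>
    measure UM ({y \<in> space UM. \<nu> * sqrt ?V \<le> \<bar>(\<Sum>i<n. ?s (y i)) - real n * integral\<^sup>L unif01 ?s\<bar>} \<union>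
      {y \<in> space UM. \<nu> * sqrt ?V \<le> \<bar>(\<Sum>i<n. (?s (y i))\<^sup>2) - real n * integral\<^sup>L unif01 (\<lambda>t. (?s t)\<^sup>2)\<bar>})"
  proof (rule UM.finite_measure_mono)
    show "{y \<in> space UM. (\<Prod>i<n. td (y i)) < 1/2} \<subseteq> {y \<in> space UM. \<nu> * sqrt ?V \<le> \<bar>(\<Sum>i<n. ?s (y i)) - real n * integral\<^sup>L unif01 ?s\<bar>} \<union>
      {y \<in> space UM. \<nu> * sqrt ?V \<le> \<bar>(\<Sum>i<n. (?s (y i))\<^sup>2) - real n * integral\<^sup>L unif01 (\<lambda>t. (?s t)\<^sup>2)\<bar>}"
      unfolding m1 m2 using sub by (auto simp: not_le[symmetric])
  qed measurable
  also have "\<dots> \<le> measure UM {y \<in> space UM. \<nu> * sqrt ?V \<le> \<bar>(\<Sum>i<n. ?s (y i)) - real n * integral\<^sup>L unif01 ?s\<bar>} +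
      measure UM {y \<in> space UM. \<nu> * sqrt ?V \<le> \<bar>(\<Sum>i<n. (?s (y i))\<^sup>2) - real n * integral\<^sup>L unif01 (\<lambda>t. (?s t)\<^sup>2)\<bar>}"
    by (rule measure_subadditive) auto
  finally show ?thesis using t1 t2 by linarith
qed

end

section \<open>Anti-concentration of the maximum\<close>

lemma card_nats_in_interval:
  fixes S :: "nat set"
  assumes S: "\<And>i j. i \<in> S \<Longrightarrow> j \<in> S \<Longrightarrow> real i - real j \<le> r" and r: "0 \<le> r"
  shows "finite S" "real (card S) \<le> r + 1"
proof -
  have "S \<subseteq> {Inf S..Inf S + nat \<lfloor>r\<rfloor>}" if "S \<noteq> {}"
  proof
    fix i assume i: "i \<in> S"
    have "real i - real (Inf S) \<le> r" using S[OF i Inf_nat_def1[OF that]] .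
    then have "int i - int (Inf S) \<le> \<lfloor>r\<rfloor>" by (simp add: le_floor_iff)
    then have "i \<le> Inf S + nat \<lfloor>r\<rfloor>" by linarith
    then show "i \<in> {Inf S..Inf S + nat \<lfloor>r\<rfloor>}" using i by (auto intro: cInf_lower)
  qed
  then have "\<exists>a. S \<subseteq> {a..a + nat \<lfloor>r\<rfloor>}" by (cases "S = {}") auto
  then obtain a where a: "S \<subseteq> {a..a + nat \<lfloor>r\<rfloor>}" by blast
  then show "finite S" using finite_subset by blast
  have "card S \<le> card {a..a + nat \<lfloor>r\<rfloor>}" by (rule card_mono) (use a in auto)
  then have "real (card S) \<le> real (nat \<lfloor>r\<rfloor>) + 1" by simp
  also have "real (nat \<lfloor>r\<rfloor>) \<le> r" using r by simp
  finally show "real (card S) \<le> r + 1" by simp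
qed

locale weighted_process = kernel_process +
  fixes A :: "real \<Rightarrow> real" and \<nu> :: real
  assumes A_nonneg: "\<And>u. u \<in> {0..1} \<Longrightarrow> 0 \<le> A u"
    and A_le: "\<And>u. u \<in> {0..1} \<Longrightarrow> A u \<le> C"
    and A_lip: "\<And>u v. u \<in> {0..1} \<Longrightarrow> v \<in> {0..1} \<Longrightarrow> \<bar>A u - A v\<bar> \<le> C * \<bar>u - v\<bar>"
    and \<nu>4: "4 \<le> \<nu>" and h\<nu>: "h * \<nu>\<^sup>2 \<le> 1/4"
begin

text \<open>Wider than \<open>h\<close>, so that whole kernel windows fit into one flank; only wider
  by a factor of order \<open>\<nu>\<^sup>2\<close>, because the Jacobian deteriorates with \<theta>
  sqrt (n \<Lambda>).\<close>

definition "\<Lambda> = h * \<nu>\<^sup>2"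

definition Zp :: "real \<Rightarrow> (nat \<Rightarrow> real) \<Rightarrow> real" where
  "Zp u y = - A u * Gp u y"

text \<open>The set \<open>Sg\<close> of signs is \<open>{1, -1}\<close> for the version with
  absolute values and \<open>{1}\<close> for the one-sided version, so that one argument covers
  both.\<close>

definition Wmax :: "real set \<Rightarrow> real set \<Rightarrow> (nat \<Rightarrow> real) \<Rightarrow> real" where
  "Wmax \<Gamma> Sg y = Max ((\<lambda>i. fst i * Zp (snd i) y) ` (Sg \<times> \<Gamma>))"

lemma \<Lambda>_bounds: "0 < \<Lambda>" "\<Lambda> \<le> 1/4" "16 * h \<le> \<Lambda>"
proof -
  have "(4::real)\<^sup>2 \<le> \<nu>\<^sup>2" using \<nu>4 by (intro power_mono) auto
  then have "h * 16 \<le> h * \<nu>\<^sup>2" using h0 by (intro mult_left_mono) auto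
  then show "16 * h \<le> \<Lambda>" by (simp add: \<Lambda>_def)
  then show "0 < \<Lambda>" using h0 by linarith
  show "\<Lambda> \<le> 1/4" using h\<nu> by (simp add: \<Lambda>_def)
qed

lemma Zp_measurable [measurable]: "Zp u \<in> borel_measurable UM"
  unfolding Zp_def[abs_def] by measurable

lemma Wmax_measurable:
  assumes "finite \<Gamma>" "finite Sg"
  shows "Wmax \<Gamma> Sg \<in> borel_measurable UM"
  unfolding Wmax_def[abs_def] using assms by (intro borel_measurable_Max) auto

lemma Wmax_ge:
  assumes "finite \<Gamma>" "finite Sg" "u \<in> \<Gamma>" "\<sigma> \<in> Sg"
  shows "\<sigma> * Zp u y \<le> Wmax \<Gamma> Sg y"
  unfolding Wmax_def using assms by (intro Max_ge) (auto intro!: image_eqI[of _ _ "(\<sigma>, u)"])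

lemma Wmax_attained:
  assumes "finite \<Gamma>" "finite Sg" "\<Gamma> \<noteq> {}" "Sg \<noteq> {}"
  obtains u \<sigma> where "u \<in> \<Gamma>" "\<sigma> \<in> Sg" "\<sigma> * Zp u y = Wmax \<Gamma> Sg y"
proof -
  have "Wmax \<Gamma> Sg y \<in> (\<lambda>i. fst i * Zp (snd i) y) ` (Sg \<times> \<Gamma>)"
    unfolding Wmax_def using assms by (intro Max_in) auto
  then show ?thesis using that by auto
qed

lemma Wmax_le_iff:
  assumes "finite \<Gamma>" "finite Sg" "\<Gamma> \<noteq> {}" "Sg \<noteq> {}"
  shows "Wmax \<Gamma> Sg y \<le> t \<longleftrightarrow> (\<forall>u\<in>\<Gamma>. \<forall>\<sigma>\<in>Sg. \<sigma> * Zp u y \<le> t)"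
  unfolding Wmax_def using assms by (subst Max_le_iff) auto

section \<open>Tent centres: covering by flanks and bounded overlap\<close>

definition cen :: "real \<Rightarrow> nat \<Rightarrow> real" where
  "cen \<zeta> i = (if \<zeta> = 1 then \<Lambda> + real i * \<Lambda> / 4 else 1 - \<Lambda> - real i * \<Lambda> / 4)"

lemma cen_bounds:
  assumes "i \<le> nat \<lfloor>2 / \<Lambda>\<rfloor>"
  shows "0 \<le> cen \<zeta> i - \<Lambda>" "cen \<zeta> i + \<Lambda> \<le> 1"
proof -
  have "real i \<le> 2 / \<Lambda>" using assms \<Lambda>_bounds by (simp add: le_nat_iff le_floor_iff)
  then have "real i * \<Lambda> \<le> 2" using \<Lambda>_bounds by (simp add: field_simps)
  moreover have "0 \<le> real i * \<Lambda>" using \<Lambda>_bounds by simp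
  ultimately show "0 \<le> cen \<zeta> i - \<Lambda>" "cen \<zeta> i + \<Lambda> \<le> 1" using \<Lambda>_bounds by (auto simp: cen_def)
qed

text \<open>Points of the left half are put on left flanks and points of the right half on right
  flanks; in this orientation the tents stay inside the unit interval even for \<open>u\<close> next
  to an end. For \<open>u = h\<close> the first centre \<open>\<Lambda>\<close> meets the upper
  bound \<open>\<Lambda> - h\<close> with equality.\<close>

lemma core_cover:
  assumes u: "u \<in> {h..1-h}"
  obtains \<zeta> i where "\<zeta> \<in> {1, -1}" "i \<le> nat \<lfloor>2 / \<Lambda>\<rfloor>" "2 * h \<le> \<zeta> * (cen \<zeta> i - u)" "\<zeta> * (cen \<zeta> i - u) \<le> \<Lambda> - h"
proof -
  define \<zeta> :: real where "\<zeta> = (if u \<le> 1/2 then 1 else -1)"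
  define v where "v = (if u \<le> 1/2 then u else 1 - u)"
  have v: "h \<le> v" "v \<le> 1/2" using u h_le by (auto simp: v_def)
  define i where "i = nat \<lfloor>4 * (v - h) / \<Lambda>\<rfloor>"
  have "0 \<le> 4 * (v - h) / \<Lambda>" using v \<Lambda>_bounds by simp
  then have i: "real i \<le> 4 * (v - h) / \<Lambda>" "4 * (v - h) / \<Lambda> < real i + 1"
    unfolding i_def by (auto simp: of_nat_nat)
  have "4 * (v - h) / \<Lambda> \<le> 2 / \<Lambda>" using v h0 \<Lambda>_bounds by (intro divide_right_mono) auto
  then have i2: "i \<le> nat \<lfloor>2 / \<Lambda>\<rfloor>" unfolding i_def by (intro nat_mono floor_mono)
  have "real i * \<Lambda> \<le> 4 * (v - h)" using i(1) \<Lambda>_bounds by (simp add: pos_le_divide_eq)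
  moreover have "4 * (v - h) < real i * \<Lambda> + \<Lambda>" using i(2) \<Lambda>_bounds by (simp add: pos_divide_less_eq algebra_simps)
  ultimately have "2 * h \<le> \<zeta> * (cen \<zeta> i - u)" "\<zeta> * (cen \<zeta> i - u) \<le> \<Lambda> - h"
    using \<Lambda>_bounds h0 by (auto simp: cen_def \<zeta>_def v_def split: if_splits)
  then show ?thesis using i2 by (intro that[of \<zeta> i]) (auto simp: \<zeta>_def)
qed

text \<open>Two such centres are less than \<open>2 * \<Lambda> + 2 * h\<close> apart, and
  \<open>16 * h \<le> \<Lambda>\<close> makes this less than nine steps of length
  \<open>\<Lambda> / 4\<close>.\<close>

lemma cen_close_card:
  shows "finite {i. \<bar>u - cen \<zeta> i\<bar> < \<Lambda> + h}" "card {i. \<bar>u - cen \<zeta> i\<bar> < \<Lambda> + h} \<le> 9"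
proof -
  have "i < j + 9" if "\<bar>u - cen \<zeta> i\<bar> < \<Lambda> + h" "\<bar>u - cen \<zeta> j\<bar> < \<Lambda> + h" for i j
  proof -
    have "\<bar>cen \<zeta> i - cen \<zeta> j\<bar> < 2 * \<Lambda> + 2 * h" using that by linarith
    moreover have "real i * \<Lambda> / 4 - real j * \<Lambda> / 4 \<le> \<bar>cen \<zeta> i - cen \<zeta> j\<bar>" by (auto simp: cen_def)
    ultimately have "real i * \<Lambda> < real j * \<Lambda> + 9 * \<Lambda>" using \<Lambda>_bounds by linarith
    then have "real i * \<Lambda> < (real j + 9) * \<Lambda>" by (simp add: algebra_simps)
    then have "real i < real j + 9" using \<Lambda>_bounds by simp
    then show ?thesis by linarith
  qed
  then have "real i - real j \<le> 8"
    if "i \<in> {i. \<bar>u - cen \<zeta> i\<bar> < \<Lambda> + h}" "j \<in> {i. \<bar>u - cen \<zeta> i\<bar> < \<Lambda> + h}" for i j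
    using that by fastforce
  note card_nats_in_interval[of "{i. \<bar>u - cen \<zeta> i\<bar> < \<Lambda> + h}" 8, OF this]
  then show "finite {i. \<bar>u - cen \<zeta> i\<bar> < \<Lambda> + h}" "card {i. \<bar>u - cen \<zeta> i\<bar> < \<Lambda> + h} \<le> 9"
    by auto
qed

end

text \<open>The largest shift is \<open>2 * N * \<epsilon>\<close> and the weight at a tent centre
  is at least \<open>a / 2\<close>, so \<open>\<Theta>\<close> bounds all slopes that occur. The
  assumption \<open>jac\<close> keeps the Jacobian above 1/2; \<open>dev\<close>,
  \<open>quad\<close> and \<open>osc\<close> bound the random fluctuation, the second-order drift
  and the variation of \<open>A\<close> across a tent, each by
  \<open>\<epsilon> / 20\<close>.\<close>

locale shift_levels = weighted_process +
  fixes \<Gamma> Sg :: "real set" and a \<epsilon> \<Theta> :: real and N :: nat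
  assumes \<Gamma>: "finite \<Gamma>" "\<Gamma> \<noteq> {}" "\<Gamma> \<subseteq> {h..1-h}" and Sg: "Sg \<noteq> {}" "Sg \<subseteq> {1, -1}"
    and a0: "0 < a" and A_ge: "\<And>u. u \<in> \<Gamma> \<Longrightarrow> a \<le> A u"
    and \<epsilon>0: "0 < \<epsilon>" and N0: "0 < N"
    and \<Theta>_def: "\<Theta> = 4 * real N * \<epsilon> / (a * sqrt (real n * h))"
    and a_\<Lambda>: "C * \<Lambda> \<le> a / 2"
    and \<Theta>_half: "\<Theta> \<le> 1/2" and \<Theta>_\<nu>: "\<Theta> * \<nu>\<^sup>2 \<le> 1"
    and jac: "160 * real N * \<epsilon> * \<nu>\<^sup>2 \<le> a"
    and dev: "2 * C\<^sup>2 * \<nu> ^ 3 * \<Theta> \<le> \<epsilon> / 20"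
    and quad: "2 * C * sqrt (real n * h) * \<Theta>\<^sup>2 \<le> \<epsilon> / 20"
    and osc: "sqrt (real n * h) * \<Theta> * C * (\<Lambda> + h) \<le> \<epsilon> / 20"
begin

lemma finite_Sg: "finite Sg"
  using Sg finite_subset by auto

lemma abs_Sg: "\<sigma> \<in> Sg \<Longrightarrow> \<bar>\<sigma>\<bar> = 1"
  using Sg by auto

abbreviation "W \<equiv> Wmax \<Gamma> Sg"

lemma W_measurable [measurable]: "W \<in> borel_measurable UM"
  by (rule Wmax_measurable) (use \<Gamma> finite_Sg in auto)

lemma shift_step:
  assumes c: "0 \<le> c - \<Lambda>" "c + \<Lambda> \<le> 1" and Ac: "a / 2 \<le> A c"
    and \<zeta>: "\<zeta> \<in> {1, -1}" and \<sigma>: "\<sigma> \<in> Sg" and s: "0 < s" "s \<le> 2 * real N * \<epsilon>"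
  obtains \<theta> B where "\<bar>\<theta>\<bar> < 1" "B \<in> sets UM" "measure UM B \<le> (4 + 2 * real (card \<Gamma>)) * exp (1 - \<nu>)"
    "\<And>y. y \<in> space UM - B \<Longrightarrow> 1/2 \<le> (\<Prod>i<n. tent_dens c \<Lambda> \<theta> (y i))"
    "\<And>y u. y \<in> space UM - B \<Longrightarrow> u \<in> \<Gamma> \<Longrightarrow> \<bar>Zp u (compose {..<n} (tent_map c \<Lambda> \<theta>) y) - Zp u y\<bar> \<le> s + 3 * (\<epsilon> / 20)"
    "\<And>y u. \<Lambda> + h \<le> \<bar>u - c\<bar> \<Longrightarrow> Zp u (compose {..<n} (tent_map c \<Lambda> \<theta>) y) = Zp u y"
    "\<And>y u. y \<in> space UM - B \<Longrightarrow> u \<in> \<Gamma> \<Longrightarrow> 2 * h \<le> \<zeta> * (c - u) \<Longrightarrow> \<zeta> * (c - u) \<le> \<Lambda> - h \<Longrightarrow>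
        s - 3 * (\<epsilon> / 20) \<le> \<sigma> * (Zp u (compose {..<n} (tent_map c \<Lambda> \<theta>) y) - Zp u y)"
proof -
  define r where "r = sqrt (real n * h)"
  have r0: "0 < r" using n0 h0 by (simp add: r_def)
  have Ac0: "0 < A c" using Ac a0 by linarith
  \<comment> \<open>To first order the mean of the kernel changes by
    \<open>- \<zeta> * \<theta>\<close>, and \<open>Zp\<close> carries the factor
    \<open>- A u\<close>. This slope therefore raises \<open>\<sigma> * Zp\<close> on the chosen
    flank by \<open>s\<close>, up to replacing \<open>A u\<close> by \<open>A c\<close>.\<close>
  define \<theta> where "\<theta> = \<sigma> * \<zeta> * (s / (A c * r))"
  have abs\<theta>: "\<bar>\<theta>\<bar> = s / (A c * r)" using abs_Sg[OF \<sigma>] \<zeta> s Ac0 r0 by (auto simp: \<theta>_def abs_mult)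
  have \<theta>r: "r * \<bar>\<theta>\<bar> * A c = s" using Ac0 r0 by (simp add: abs\<theta>)
  have "\<bar>\<theta>\<bar> \<le> (2 * real N * \<epsilon>) / (a / 2 * r)"
    unfolding abs\<theta> using s Ac r0 a0 \<epsilon>0 by (intro frac_le mult_right_mono) auto
  also have "\<dots> = \<Theta>" unfolding \<Theta>_def r_def[symmetric] using a0 r0 by (simp add: field_simps)
  finally have \<theta>\<Theta>: "\<bar>\<theta>\<bar> \<le> \<Theta>" .
  have \<theta>0: "\<theta> \<noteq> 0" using abs\<theta> s Ac0 r0 by auto
  have \<Theta>0: "0 < \<Theta>" using \<theta>\<Theta> \<theta>0 by linarith
  have "\<bar>\<theta>\<bar> * \<Lambda> \<le> \<Theta> * \<Lambda>" using \<theta>\<Theta> \<Lambda>_bounds by (intro mult_right_mono) auto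
  also have "\<dots> = h * (\<Theta> * \<nu>\<^sup>2)" by (simp add: \<Lambda>_def)
  also have "\<dots> \<le> h * 1" using \<Theta>_\<nu> h0 by (intro mult_left_mono) auto
  finally have \<theta>\<Lambda>: "\<bar>\<theta>\<bar> * \<Lambda> \<le> h" by simp
  interpret T: kernel_transport K C h n c \<Lambda> \<theta>
    by unfold_locales (use \<Lambda>_bounds c \<theta>\<Theta> \<Theta>_half \<theta>0 \<theta>\<Lambda> in auto)
  have n\<Lambda>: "4 \<le> real n * (2 * \<Lambda>)"
  proof -
    have "real n * h * 1 \<le> real n * (2 * \<Lambda>)" using \<Lambda>_bounds h0 n0 by (simp add: mult.assoc)
    then show ?thesis using nh1 C1 by linarith
  qed
  have small: "\<bar>\<theta>\<bar> * \<nu> * sqrt (real n * (2 * \<Lambda>)) \<le> 1/20"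
  proof -
    have "real n * (2 * \<Lambda>) = (real n * h) * (\<nu>\<^sup>2 * 2)" by (simp add: \<Lambda>_def)
    then have "sqrt (real n * (2 * \<Lambda>)) = r * (\<nu> * sqrt 2)"
      using \<nu>4 by (simp only: real_sqrt_mult real_sqrt_abs r_def)
    moreover have "\<nu> * sqrt 2 \<le> \<nu> * 2" using \<nu>4 by (intro mult_left_mono) (auto intro: real_le_lsqrt)
    ultimately have "sqrt (real n * (2 * \<Lambda>)) \<le> r * (\<nu> * 2)" using r0 by simp
    then have "\<bar>\<theta>\<bar> * \<nu> * sqrt (real n * (2 * \<Lambda>)) \<le> \<Theta> * \<nu> * (r * (\<nu> * 2))"
      using \<theta>\<Theta> \<nu>4 \<Theta>0 n\<Lambda> by (intro mult_mono) auto
    also have "\<dots> = 8 * real N * \<epsilon> * \<nu>\<^sup>2 / a"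
      unfolding \<Theta>_def r_def[symmetric] using r0 a0 by (simp add: field_simps power2_eq_square)
    also have "\<dots> \<le> 1/20" using jac a0 by (simp add: pos_divide_le_eq)
    finally show ?thesis .
  qed
  define B1 where "B1 = {y \<in> space UM. (\<Prod>i<n. tent_dens c \<Lambda> \<theta> (y i)) < 1/2}"
  define \<delta> where "\<delta> = \<nu> * (2 * C * \<bar>\<theta>\<bar> * \<Lambda> / h)"
  define B2 where "B2 u = {y \<in> space UM. \<delta> \<le> \<bar>Gp u (compose {..<n} (tent_map c \<Lambda> \<theta>) y) - Gp u y - T.Gshift u\<bar>}" for u
  have [measurable]: "compose {..<n} (tent_map c \<Lambda> \<theta>) \<in> measurable UM UM"
    unfolding compose_def by measurable
  have B1m [measurable]: "B1 \<in> sets UM" unfolding B1_def by measurable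
  have B2m [measurable]: "B2 u \<in> sets UM" for u unfolding B2_def by measurable
  have P1: "measure UM B1 \<le> 4 * exp (1 - \<nu>)" unfolding B1_def
    by (rule T.jacobian_tail[OF _ n\<Lambda> small]) (use \<nu>4 in auto)
  have P2: "measure UM (B2 u) \<le> 2 * exp (1 - \<nu>)" if "u \<in> \<Gamma>" for u
    unfolding B2_def \<delta>_def by (rule T.transport_deviation) (use that \<Gamma> in auto)
  define B where "B = B1 \<union> (\<Union>u\<in>\<Gamma>. B2 u)"
  have U2: "(\<Union>u\<in>\<Gamma>. B2 u) \<in> sets UM" by (rule sets.finite_UN[OF \<Gamma>(1)]) (rule B2m)
  have Bm: "B \<in> sets UM" unfolding B_def by (rule sets.Un[OF B1m U2])
  have "measure UM B \<le> measure UM B1 + measure UM (\<Union>u\<in>\<Gamma>. B2 u)"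
    unfolding B_def by (rule measure_subadditive[OF B1m U2]) auto
  also have "measure UM (\<Union>u\<in>\<Gamma>. B2 u) \<le> (\<Sum>u\<in>\<Gamma>. measure UM (B2 u))"
    by (rule UM.finite_measure_subadditive_finite) (use \<Gamma> in auto)
  also have "\<dots> \<le> (\<Sum>u\<in>\<Gamma>. 2 * exp (1 - \<nu>))" by (rule sum_mono) (rule P2)
  finally have PB: "measure UM B \<le> (4 + 2 * real (card \<Gamma>)) * exp (1 - \<nu>)" using P1 by (simp add: algebra_simps)
  have \<delta>C: "C * \<delta> \<le> \<epsilon> / 20"
  proof -
    have "C * \<delta> = 2 * C\<^sup>2 * \<nu> ^ 3 * \<bar>\<theta>\<bar>" using h0 by (simp add: \<delta>_def \<Lambda>_def power2_eq_square power3_eq_cube)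
    also have "\<dots> \<le> 2 * C\<^sup>2 * \<nu> ^ 3 * \<Theta>" using \<theta>\<Theta> C1 \<nu>4 by (intro mult_left_mono) auto
    finally show ?thesis using dev by linarith
  qed
  have quad': "2 * C * r * \<theta>\<^sup>2 \<le> \<epsilon> / 20"
  proof -
    have "\<theta>\<^sup>2 \<le> \<Theta>\<^sup>2" using \<theta>\<Theta> by (metis abs_ge_zero power_mono power2_abs)
    then have "2 * C * r * \<theta>\<^sup>2 \<le> 2 * C * r * \<Theta>\<^sup>2" using C1 r0 by (intro mult_left_mono) auto
    then show ?thesis using quad by (simp add: r_def)
  qed
  have c01: "c \<in> {0..1}" using c \<Lambda>_bounds by auto
  have osc': "r * \<bar>\<theta>\<bar> * \<bar>A u - A c\<bar> \<le> \<epsilon> / 20" if "u \<in> {0..1}" "\<bar>u - c\<bar> \<le> \<Lambda> + h" for u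
  proof -
    have "\<bar>A u - A c\<bar> \<le> C * \<bar>u - c\<bar>" using that c01 by (intro A_lip) auto
    also have "\<dots> \<le> C * (\<Lambda> + h)" using that C1 by (intro mult_left_mono) auto
    finally have "r * \<bar>\<theta>\<bar> * \<bar>A u - A c\<bar> \<le> r * \<Theta> * (C * (\<Lambda> + h))"
      using r0 \<theta>\<Theta> \<Theta>0 by (intro mult_mono) auto
    moreover have "r * \<Theta> * (C * (\<Lambda> + h)) \<le> \<epsilon> / 20" using osc unfolding r_def by (simp only: mult.assoc)
    ultimately show ?thesis by linarith
  qed
  have diff: "Zp u (compose {..<n} (tent_map c \<Lambda> \<theta>) y) - Zp u y =
      - A u * T.Gshift u - A u * (Gp u (compose {..<n} (tent_map c \<Lambda> \<theta>) y) - Gp u y - T.Gshift u)" for u y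
    by (simp add: Zp_def algebra_simps)
  have rem: "\<bar>A u * (Gp u (compose {..<n} (tent_map c \<Lambda> \<theta>) y) - Gp u y - T.Gshift u)\<bar> \<le> \<epsilon> / 20"
    if "y \<in> space UM - B" "u \<in> \<Gamma>" for u y
  proof -
    have u01: "u \<in> {0..1}" using that \<Gamma> h0 by auto
    have "\<bar>Gp u (compose {..<n} (tent_map c \<Lambda> \<theta>) y) - Gp u y - T.Gshift u\<bar> \<le> \<delta>"
      using that unfolding B_def B2_def by force
    then have "\<bar>A u * (Gp u (compose {..<n} (tent_map c \<Lambda> \<theta>) y) - Gp u y - T.Gshift u)\<bar> \<le> C * \<delta>"
      unfolding abs_mult using A_nonneg[OF u01] A_le[OF u01] C1 by (intro mult_mono) auto
    then show ?thesis using \<delta>C by linarith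
  qed
  show ?thesis
  proof (rule that[of \<theta> B])
    show "\<bar>\<theta>\<bar> < 1" using \<theta>\<Theta> \<Theta>_half by linarith
    show "B \<in> sets UM" by (rule Bm)
    show "measure UM B \<le> (4 + 2 * real (card \<Gamma>)) * exp (1 - \<nu>)" by (rule PB)
    show "1/2 \<le> (\<Prod>i<n. tent_dens c \<Lambda> \<theta> (y i))" if "y \<in> space UM - B" for y
      using that unfolding B_def B1_def by auto
    show far: "Zp u (compose {..<n} (tent_map c \<Lambda> \<theta>) y) = Zp u y" if "\<Lambda> + h \<le> \<bar>u - c\<bar>" for u y
      unfolding Zp_def T.Gp_far[OF that] ..
    show "\<bar>Zp u (compose {..<n} (tent_map c \<Lambda> \<theta>) y) - Zp u y\<bar> \<le> s + 3 * (\<epsilon> / 20)"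
      if y: "y \<in> space UM - B" and u: "u \<in> \<Gamma>" for y u
    proof (cases "\<bar>u - c\<bar> \<le> \<Lambda> + h")
      case False
      then show ?thesis using far[of u y] s \<epsilon>0 by simp
    next
      case True
      have u01: "u \<in> {0..1}" and uh: "u \<in> {h..1-h}" using u \<Gamma> h0 by auto
      have "\<bar>A u * T.Gshift u\<bar> = A u * (r * \<bar>T.mean_tm u - 1\<bar>)"
        unfolding T.Gshift_def abs_mult r_def using A_nonneg[OF u01] n0 h0 by simp
      also have "\<dots> \<le> A u * (r * (\<bar>\<theta>\<bar> + 2 * \<theta>\<^sup>2))"
        using T.mean_tm_diff[OF uh] A_nonneg[OF u01] r0 by (intro mult_left_mono) auto
      also have "\<dots> = A u * r * \<bar>\<theta>\<bar> + A u * (2 * r * \<theta>\<^sup>2)" by (simp add: algebra_simps)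
      also have "A u * (2 * r * \<theta>\<^sup>2) \<le> C * (2 * r * \<theta>\<^sup>2)" using A_le[OF u01] r0 by (intro mult_right_mono) auto
      also have "A u * r * \<bar>\<theta>\<bar> \<le> s + \<epsilon> / 20"
      proof -
        have "A u * r * \<bar>\<theta>\<bar> = r * \<bar>\<theta>\<bar> * A c + r * \<bar>\<theta>\<bar> * (A u - A c)" by (simp add: algebra_simps)
        also have "r * \<bar>\<theta>\<bar> * (A u - A c) \<le> r * \<bar>\<theta>\<bar> * \<bar>A u - A c\<bar>" using r0 by (intro mult_left_mono) auto
        finally show ?thesis using osc'[OF u01 True] \<theta>r by linarith
      qed
      finally have "\<bar>A u * T.Gshift u\<bar> \<le> s + 2 * (\<epsilon> / 20)" using quad' by (simp add: mult.assoc mult.left_commute)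
      then show ?thesis unfolding diff using rem[OF y u] by (auto simp: abs_le_iff)
    qed
    show "s - 3 * (\<epsilon> / 20) \<le> \<sigma> * (Zp u (compose {..<n} (tent_map c \<Lambda> \<theta>) y) - Zp u y)"
      if y: "y \<in> space UM - B" and u: "u \<in> \<Gamma>" and co: "2 * h \<le> \<zeta> * (c - u)" "\<zeta> * (c - u) \<le> \<Lambda> - h" for y u
    proof -
      have u01: "u \<in> {0..1}" and uh: "u \<in> {h..1-h}" using u \<Gamma> h0 by auto
      have uc: "\<bar>u - c\<bar> \<le> \<Lambda> + h" using co \<zeta> h0 by auto
      have e1: "\<sigma> * \<zeta> * \<theta> = \<bar>\<theta>\<bar>"
        using \<zeta> Sg \<sigma> abs\<theta> by (auto simp: \<theta>_def)
      have "A u * r * \<bar>T.mean_tm u - 1 + \<zeta> * \<theta>\<bar> \<le> C * r * (2 * \<theta>\<^sup>2)"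
        using T.mean_tm_core[OF uh \<zeta> co] A_nonneg[OF u01] A_le[OF u01] r0 C1 by (intro mult_mono) auto
      also have "\<dots> \<le> \<epsilon> / 20" using quad' by (simp add: mult.assoc mult.left_commute)
      finally have q: "\<bar>A u * r * (T.mean_tm u - 1 + \<zeta> * \<theta>)\<bar> \<le> \<epsilon> / 20"
        using A_nonneg[OF u01] r0 by (simp add: abs_mult)
      have "\<sigma> * (- A u * T.Gshift u) = A u * r * (\<sigma> * \<zeta> * \<theta>) - \<sigma> * (A u * r * (T.mean_tm u - 1 + \<zeta> * \<theta>))"
        unfolding T.Gshift_def r_def by (simp add: algebra_simps)
      also have "A u * r * (\<sigma> * \<zeta> * \<theta>) = s + r * \<bar>\<theta>\<bar> * (A u - A c)"
        unfolding e1 using \<theta>r by (simp add: algebra_simps)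
      finally have m: "\<sigma> * (- A u * T.Gshift u) = s + r * \<bar>\<theta>\<bar> * (A u - A c) - \<sigma> * (A u * r * (T.mean_tm u - 1 + \<zeta> * \<theta>))" .
      have "- (r * \<bar>\<theta>\<bar> * \<bar>A u - A c\<bar>) = r * \<bar>\<theta>\<bar> * (- \<bar>A u - A c\<bar>)" by simp
      also have "\<dots> \<le> r * \<bar>\<theta>\<bar> * (A u - A c)" using r0 by (intro mult_left_mono) auto
      finally have "- (\<epsilon> / 20) \<le> r * \<bar>\<theta>\<bar> * (A u - A c)" using osc'[OF u01 uc] by linarith
      moreover have "\<bar>\<sigma> * (A u * r * (T.mean_tm u - 1 + \<zeta> * \<theta>))\<bar> \<le> \<epsilon> / 20"
        using q abs_Sg[OF \<sigma>] by (simp add: abs_mult)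
      ultimately have "s - 2 * (\<epsilon> / 20) \<le> \<sigma> * (- A u * T.Gshift u)" unfolding m by linarith
      moreover have "\<bar>\<sigma> * (A u * (Gp u (compose {..<n} (tent_map c \<Lambda> \<theta>) y) - Gp u y - T.Gshift u))\<bar> \<le> \<epsilon> / 20"
        using rem[OF y u] abs_Sg[OF \<sigma>] by (simp add: abs_mult)
      ultimately show ?thesis unfolding diff right_diff_distrib[of \<sigma> "- A u * T.Gshift u"] by linarith
    qed
  qed
qed

text \<open>In \<open>argmax_event\<close> the maximum lies in \<open>[x, x + \<epsilon>]\<close> and is attained where the tent at \<open>c\<close>
  has constant slope. The transport raises the maximum there by \<open>s\<close> and leaves the process unchanged far
  from \<open>c\<close>, so the sample ends up in \<open>shifted_event\<close>. These target events overlap boundedly, because each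
  of them locates the argmax near \<open>c\<close>.\<close>

definition argmax_event :: "real \<Rightarrow> real \<Rightarrow> real \<Rightarrow> real \<Rightarrow> (nat \<Rightarrow> real) set" where
  "argmax_event x \<zeta> c \<sigma> = {y \<in> space UM. x \<le> W y \<and> W y \<le> x + \<epsilon> \<and>
     (\<exists>u\<in>\<Gamma>. 2 * h \<le> \<zeta> * (c - u) \<and> \<zeta> * (c - u) \<le> \<Lambda> - h \<and> \<sigma> * Zp u y = W y)}"

definition shifted_event :: "real \<Rightarrow> real \<Rightarrow> real \<Rightarrow> (nat \<Rightarrow> real) set" where
  "shifted_event x c s = {y \<in> space UM. x + s - \<epsilon> / 5 \<le> W y \<and> W y \<le> x + s + 6 * (\<epsilon> / 5) \<and>
     (\<forall>u\<in>\<Gamma>. \<Lambda> + h \<le> \<bar>u - c\<bar> \<longrightarrow> (\<forall>\<sigma>\<in>Sg. \<sigma> * Zp u y < W y))}"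

lemma argmax_event_measurable [measurable]: "argmax_event x \<zeta> c \<sigma> \<in> sets UM"
proof -
  have "{y \<in> space UM. \<exists>u\<in>\<Gamma>. 2 * h \<le> \<zeta> * (c - u) \<and> \<zeta> * (c - u) \<le> \<Lambda> - h \<and> \<sigma> * Zp u y = W y} \<in> sets UM"
  proof (rule sets.sets_Collect_finite_Ex[OF _ \<Gamma>(1)])
    fix u
    have "{y \<in> space UM. (\<lambda>y. \<sigma> * Zp u y) y = W y} \<in> sets UM"
      by (rule borel_measurable_eq[OF borel_measurable_times[OF borel_measurable_const Zp_measurable] W_measurable])
    moreover have "{y \<in> space UM. 2 * h \<le> \<zeta> * (c - u) \<and> \<zeta> * (c - u) \<le> \<Lambda> - h \<and> \<sigma> * Zp u y = W y} =
      (if 2 * h \<le> \<zeta> * (c - u) \<and> \<zeta> * (c - u) \<le> \<Lambda> - h then {y \<in> space UM. \<sigma> * Zp u y = W y} else {})"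
      by (simp split: if_split) blast
    ultimately show "{y \<in> space UM. 2 * h \<le> \<zeta> * (c - u) \<and> \<zeta> * (c - u) \<le> \<Lambda> - h \<and> \<sigma> * Zp u y = W y} \<in> sets UM"
      by (simp only: sets.empty_sets split: if_split) blast
  qed
  moreover have "{y \<in> space UM. x \<le> W y \<and> W y \<le> x + \<epsilon>} \<in> sets UM" by measurable
  ultimately have "{y \<in> space UM. x \<le> W y \<and> W y \<le> x + \<epsilon>} \<inter>
    {y \<in> space UM. \<exists>u\<in>\<Gamma>. 2 * h \<le> \<zeta> * (c - u) \<and> \<zeta> * (c - u) \<le> \<Lambda> - h \<and> \<sigma> * Zp u y = W y} \<in> sets UM"
    by (rule sets.Int[rotated])
  then show ?thesis unfolding argmax_event_def by (rule back_subst[where P = "\<lambda>S. S \<in> sets UM"]) blast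
qed

lemma shifted_event_measurable [measurable]: "shifted_event x c s \<in> sets UM"
proof -
  have "{y \<in> space UM. \<forall>u\<in>\<Gamma>. \<forall>\<sigma>\<in>Sg. \<Lambda> + h \<le> \<bar>u - c\<bar> \<longrightarrow> \<sigma> * Zp u y < W y} \<in> sets UM"
    by (intro sets.sets_Collect_finite_All[OF _ \<Gamma>(1)] sets.sets_Collect_finite_All[OF _ finite_Sg]) measurable
  moreover have "{y \<in> space UM. x + s - \<epsilon> / 5 \<le> W y \<and> W y \<le> x + s + 6 * (\<epsilon> / 5)} \<in> sets UM" by measurable
  ultimately have "{y \<in> space UM. x + s - \<epsilon> / 5 \<le> W y \<and> W y \<le> x + s + 6 * (\<epsilon> / 5)} \<inter>
    {y \<in> space UM. \<forall>u\<in>\<Gamma>. \<forall>\<sigma>\<in>Sg. \<Lambda> + h \<le> \<bar>u - c\<bar> \<longrightarrow> \<sigma> * Zp u y < W y} \<in> sets UM"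
    by (rule sets.Int[rotated])
  then show ?thesis unfolding shifted_event_def by (rule back_subst[where P = "\<lambda>S. S \<in> sets UM"]) blast
qed

lemma argmax_event_bound:
  assumes c: "0 \<le> c - \<Lambda>" "c + \<Lambda> \<le> 1"
    and \<zeta>: "\<zeta> \<in> {1, -1}" and \<sigma>: "\<sigma> \<in> Sg" and s: "2 * \<epsilon> \<le> s" "s \<le> 2 * real N * \<epsilon>"
  shows "measure UM (argmax_event x \<zeta> c \<sigma>) \<le> 2 * measure UM (shifted_event x c s) + (4 + 2 * real (card \<Gamma>)) * exp (1 - \<nu>)"
\<comment> \<open>A nonempty event supplies a point \<open>u\<close> of \<open>\<Gamma>\<close> near
  \<open>c\<close>. Its weight is at least \<open>a\<close>, and the Lipschitz bound transfers
  \<open>a / 2\<close> to the centre, where no lower bound is assumed.\<close>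
proof (cases "argmax_event x \<zeta> c \<sigma> = {}")
  case True then show ?thesis by simp
next
  case False
  then obtain u where u: "u \<in> \<Gamma>" "2 * h \<le> \<zeta> * (c - u)" "\<zeta> * (c - u) \<le> \<Lambda> - h"
    unfolding argmax_event_def by blast
  have c01: "c \<in> {0..1}" "u \<in> {0..1}" using c \<Lambda>_bounds u \<Gamma> h0 by auto
  have "\<bar>A u - A c\<bar> \<le> C * \<bar>u - c\<bar>" using c01 by (intro A_lip) auto
  also have "\<dots> \<le> C * \<Lambda>" using u \<zeta> h0 C1 by (intro mult_left_mono) auto
  finally have Ac: "a / 2 \<le> A c" using a_\<Lambda> A_ge[OF u(1)] by linarith
  have s0: "0 < s" using s \<epsilon>0 by linarith
  obtain \<theta> B where \<theta>: "\<bar>\<theta>\<bar> < 1" and B: "B \<in> sets UM"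
    and PB: "measure UM B \<le> (4 + 2 * real (card \<Gamma>)) * exp (1 - \<nu>)"
    and J: "\<And>y. y \<in> space UM - B \<Longrightarrow> 1/2 \<le> (\<Prod>i<n. tent_dens c \<Lambda> \<theta> (y i))"
    and up: "\<And>y u. y \<in> space UM - B \<Longrightarrow> u \<in> \<Gamma> \<Longrightarrow> \<bar>Zp u (compose {..<n} (tent_map c \<Lambda> \<theta>) y) - Zp u y\<bar> \<le> s + 3 * (\<epsilon> / 20)"
    and far: "\<And>y u. \<Lambda> + h \<le> \<bar>u - c\<bar> \<Longrightarrow> Zp u (compose {..<n} (tent_map c \<Lambda> \<theta>) y) = Zp u y"
    and core: "\<And>y u. y \<in> space UM - B \<Longrightarrow> u \<in> \<Gamma> \<Longrightarrow> 2 * h \<le> \<zeta> * (c - u) \<Longrightarrow> \<zeta> * (c - u) \<le> \<Lambda> - h \<Longrightarrow>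
        s - 3 * (\<epsilon> / 20) \<le> \<sigma> * (Zp u (compose {..<n} (tent_map c \<Lambda> \<theta>) y) - Zp u y)"
    using shift_step[OF c Ac \<zeta> \<sigma> s0 s(2)] by metis
  let ?f = "compose {..<n} (tent_map c \<Lambda> \<theta>)" and ?E = "argmax_event x \<zeta> c \<sigma>" and ?F = "shifted_event x c s"
  have [measurable]: "?f \<in> measurable UM UM" unfolding compose_def by measurable
  note B[measurable]
  have EF: "?f y \<in> ?F" if y: "y \<in> ?E - B" for y
  proof -
    have ys: "y \<in> space UM - B" using y by (auto simp: argmax_event_def)
    obtain v where v: "v \<in> \<Gamma>" "2 * h \<le> \<zeta> * (c - v)" "\<zeta> * (c - v) \<le> \<Lambda> - h" "\<sigma> * Zp v y = W y"
      and Wx: "x \<le> W y" "W y \<le> x + \<epsilon>" using y by (auto simp: argmax_event_def)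
    have "W y + s - 3 * (\<epsilon> / 20) \<le> \<sigma> * Zp v (?f y)"
      using core[OF ys v(1-3)] v(4) by (simp add: right_diff_distrib)
    also have "\<dots> \<le> W (?f y)" by (rule Wmax_ge) (use \<Gamma> finite_Sg v \<sigma> in auto)
    finally have lo: "W y + s - 3 * (\<epsilon> / 20) \<le> W (?f y)" .
    have "\<forall>w\<in>\<Gamma>. \<forall>\<tau>\<in>Sg. \<tau> * Zp w (?f y) \<le> W y + s + 3 * (\<epsilon> / 20)"
    proof (intro ballI)
      fix w \<tau> assume w: "w \<in> \<Gamma>" "\<tau> \<in> Sg"
      have "\<tau> * Zp w (?f y) = \<tau> * Zp w y + \<tau> * (Zp w (?f y) - Zp w y)" by (simp add: algebra_simps)
      also have "\<dots> \<le> W y + \<bar>\<tau> * (Zp w (?f y) - Zp w y)\<bar>"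
        using Wmax_ge[of \<Gamma> Sg w \<tau> y] w \<Gamma> finite_Sg by (intro add_mono) auto
      also have "\<bar>\<tau> * (Zp w (?f y) - Zp w y)\<bar> \<le> s + 3 * (\<epsilon> / 20)"
        using up[OF ys w(1)] abs_Sg[OF w(2)] by (simp add: abs_mult)
      finally show "\<tau> * Zp w (?f y) \<le> W y + s + 3 * (\<epsilon> / 20)" by simp
    qed
    then have hi: "W (?f y) \<le> W y + s + 3 * (\<epsilon> / 20)"
      using Wmax_le_iff[OF \<Gamma>(1) finite_Sg \<Gamma>(2) Sg(1)] by blast
    have "\<tau> * Zp w (?f y) < W (?f y)" if w: "w \<in> \<Gamma>" "\<tau> \<in> Sg" "\<Lambda> + h \<le> \<bar>w - c\<bar>" for w \<tau>
    proof -
      have "\<tau> * Zp w (?f y) = \<tau> * Zp w y" using far[OF w(3)] by simp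
      also have "\<dots> \<le> W y" by (rule Wmax_ge) (use w \<Gamma> finite_Sg in auto)
      \<comment> \<open>Strict because \<open>s \<ge> 2 * \<epsilon>\<close> exceeds the accumulated
        error \<open>3 * (\<epsilon> / 20)\<close>. This strictness locates the new argmax near the
        tent.\<close>
      also have "\<dots> < W (?f y)" using lo s \<epsilon>0 by linarith
      finally show ?thesis .
    qed
    moreover have "?f y \<in> space UM" using ys measurable_space[of ?f UM UM y] by simp
    ultimately show ?thesis unfolding shifted_event_def using lo hi Wx \<epsilon>0 by auto
  qed
  \<comment> \<open>Off \<open>B\<close> the Jacobian is at least 1/2 and the image lies in the
    target, so half the mass of the source is bounded through the change of variables.\<close>
  have "emeasure UM (?E - B) / 2 = (\<integral>\<^sup>+y. ennreal (1/2) * indicator (?E - B) y \<partial>UM)"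
    by (subst nn_integral_cmult_indicator) (auto simp: divide_ennreal_def mult.commute ennreal_divide_times)
  also have "\<dots> \<le> (\<integral>\<^sup>+y. ennreal (\<Prod>i<n. tent_dens c \<Lambda> \<theta> (y i)) * indicator ?F (?f y) \<partial>UM)"
  proof (rule nn_integral_mono)
    fix y assume y: "y \<in> space UM"
    show "ennreal (1/2) * indicator (?E - B) y \<le> ennreal (\<Prod>i<n. tent_dens c \<Lambda> \<theta> (y i)) * indicator ?F (?f y)"
    proof (cases "y \<in> ?E - B")
      case True
      then have "ennreal (1/2) \<le> ennreal (\<Prod>i<n. tent_dens c \<Lambda> \<theta> (y i))" using J[of y] y by (intro ennreal_leI) auto
      then show ?thesis using True EF[OF True] by simp
    qed simp
  qed
  also have "\<dots> = (\<integral>\<^sup>+y. indicator ?F y \<partial>UM)"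
    by (rule tent_map_change_of_variables[symmetric]) (use \<Lambda>_bounds c \<theta> in auto)
  also have "\<dots> = emeasure UM ?F" by simp
  finally have "emeasure UM (?E - B) / 2 \<le> emeasure UM ?F" .
  then have "measure UM (?E - B) / 2 \<le> measure UM ?F"
    by (simp add: UM.emeasure_eq_measure divide_ennreal flip: ennreal_numeral)
  moreover have "measure UM ?E \<le> measure UM (?E - B) + measure UM B"
  proof -
    have "measure UM ?E \<le> measure UM ((?E - B) \<union> B)" by (rule UM.finite_measure_mono) auto
    also have "\<dots> \<le> measure UM (?E - B) + measure UM B" by (rule measure_subadditive) auto
    finally show ?thesis .
  qed
  ultimately show ?thesis using PB by linarith
qed

text \<open>Every argmax event is transported to all \<open>N\<close> levels. Summed over tents and
  levels, the target events cover each sample at most 72 times, so \<open>N\<close> times the total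
  mass of the argmax events is at most 144 plus the exceptional probabilities.\<close>

lemma anti_concentration:
  "measure UM {y \<in> space UM. x \<le> W y \<and> W y \<le> x + \<epsilon>}
    \<le> 144 / real N + 4 * (2 / \<Lambda> + 1) * (4 + 2 * real (card \<Gamma>)) * exp (1 - \<nu>)"
proof -
  define m where "m = nat \<lfloor>2 / \<Lambda>\<rfloor>"
  define I where "I = {..m} \<times> {1, -1::real} \<times> Sg"
  define tiny where "tiny = (4 + 2 * real (card \<Gamma>)) * exp (1 - \<nu>)"
  have tiny0: "0 \<le> tiny" by (simp add: tiny_def)
  define E where "E j = argmax_event x (fst (snd j)) (cen (fst (snd j)) (fst j)) (snd (snd j))" for j :: "nat \<times> real \<times> real"
  define F where "F j k = shifted_event x (cen (fst (snd j)) (fst j)) (2 * real k * \<epsilon>)" for j :: "nat \<times> real \<times> real" and k :: nat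
  have finI: "finite I" using finite_Sg by (simp add: I_def)
  have Em [measurable]: "E j \<in> sets UM" for j by (simp add: E_def)
  have Fm [measurable]: "F j k \<in> sets UM" for j k by (simp add: F_def)
  have "{y \<in> space UM. x \<le> W y \<and> W y \<le> x + \<epsilon>} \<subseteq> (\<Union>j\<in>I. E j)"
  proof
    fix y assume y: "y \<in> {y \<in> space UM. x \<le> W y \<and> W y \<le> x + \<epsilon>}"
    obtain u \<sigma> where u: "u \<in> \<Gamma>" "\<sigma> \<in> Sg" "\<sigma> * Zp u y = W y"
      using Wmax_attained[of \<Gamma> Sg y] \<Gamma> Sg finite_Sg by auto
    obtain \<zeta> i where z: "\<zeta> \<in> {1, -1}" "i \<le> m" "2 * h \<le> \<zeta> * (cen \<zeta> i - u)" "\<zeta> * (cen \<zeta> i - u) \<le> \<Lambda> - h"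
      unfolding m_def by (rule core_cover[of u]) (use u \<Gamma> in auto)
    have "(i, \<zeta>, \<sigma>) \<in> I" using z u by (auto simp: I_def)
    moreover have "y \<in> E (i, \<zeta>, \<sigma>)" unfolding E_def argmax_event_def using y u z by auto
    ultimately show "y \<in> (\<Union>j\<in>I. E j)" by blast
  qed
  then have "measure UM {y \<in> space UM. x \<le> W y \<and> W y \<le> x + \<epsilon>} \<le> measure UM (\<Union>j\<in>I. E j)"
    by (intro UM.finite_measure_mono) (use finI in auto)
  also have "\<dots> \<le> (\<Sum>j\<in>I. measure UM (E j))"
    by (rule UM.finite_measure_subadditive_finite) (use finI in auto)
  finally have cover: "measure UM {y \<in> space UM. x \<le> W y \<and> W y \<le> x + \<epsilon>} \<le> (\<Sum>j\<in>I. measure UM (E j))" .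
  have step: "measure UM (E j) \<le> 2 * measure UM (F j k) + tiny" if j: "j \<in> I" and k: "k \<in> {1..N}" for j k
    unfolding E_def F_def tiny_def
  proof (rule argmax_event_bound)
    have "fst j \<le> m" using j by (auto simp: I_def)
    then show "0 \<le> cen (fst (snd j)) (fst j) - \<Lambda>" "cen (fst (snd j)) (fst j) + \<Lambda> \<le> 1"
      unfolding m_def by (rule cen_bounds)+
    show "2 * \<epsilon> \<le> 2 * real k * \<epsilon>" "2 * real k * \<epsilon> \<le> 2 * real N * \<epsilon>" using k \<epsilon>0 by auto
  qed (use j in \<open>auto simp: I_def\<close>)
  have overlap: "(\<Sum>p\<in>I \<times> {1..N}. indicator (F (fst p) (snd p)) y) \<le> (72::real)" if y: "y \<in> space UM" for y
  proof -
    obtain u \<sigma> where u: "u \<in> \<Gamma>" "\<sigma> \<in> Sg" "\<sigma> * Zp u y = W y"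
      using Wmax_attained[of \<Gamma> Sg y] \<Gamma> Sg finite_Sg by auto
    define S where "S \<zeta> = {i. \<bar>u - cen \<zeta> i\<bar> < \<Lambda> + h}" for \<zeta>
    define ks where "ks = {k. x + 2 * real k * \<epsilon> - \<epsilon> / 5 \<le> W y \<and> W y \<le> x + 2 * real k * \<epsilon> + 6 * (\<epsilon> / 5)}"
    \<comment> \<open>The admissible window for the maximum has length
      \<open>7 * (\<epsilon> / 5)\<close>, shorter than the spacing \<open>2 * \<epsilon>\<close> of
      the levels, so the value of the maximum determines the level.\<close>
    have ks1: "k = k'" if "k \<in> ks" "k' \<in> ks" for k k'
    proof -
      have *: "i < j + 1" if "i \<in> ks" "j \<in> ks" for i j
      proof -
        have "2 * real i * \<epsilon> - 2 * real j * \<epsilon> \<le> 7 * (\<epsilon> / 5)" using that unfolding ks_def by auto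
        then have "(real i - real j) * \<epsilon> < 1 * \<epsilon>" using \<epsilon>0 by (simp add: algebra_simps)
        then have "real i - real j < 1" using \<epsilon>0 by (simp only: mult_less_cancel_right_pos)
        then show ?thesis by linarith
      qed
      show ?thesis using *[OF that] *[OF that(2,1)] by simp
    qed
    have kf: "finite ks" using ks1 by (metis finite.simps infinite_imp_nonempty subsetI subset_singletonD ex_in_conv singleton_iff finite_subset)
    have kc: "card ks \<le> 1" using ks1 kf by (auto simp: card_le_Suc0_iff_eq)
    have Sf: "finite (S \<zeta>)" "card (S \<zeta>) \<le> 9" for \<zeta> unfolding S_def by (rule cen_close_card)+
    let ?P = "{p \<in> I \<times> {1..N}. y \<in> F (fst p) (snd p)}"
    let ?R = "((S 1 \<union> S (-1)) \<times> {1, -1::real} \<times> {1, -1::real}) \<times> ks"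
    have "?P \<subseteq> ?R"
    proof
      fix p assume p: "p \<in> ?P"
      obtain i \<zeta> \<tau> k where pe: "p = ((i, \<zeta>, \<tau>), k)" by (cases p) auto
      have pI: "\<zeta> \<in> {1, -1}" "\<tau> \<in> Sg" using p pe by (auto simp: I_def)
      have yF: "y \<in> shifted_event x (cen \<zeta> i) (2 * real k * \<epsilon>)" using p pe by (simp add: F_def)
      then have "k \<in> ks" by (auto simp: shifted_event_def ks_def)
      moreover have "i \<in> S \<zeta>"
      proof (rule ccontr)
        assume "i \<notin> S \<zeta>"
        then have "\<Lambda> + h \<le> \<bar>u - cen \<zeta> i\<bar>" by (simp add: S_def)
        then have "\<sigma> * Zp u y < W y" using yF u(1,2) unfolding shifted_event_def by blast
        then show False using u by simp
      qed
      ultimately show "p \<in> ?R" using pe pI Sg by auto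
    qed
    moreover have "finite ?R" using kf Sf by simp
    ultimately have "card ?P \<le> card ?R" by (intro card_mono)
    also have "\<dots> = card (S 1 \<union> S (-1)) * 4 * card ks" by (simp add: card_cartesian_product)
    \<comment> \<open>Nine centres for each of the two families, two orientations, two signs and one
      level.\<close>
    also have "\<dots> \<le> 18 * 4 * 1"
      using Sf(2)[of 1] Sf(2)[of "-1"] card_Un_le[of "S 1" "S (-1)"] kc by (intro mult_le_mono) auto
    finally have "card ?P \<le> 72" by simp
    moreover have "(\<Sum>p\<in>I \<times> {1..N}. indicator (F (fst p) (snd p)) y) = (real (card ?P))"
    proof -
      have "(\<Sum>p\<in>I \<times> {1..N}. indicator (F (fst p) (snd p)) y) = (\<Sum>p\<in>I \<times> {1..N}. if y \<in> F (fst p) (snd p) then 1 else (0::real))"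
        by (intro sum.cong) (auto simp: indicator_def)
      also have "\<dots> = (\<Sum>p\<in>?P. 1)" using finI by (subst sum.inter_filter[symmetric]) auto
      finally show ?thesis by simp
    qed
    ultimately show ?thesis by linarith
  qed
  have "(\<Sum>p\<in>I \<times> {1..N}. measure UM (F (fst p) (snd p))) = (\<integral>y. (\<Sum>p\<in>I \<times> {1..N}. indicator (F (fst p) (snd p)) y) \<partial>UM)"
    by (subst Bochner_Integration.integral_sum) (auto simp: UM.emeasure_eq_measure)
  also have "\<dots> \<le> (\<integral>y. 72 \<partial>UM)"
    by (rule integral_mono) (use overlap in \<open>auto simp: UM.emeasure_eq_measure\<close>)
  also have "\<dots> = 72" by (simp add: UM.prob_space)
  finally have sumF: "(\<Sum>p\<in>I \<times> {1..N}. measure UM (F (fst p) (snd p))) \<le> 72" .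
  have "real N * (\<Sum>j\<in>I. measure UM (E j)) = (\<Sum>p\<in>I \<times> {1..N}. measure UM (E (fst p)))"
    by (simp add: sum.cartesian_product' sum_distrib_left)
  also have "\<dots> \<le> (\<Sum>p\<in>I \<times> {1..N}. 2 * measure UM (F (fst p) (snd p)) + tiny)"
    by (rule sum_mono) (use step in auto)
  also have "\<dots> = 2 * (\<Sum>p\<in>I \<times> {1..N}. measure UM (F (fst p) (snd p))) + real (card I) * real N * tiny"
    by (simp add: sum.distrib sum_distrib_left card_cartesian_product)
  also have "\<dots> \<le> 144 + real (card I) * real N * tiny" using sumF by simp
  finally have "(\<Sum>j\<in>I. measure UM (E j)) \<le> 144 / real N + real (card I) * tiny"
    using N0 by (simp add: field_simps)
  moreover have "real (card I) * tiny \<le> (4 * (2 / \<Lambda> + 1)) * tiny"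
  proof (rule mult_right_mono[OF _ tiny0])
    have "card Sg \<le> card {1, -1::real}" by (rule card_mono) (use Sg in auto)
    then have cS: "real (card Sg) \<le> 2" by simp
    have "real (card I) = real (m + 1) * (2 * real (card Sg))" by (simp add: I_def card_cartesian_product algebra_simps)
    also have "\<dots> \<le> (2 / \<Lambda> + 1) * (2 * 2)"
    proof (rule mult_mono)
      have "real m \<le> 2 / \<Lambda>" using \<Lambda>_bounds by (simp add: m_def)
      then show "real (m + 1) \<le> 2 / \<Lambda> + 1" by simp
    qed (use cS \<Lambda>_bounds in auto)
    finally show "real (card I) \<le> 4 * (2 / \<Lambda> + 1)" by simp
  qed
  ultimately show ?thesis using cover unfolding tiny_def mult.assoc by linarith
qed

end

section \<open>The maximum over a fine grid\<close>

context weighted_process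
begin

text \<open>Reduces the numerical side conditions to powers of \<nu>: the step is at least
  \<nu>^(-8), the weight at least \<nu>^(-5), the normalisation \<open>sqrt (n * h)\<close> at least
  \<nu>^20, and \<open>h\<close> at most \<nu>^(-40).\<close>

lemma shift_levelsI:
  assumes \<Gamma>: "finite \<Gamma>" "\<Gamma> \<noteq> {}" "\<Gamma> \<subseteq> {h..1-h}" and Sg: "Sg \<noteq> {}" "Sg \<subseteq> {1, -1}"
    and A_ge: "\<And>u. u \<in> \<Gamma> \<Longrightarrow> a \<le> A u" and N0: "0 < N"
    and h40: "h * \<nu> ^ 40 \<le> 1" and nh40: "\<nu> ^ 40 \<le> real n * h" and C\<nu>: "40 * C\<^sup>2 \<le> \<nu>"
    and \<epsilon>: "1 \<le> \<epsilon> * \<nu> ^ 8" and a: "1 \<le> a * \<nu> ^ 5" and jac: "160 * real N * \<epsilon> * \<nu>\<^sup>2 \<le> a"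
  shows "shift_levels K C h n A \<nu> \<Gamma> Sg a \<epsilon> (4 * real N * \<epsilon> / (a * sqrt (real n * h))) N"
proof -
  have \<nu>1: "1 \<le> \<nu>" using \<nu>4 by simp
  have pw: "\<nu> ^ i \<le> \<nu> ^ j" if "i \<le> j" for i j using \<nu>1 that by (rule power_increasing[rotated])
  have p0: "0 < \<nu> ^ i" for i using \<nu>4 by simp
  have "C \<le> C\<^sup>2" using C1 by (simp add: power2_eq_square)
  then have C\<nu>': "40 * C \<le> \<nu>" using C\<nu> by simp
  \<comment> \<open>Inequalities against \<open>\<epsilon>\<close> and \<open>a\<close> are checked
    after multiplication by the power of \<nu> that makes those quantities at least 1.\<close>
  have small: "x \<le> b" if "x * \<nu> ^ i \<le> 1" "1 \<le> b * \<nu> ^ i" for x b i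
    using that p0[of i] by (meson mult_le_cancel_right_pos order_trans)
  have "0 < a * \<nu> ^ 5" "0 < \<epsilon> * \<nu> ^ 8" using a \<epsilon> by linarith+
  then have a0: "0 < a" and \<epsilon>0: "0 < \<epsilon>"
    using zero_less_mult_pos2[OF _ p0] by blast+
  define r where "r = sqrt (real n * h)"
  have r20: "\<nu> ^ 20 \<le> r" unfolding r_def
    by (rule real_le_rsqrt) (use nh40 in \<open>simp add: power_mult[symmetric]\<close>)
  have r0: "0 < r" using r20 p0[of 20] by linarith
  \<comment> \<open>The largest shift measured in units of the unweighted process,
    \<open>t = r * \<Theta>\<close>. The Jacobian condition already forces
    \<open>t \<le> 1\<close>.\<close>
  define t where "t = 4 * real N * \<epsilon> / a"
  have t0: "0 < t" using N0 \<epsilon>0 a0 by (simp add: t_def)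
  have t1: "40 * t * \<nu>\<^sup>2 \<le> 1" using jac a0 by (simp add: t_def field_simps)
  have "1 * 1 \<le> 40 * \<nu>\<^sup>2" using \<nu>1 by (intro mult_mono) auto
  then have "t * 1 \<le> t * (40 * \<nu>\<^sup>2)" using t0 by (intro mult_left_mono) auto
  then have t2: "t \<le> 1" using t1 by (simp add: algebra_simps)
  define \<Theta> where "\<Theta> = 4 * real N * \<epsilon> / (a * sqrt (real n * h))"
  have \<Theta>: "\<Theta> = t / r" by (simp add: \<Theta>_def t_def r_def)
  have \<Theta>0: "0 < \<Theta>" using t0 r0 by (simp add: \<Theta>)
  have r\<Theta>: "r * \<Theta> = t" using r0 by (simp add: \<Theta>)
  have "\<Theta> * \<nu> ^ 20 \<le> \<Theta> * r" using r20 \<Theta>0 by (intro mult_left_mono) auto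
  then have \<Theta>20: "\<Theta> * \<nu> ^ 20 \<le> t" using r\<Theta> by (simp add: mult.commute)
  have \<Theta>k: "\<Theta> * \<nu> ^ k \<le> t" if "k \<le> 20" for k
    using \<Theta>20 pw[OF that] \<Theta>0 by (meson mult_left_mono less_imp_le order_trans)
  have hk: "h * \<nu> ^ k \<le> 1" if "k \<le> 40" for k
    using h40 pw[OF that] h0 by (meson mult_left_mono less_imp_le order_trans)
  have d1: "2 * C\<^sup>2 * \<nu> ^ 3 * \<Theta> \<le> \<epsilon> / 20"
  proof -
    have "(20 * (2 * C\<^sup>2 * \<nu> ^ 3 * \<Theta>)) * \<nu> ^ 8 = (40 * C\<^sup>2) * (\<Theta> * \<nu> ^ 11)" by (simp add: eval_nat_numeral)
    also have "\<dots> \<le> \<nu> * (\<Theta> * \<nu> ^ 11)" using C\<nu> \<Theta>0 p0[of 11] by (intro mult_right_mono) auto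
    also have "\<dots> = \<Theta> * \<nu> ^ 12" by (simp add: eval_nat_numeral)
    also have "\<dots> \<le> 1" using \<Theta>k[of 12] t2 by simp
    finally show ?thesis using small[OF _ \<epsilon>] by fastforce
  qed
  have d2: "2 * C * r * \<Theta>\<^sup>2 \<le> \<epsilon> / 20"
  proof -
    have "(20 * (2 * C * r * \<Theta>\<^sup>2)) * \<nu> ^ 8 = (40 * C) * (r * \<Theta>) * (\<Theta> * \<nu> ^ 8)" by (simp add: power2_eq_square)
    also have "\<dots> \<le> \<nu> * 1 * (\<Theta> * \<nu> ^ 8)" unfolding r\<Theta>
      using C\<nu>' t2 t0 \<nu>1 C1 \<Theta>0 by (intro mult_mono) auto
    also have "\<dots> = \<Theta> * \<nu> ^ 9" by (simp add: eval_nat_numeral)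
    also have "\<dots> \<le> 1" using \<Theta>k[of 9] t2 by simp
    finally show ?thesis using small[OF _ \<epsilon>] by fastforce
  qed
  have d3: "r * \<Theta> * C * (\<Lambda> + h) \<le> \<epsilon> / 20"
  proof -
    have "(20 * (r * \<Theta> * C * (\<Lambda> + h))) * \<nu> ^ 8 = t * (20 * C * (\<Lambda> + h) * \<nu> ^ 8)" unfolding r\<Theta> by simp
    also have "\<dots> \<le> 1 * (20 * C * (2 * (h * \<nu>\<^sup>2)) * \<nu> ^ 8)"
      using t2 t0 C1 \<Lambda>_bounds h0 p0[of 8] by (intro mult_mono) (auto simp: \<Lambda>_def[symmetric])
    also have "\<dots> = (40 * C) * (h * \<nu> ^ 10)" by (simp add: eval_nat_numeral)
    also have "\<dots> \<le> \<nu> * (h * \<nu> ^ 10)" using C\<nu>' h0 p0[of 10] by (intro mult_right_mono) auto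
    also have "\<dots> = h * \<nu> ^ 11" by (simp add: eval_nat_numeral)
    also have "\<dots> \<le> 1" using hk[of 11] by simp
    finally show ?thesis using small[OF _ \<epsilon>] by fastforce
  qed
  have d4: "C * \<Lambda> \<le> a / 2"
  proof -
    have "(2 * (C * \<Lambda>)) * \<nu> ^ 5 = (2 * C) * (h * \<nu> ^ 7)" by (simp add: \<Lambda>_def eval_nat_numeral)
    also have "\<dots> \<le> \<nu> * (h * \<nu> ^ 7)" using C\<nu>' C1 h0 p0[of 7] by (intro mult_right_mono) auto
    also have "\<dots> = h * \<nu> ^ 8" by (simp add: eval_nat_numeral)
    also have "\<dots> \<le> 1" using hk[of 8] by simp
    finally show ?thesis using small[OF _ a] by fastforce
  qed
  have d5: "\<Theta> * \<nu>\<^sup>2 \<le> 1" using \<Theta>k[of 2] t2 by simp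
  have "\<Theta> * 2 \<le> \<Theta> * \<nu>" using \<nu>4 \<Theta>0 by (intro mult_left_mono) auto
  then have d6: "\<Theta> \<le> 1/2" using \<Theta>k[of 1] t2 by simp
  show ?thesis unfolding \<Theta>_def[symmetric]
    by unfold_locales (use \<Gamma> Sg A_ge N0 a0 \<epsilon>0 d1 d2 d3 d4 d5 d6 jac in \<open>auto simp: \<Theta>_def r_def\<close>)
qed

text \<open>The denominator is a multiple of 4 so that 1/2 and 3/4, the ends of the range where
  \<open>A\<close> is bounded below, are grid points.\<close>

definition grid :: "nat \<Rightarrow> real set" where
  "grid g = (\<lambda>j. real j / (4 * real g)) ` {j. h \<le> real j / (4 * real g) \<and> real j / (4 * real g) \<le> 1 - h}"

lemma grid_subset: "grid g \<subseteq> {h..1-h}"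
  by (auto simp: grid_def)

lemma grid_finite_card:
  assumes "0 < g" shows "finite (grid g)" "real (card (grid g)) \<le> 4 * real g + 1"
proof -
  let ?S = "{j. h \<le> real j / (4 * real g) \<and> real j / (4 * real g) \<le> 1 - h}"
  have *: "real i - real j \<le> 4 * real g" if "i \<in> ?S" "j \<in> ?S" for i j
  proof -
    have "real i / (4 * real g) \<le> 1" using that h0 by auto
    then have "real i \<le> 4 * real g" using assms by (simp add: field_simps)
    then show ?thesis by simp
  qed
  have "finite ?S" by (rule card_nats_in_interval(1)[OF *]) auto
  moreover have "real (card ?S) \<le> 4 * real g + 1" by (rule card_nats_in_interval(2)[OF *]) auto
  moreover have "card (grid g) \<le> card ?S" unfolding grid_def by (rule card_image_le) fact
  ultimately show "finite (grid g)" "real (card (grid g)) \<le> 4 * real g + 1" unfolding grid_def by auto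
qed

lemma grid_middle:
  assumes "0 < g" "j \<in> {2*g..3*g}"
  shows "real j / (4 * real g) \<in> grid g" "real j / (4 * real g) \<in> {1/2..3/4}"
proof -
  have "2 * real g \<le> real j" "real j \<le> 3 * real g" using assms by auto
  then have "1/2 \<le> real j / (4 * real g)" "real j / (4 * real g) \<le> 3/4" using assms by (auto simp: field_simps)
  then show "real j / (4 * real g) \<in> grid g" "real j / (4 * real g) \<in> {1/2..3/4}"
    unfolding grid_def using h_le by auto
qed

text \<open>Rounding goes towards the middle of the interval, upwards on the left half and downwards
  on the right half, so that the grid point cannot leave \<open>{h..1-h}\<close>.\<close>

lemma grid_close:
  assumes g: "0 < g" "1 \<le> 4 * real g * h" and u: "u \<in> {h..1-h}"
  obtains v where "v \<in> grid g" "\<bar>u - v\<bar> \<le> 1 / (4 * real g)"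
proof (cases "u \<le> 1/2")
  case True
  define j where "j = nat \<lceil>4 * real g * u\<rceil>"
  have p: "0 \<le> 4 * real g * u" using u h0 by auto
  have j: "4 * real g * u \<le> real j" "real j < 4 * real g * u + 1"
    unfolding j_def using p by (auto simp: of_nat_ceiling ceiling_correct)
     (use ceiling_correct[of "4 * real g * u"] in linarith)
  have e: "u \<le> real j / (4 * real g)" "real j / (4 * real g) \<le> u + 1 / (4 * real g)"
    using j g by (auto simp: field_simps)
  have "1 / (4 * real g) \<le> h" using g by (simp add: field_simps)
  then have "real j / (4 * real g) \<in> grid g" unfolding grid_def using e u True h_le by auto
  then show ?thesis using e by (intro that) auto
next
  case False
  define j where "j = nat \<lfloor>4 * real g * u\<rfloor>"
  have p: "0 \<le> 4 * real g * u" using u h0 by auto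
  have j: "real j \<le> 4 * real g * u" "4 * real g * u < real j + 1"
    unfolding j_def using p by auto
  have e: "real j / (4 * real g) \<le> u" "u \<le> real j / (4 * real g) + 1 / (4 * real g)"
    using j g by (auto simp: field_simps)
  have "1 / (4 * real g) \<le> h" using g by (simp add: field_simps)
  then have "real j / (4 * real g) \<in> grid g" unfolding grid_def using e u False h_le by auto
  then show ?thesis using e by (intro that) auto
qed

text \<open>The average of the process over the middle of the grid is a single centred sum with bounded
  summands, hence of order \<open>sqrt h\<close>; so the maximum cannot be much below zero.\<close>

lemma Gp_average_tail:
  assumes g: "0 < g" "1 \<le> 4 * real g * h"
  shows "measure UM {y \<in> space UM. \<forall>u\<in>grid g \<inter> {1/2..3/4}. 12 * C * \<nu> * sqrt h < Gp u y} \<le> 2 * exp (1 - \<nu>)"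
proof -
  let ?pt = "\<lambda>j. real j / (4 * real g)"
  let ?J = "{2*g..3*g}"
  \<comment> \<open>Interchanging the sums over grid points and over the sample turns the average of
    the process into a centred sum of \<open>H\<close> over the sample.\<close>
  define H where "H t = (\<Sum>j\<in>?J. kh (?pt j - t)) / (4 * real g)" for t
  have [measurable]: "H \<in> borel_measurable borel" unfolding H_def[abs_def] by measurable
  have pt_in: "?pt j \<in> {h..1-h}" if "j \<in> ?J" for j using grid_middle[OF g(1) that] grid_subset by blast
  have H0: "0 \<le> H t" for t unfolding H_def by (intro divide_nonneg_nonneg sum_nonneg kh_nonneg) auto
  \<comment> \<open>A kernel window contains at most \<open>2 * h * (4 * g) + 1\<close> grid points;
    the extra one is absorbed by \<open>1 \<le> 4 * g * h\<close>. The height \<open>C / h\<close>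
    then cancels the factor \<open>h\<close>.\<close>
  have H1: "H t \<le> 3 * C" for t
  proof -
    let ?S = "{j \<in> ?J. \<bar>?pt j - t\<bar> < h}"
    have dS: "real i - real j \<le> 2 * h * (4 * real g)" if "i \<in> ?S" "j \<in> ?S" for i j
    proof -
      have "?pt i - ?pt j \<le> 2 * h" using that by (auto simp: abs_less_iff)
      then have "(real i - real j) / (4 * real g) \<le> 2 * h" by (simp add: diff_divide_distrib)
      then show ?thesis using g by (simp add: pos_divide_le_eq)
    qed
    have "real (card ?S) \<le> 2 * h * (4 * real g) + 1" by (rule card_nats_in_interval(2)[OF dS]) (use h0 in auto)
    also have "\<dots> \<le> 3 * h * (4 * real g)" using g by (simp add: algebra_simps)
    finally have cS: "real (card ?S) \<le> 3 * h * (4 * real g)" .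
    have "(\<Sum>j\<in>?J. kh (?pt j - t)) = (\<Sum>j\<in>?S. kh (?pt j - t))"
      by (rule sum.mono_neutral_right) (auto simp: kh_zero not_less)
    also have "\<dots> \<le> (\<Sum>j\<in>?S. C / h)" by (rule sum_mono) (rule kh_le)
    also have "\<dots> = real (card ?S) * (C / h)" by simp
    also have "\<dots> \<le> 3 * h * (4 * real g) * (C / h)" using cS C1 h0 by (intro mult_right_mono) auto
    also have "\<dots> = 3 * C * (4 * real g)" using h0 by simp
    finally show ?thesis unfolding H_def using g by (simp add: pos_divide_le_eq)
  qed
  have bd: "\<bar>H t\<bar> \<le> 3 * C" for t using H0[of t] H1[of t] by simp
  have mean: "integral\<^sup>L unif01 H = real (g + 1) / (4 * real g)"
  proof -
    have "integral\<^sup>L unif01 H = (\<Sum>j\<in>?J. integral\<^sup>L unif01 (\<lambda>t. kh (?pt j - t))) / (4 * real g)"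
      unfolding H_def
      by (subst integral_divide_zero, subst Bochner_Integration.integral_sum)
         (auto intro!: integrable_unif01[of _ "C / h"] simp: kh_abs_le)
    also have "(\<Sum>j\<in>?J. integral\<^sup>L unif01 (\<lambda>t. kh (?pt j - t))) = (\<Sum>j\<in>?J. 1)"
      by (rule sum.cong) (use kh_integral_unif pt_in in auto)
    finally show ?thesis by simp
  qed
  have var: "integral\<^sup>L unif01 (\<lambda>t. (H t)\<^sup>2) \<le> (3 * C)\<^sup>2"
  proof -
    interpret U: prob_space unif01 by (rule prob_space_unif01)
    have sq: "(H t)\<^sup>2 \<le> (3 * C)\<^sup>2" for t using H0[of t] H1[of t] by (intro power_mono) auto
    have "integral\<^sup>L unif01 (\<lambda>t. (H t)\<^sup>2) \<le> integral\<^sup>L unif01 (\<lambda>t. (3 * C)\<^sup>2)"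
      by (rule integral_mono) (use sq in \<open>auto intro!: integrable_unif01[of _ "(3 * C)\<^sup>2"]\<close>)
    then show ?thesis using U.prob_space by simp
  qed
  let ?V = "real n * (3 * C)\<^sup>2"
  have "real n * h \<le> real n * (1/4)" using h_le by (intro mult_left_mono) auto
  then have "4 \<le> real n" using nh1 C1 by simp
  then have V: "real n * (3 * C)\<^sup>2 \<le> ?V" "4 * (3 * C)\<^sup>2 \<le> ?V" "0 < ?V"
    using C1 n0 by (auto intro!: mult_right_mono)
  have tail: "measure UM {y \<in> space UM. \<nu> * sqrt ?V \<le> \<bar>(\<Sum>i<n. H (y i)) - real n * integral\<^sup>L unif01 H\<bar>} \<le> 2 * exp (1 - \<nu>)"
    by (rule chernoff[OF prob_space_unif01 _ _ bd var V]) auto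
  have sub: "\<nu> * sqrt ?V \<le> \<bar>(\<Sum>i<n. H (y i)) - real n * integral\<^sup>L unif01 H\<bar>"
    if "\<forall>u\<in>grid g \<inter> {1/2..3/4}. 12 * C * \<nu> * sqrt h < Gp u y" for y
  proof -
    let ?t = "12 * C * \<nu> * sqrt h" and ?s = "sqrt (real n * h) / real n"
    have "real (g + 1) * ?t = (\<Sum>j\<in>?J. ?t)" by simp
    also have "\<dots> \<le> (\<Sum>j\<in>?J. Gp (?pt j) y)"
      by (rule sum_mono) (use that grid_middle[OF g(1)] in \<open>auto intro!: less_imp_le\<close>)
    also have "\<dots> = ?s * ((\<Sum>j\<in>?J. \<Sum>i<n. kh (?pt j - y i)) - real (g + 1) * real n)"
      unfolding Gp_def sum_distrib_left[symmetric] sum_subtractf by simp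
    also have "(\<Sum>j\<in>?J. \<Sum>i<n. kh (?pt j - y i)) = 4 * real g * (\<Sum>i<n. H (y i))"
      unfolding H_def using g by (subst sum.swap) (simp add: sum_divide_distrib[symmetric])
    also have "4 * real g * (\<Sum>i<n. H (y i)) - real (g + 1) * real n = 4 * real g * ((\<Sum>i<n. H (y i)) - real n * integral\<^sup>L unif01 H)"
      unfolding mean using g by (simp add: field_simps)
    finally have 1: "real (g + 1) * ?t \<le> ?s * (4 * real g * ((\<Sum>i<n. H (y i)) - real n * integral\<^sup>L unif01 H))" .
    have "real g * ?t \<le> real (g + 1) * ?t" using C1 \<nu>4 h0 by (intro mult_right_mono) auto
    then have "real g * ?t \<le> real g * (4 * ?s * ((\<Sum>i<n. H (y i)) - real n * integral\<^sup>L unif01 H))"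
      using 1 by (simp add: algebra_simps)
    then have 2: "?t \<le> 4 * ?s * ((\<Sum>i<n. H (y i)) - real n * integral\<^sup>L unif01 H)"
      using g(1) by (simp only: mult_le_cancel_left_pos of_nat_0_less_iff)
    \<comment> \<open>The threshold 12 is 3 from the sup bound \<open>3 * C\<close> times 4 from
      averaging over a quarter of the grid scale.\<close>
    have "?t = 4 * ?s * (\<nu> * sqrt ?V)"
    proof -
      have "sqrt ?V = sqrt (real n) * (3 * C)" using C1 by (simp add: real_sqrt_mult)
      moreover have "?s = sqrt h / sqrt (real n)"
        using n0 by (simp add: real_sqrt_mult field_simps)
      ultimately show ?thesis using n0 by simp
    qed
    then have "4 * ?s * (\<nu> * sqrt ?V) \<le> 4 * ?s * ((\<Sum>i<n. H (y i)) - real n * integral\<^sup>L unif01 H)" using 2 by simp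
    moreover have "0 < 4 * ?s" using n0 h0 by simp
    ultimately have "\<nu> * sqrt ?V \<le> (\<Sum>i<n. H (y i)) - real n * integral\<^sup>L unif01 H"
      by (simp only: mult_le_cancel_left_pos)
    then show ?thesis by linarith
  qed
  have "measure UM {y \<in> space UM. \<forall>u\<in>grid g \<inter> {1/2..3/4}. 12 * C * \<nu> * sqrt h < Gp u y}
    \<le> measure UM {y \<in> space UM. \<nu> * sqrt ?V \<le> \<bar>(\<Sum>i<n. H (y i)) - real n * integral\<^sup>L unif01 H\<bar>}"
    by (rule UM.finite_measure_mono) (use sub in auto)
  then show ?thesis using tail by linarith
qed

definition Gbad :: "nat \<Rightarrow> (nat \<Rightarrow> real) set" where
  "Gbad g = (\<Union>u\<in>grid g. {y \<in> space UM. \<nu> * sqrt C \<le> \<bar>Gp u y\<bar>})"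

lemma Gbad:
  assumes "0 < g"
  shows "Gbad g \<in> sets UM" "measure UM (Gbad g) \<le> (4 * real g + 1) * (2 * exp (1 - \<nu>))"
proof -
  have m: "{y \<in> space UM. \<nu> * sqrt C \<le> \<bar>Gp u y\<bar>} \<in> sets UM" for u by measurable
  show "Gbad g \<in> sets UM"
    unfolding Gbad_def by (rule sets.finite_UN[OF grid_finite_card(1)[OF assms]]) (rule m)
  have "measure UM (Gbad g) \<le> (\<Sum>u\<in>grid g. measure UM {y \<in> space UM. \<nu> * sqrt C \<le> \<bar>Gp u y\<bar>})"
    unfolding Gbad_def by (rule UM.finite_measure_subadditive_finite[OF grid_finite_card(1)[OF assms]]) (use m in auto)
  also have "\<dots> \<le> (\<Sum>u\<in>grid g. 2 * exp (1 - \<nu>))" by (rule sum_mono, rule Gp_tail) (use grid_subset[of g] in auto)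
  also have "\<dots> \<le> (4 * real g + 1) * (2 * exp (1 - \<nu>))"
    using grid_finite_card(2)[OF assms] by (simp add: mult_right_mono)
  finally show "measure UM (Gbad g) \<le> (4 * real g + 1) * (2 * exp (1 - \<nu>))" .
qed

text \<open>Off \<open>Gbad\<close>, points of weight below \<open>a1\<close> contribute at most
  \<open>x0\<close>. If the maximum exceeds \<open>x0\<close>, it is therefore attained in
  \<open>G2\<close>, where the transport applies with step \<nu>^(-8). To see that it exceeds
  \<open>x0\<close>, the transport is first run on \<open>G1\<close> with the larger step
  \<open>\<epsilon>1\<close>: by the averaging bound the maximum over \<open>G1\<close> is at least
  \<open>- \<rho>\<close>, and the first run excludes the whole stretch from there up to
  \<open>x0\<close>.\<close>

lemma grid_anti_concentration:
  assumes g: "0 < g" "1 \<le> 4 * real g * h" and N0: "0 < N"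
    and h40: "h * \<nu> ^ 40 \<le> 1" and nh40: "\<nu> ^ 40 \<le> real n * h" and C\<nu>: "40 * C\<^sup>2 \<le> \<nu>"
    and a0: "0 < a0" "\<And>u. u \<in> {1/2..3/4} \<Longrightarrow> a0 \<le> A u"
    and \<nu>a: "1 \<le> a0 * \<nu>" and \<nu>N: "160 * real N * (13 * C\<^sup>2) \<le> a0 * \<nu>"
    and Sg: "1 \<in> Sg" "Sg \<subseteq> {1, -1}"
  shows "measure UM {y \<in> space UM. x \<le> Wmax (grid g) Sg y \<and> Wmax (grid g) Sg y \<le> x + 1 / \<nu> ^ 8}
    \<le> 288 / real N + (8 * (2 / \<Lambda> + 1) * (6 + 8 * real g) + 8 * real g + 4) * exp (1 - \<nu>)"
proof -
  have \<nu>1: "1 \<le> \<nu>" using \<nu>4 by simp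
  have pw: "\<nu> ^ i \<le> \<nu> ^ j" if "i \<le> j" for i j using \<nu>1 that by (rule power_increasing[rotated])
  have p0: "0 < \<nu> ^ i" for i using \<nu>4 by simp
  have CC: "1 \<le> C\<^sup>2" "C \<le> C\<^sup>2" using C1 by (auto simp: power2_eq_square mult_ge1_I)
  let ?G = "grid g"
  define a1 where "a1 = 1 / \<nu> ^ 5"
  define G1 where "G1 = {u \<in> ?G. a0 \<le> A u}"
  define G2 where "G2 = {u \<in> ?G. a1 \<le> A u}"
  have finG: "finite ?G" by (rule grid_finite_card(1)[OF g(1)])
  have mid: "?G \<inter> {1/2..3/4} \<subseteq> G1" using a0 by (auto simp: G1_def)
  have midne: "?G \<inter> {1/2..3/4} \<noteq> {}" using grid_middle[OF g(1), of "2*g"] by auto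
  have a0\<nu>5: "1 \<le> a0 * \<nu> ^ 5"
  proof -
    have "a0 * \<nu> ^ 1 \<le> a0 * \<nu> ^ 5" using pw[of 1 5] a0(1) by (intro mult_left_mono) auto
    then show ?thesis using \<nu>a by simp
  qed
  have a01: "a1 \<le> a0"
  proof -
    show ?thesis using a0\<nu>5 p0[of 5] by (simp add: a1_def pos_divide_le_eq)
  qed
  have G12: "G1 \<subseteq> G2" using a01 by (auto simp: G1_def G2_def)
  define x0 where "x0 = a1 * (\<nu> * C)"
  define \<rho> where "\<rho> = 12 * C\<^sup>2 * \<nu> * sqrt h"
  have x00: "0 \<le> x0" using p0 C1 \<nu>1 by (simp add: x0_def a1_def)
  have \<rho>0: "0 \<le> \<rho>" using C1 \<nu>1 h0 by (simp add: \<rho>_def)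
  \<comment> \<open>Long enough to cover the stretch from \<open>- \<rho>\<close> to
    \<open>x0\<close>; both lengths are of order \<nu>^(-4).\<close>
  define \<epsilon>1 where "\<epsilon>1 = 13 * C\<^sup>2 / \<nu> ^ 4"
  have x0e: "x0 = C / \<nu> ^ 4" using \<nu>4 by (simp add: x0_def a1_def eval_nat_numeral field_simps)
  have "\<rho> \<le> 12 * C\<^sup>2 / \<nu> ^ 4"
  proof -
    have "(sqrt h * \<nu> ^ 5)\<^sup>2 = h * \<nu> ^ 10" using h0 by (simp add: power_mult_distrib flip: power_mult)
    also have "\<dots> \<le> h * \<nu> ^ 40" using pw[of 10 40] h0 by (intro mult_left_mono) auto
    finally have "(sqrt h * \<nu> ^ 5)\<^sup>2 \<le> 1\<^sup>2" using h40 by simp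
    then have "sqrt h * \<nu> ^ 5 \<le> 1" by (rule power2_le_imp_le) simp
    then have "12 * C\<^sup>2 * (sqrt h * \<nu> ^ 5) \<le> 12 * C\<^sup>2 * 1" by (intro mult_left_mono) auto
    then show ?thesis using p0[of 4] by (simp add: \<rho>_def pos_le_divide_eq eval_nat_numeral algebra_simps)
  qed
  moreover have "x0 \<le> C\<^sup>2 / \<nu> ^ 4" unfolding x0e using CC p0[of 4] by (intro divide_right_mono) auto
  ultimately have \<epsilon>1: "x0 + \<rho> \<le> \<epsilon>1" unfolding \<epsilon>1_def by (simp add: add_divide_distrib[symmetric])
  interpret L1: shift_levels K C h n A \<nu> G1 "{1}" a0 \<epsilon>1 "4 * real N * \<epsilon>1 / (a0 * sqrt (real n * h))" N
  proof (rule shift_levelsI)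
    show "finite G1" "G1 \<noteq> {}" "G1 \<subseteq> {h..1-h}" using finG mid midne grid_subset by (auto simp: G1_def)
    have "1 * \<nu> ^ 0 \<le> (13 * C\<^sup>2) * \<nu> ^ 4" using CC pw[of 0 4] by (intro mult_mono) auto
    moreover have "\<epsilon>1 * \<nu> ^ 8 = (13 * C\<^sup>2) * \<nu> ^ 4" using \<nu>4 by (simp add: \<epsilon>1_def eval_nat_numeral)
    ultimately show "1 \<le> \<epsilon>1 * \<nu> ^ 8" by simp
    show "1 \<le> a0 * \<nu> ^ 5" by (rule a0\<nu>5)
    have "160 * real N * \<epsilon>1 * \<nu>\<^sup>2 = 160 * real N * (13 * C\<^sup>2) / \<nu>\<^sup>2"
      using \<nu>4 by (simp add: \<epsilon>1_def eval_nat_numeral)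
    also have "\<dots> \<le> a0 * \<nu> / \<nu>\<^sup>2" using \<nu>N by (intro divide_right_mono) auto
    also have "\<dots> = a0 / \<nu>" using \<nu>4 by (simp add: power2_eq_square)
    also have "\<dots> \<le> a0" using \<nu>1 a0(1) by (simp add: pos_divide_le_eq)
    finally show "160 * real N * \<epsilon>1 * \<nu>\<^sup>2 \<le> a0" .
  qed (use N0 h40 nh40 C\<nu> in \<open>auto simp: G1_def\<close>)
  interpret L2: shift_levels K C h n A \<nu> G2 Sg a1 "1 / \<nu> ^ 8" "4 * real N * (1 / \<nu> ^ 8) / (a1 * sqrt (real n * h))" N
  proof (rule shift_levelsI)
    show "finite G2" "G2 \<noteq> {}" "G2 \<subseteq> {h..1-h}" using finG mid midne G12 grid_subset by (auto simp: G2_def)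
    show "1 \<le> 1 / \<nu> ^ 8 * \<nu> ^ 8" "1 \<le> a1 * \<nu> ^ 5" using \<nu>4 by (auto simp: a1_def)
    have "a0 \<le> C" using a0(2)[of "1/2"] A_le[of "1/2"] by auto
    then have "a0 * \<nu> \<le> C * \<nu>" using \<nu>1 by (intro mult_right_mono) auto
    then have "160 * real N * (13 * C\<^sup>2) \<le> C * \<nu>" using \<nu>N by linarith
    moreover have "C * (160 * real N) \<le> (13 * C\<^sup>2) * (160 * real N)"
      using CC by (intro mult_right_mono) auto
    ultimately have "C * (160 * real N) \<le> C * \<nu>" by (simp add: algebra_simps)
    then have "160 * real N \<le> \<nu>" using C1 by simp
    then have "160 * real N / \<nu> ^ 6 \<le> \<nu> / \<nu> ^ 6" using p0[of 6] by (intro divide_right_mono) auto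
    then show "160 * real N * (1 / \<nu> ^ 8) * \<nu>\<^sup>2 \<le> a1" using \<nu>4 by (simp add: a1_def eval_nat_numeral)
  qed (use N0 h40 nh40 C\<nu> Sg in \<open>auto simp: G2_def\<close>)
  have card1: "real (card G1) \<le> 4 * real g + 1" "real (card G2) \<le> 4 * real g + 1"
    using grid_finite_card[OF g(1)] card_mono[OF finG, of G1] card_mono[OF finG, of G2] by (auto simp: G1_def G2_def)
  define Low where "Low = {y \<in> space UM. \<forall>u\<in>?G \<inter> {1/2..3/4}. 12 * C * \<nu> * sqrt h < Gp u y}"
  define S1 where "S1 = {y \<in> space UM. - \<rho> \<le> L1.W y \<and> L1.W y \<le> - \<rho> + \<epsilon>1}"
  define S2 where "S2 = {y \<in> space UM. x \<le> L2.W y \<and> L2.W y \<le> x + 1 / \<nu> ^ 8}"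
  define tiny where "tiny = 4 * (2 / \<Lambda> + 1) * (6 + 8 * real g) * exp (1 - \<nu>)"
  have tinyI: "4 * (2 / \<Lambda> + 1) * (4 + 2 * real (card \<Gamma>)) * exp (1 - \<nu>) \<le> tiny" if "real (card \<Gamma>) \<le> 4 * real g + 1" for \<Gamma> :: "real set"
    unfolding tiny_def using that \<Lambda>_bounds by (intro mult_right_mono mult_left_mono) auto
  have Lowm: "Low \<in> sets UM" unfolding Low_def by (rule sets.sets_Collect_finite_All) (use finG in auto)
  have S1m: "S1 \<in> sets UM" unfolding S1_def by measurable
  have S2m: "S2 \<in> sets UM" unfolding S2_def by measurable
  have "{y \<in> space UM. x \<le> Wmax ?G Sg y \<and> Wmax ?G Sg y \<le> x + 1 / \<nu> ^ 8} \<subseteq> S2 \<union> (S1 \<union> (Low \<union> Gbad g))"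
  proof
    fix y assume y: "y \<in> {y \<in> space UM. x \<le> Wmax ?G Sg y \<and> Wmax ?G Sg y \<le> x + 1 / \<nu> ^ 8}"
    show "y \<in> S2 \<union> (S1 \<union> (Low \<union> Gbad g))"
    proof (rule ccontr)
      assume n: "y \<notin> S2 \<union> (S1 \<union> (Low \<union> Gbad g))"
      then obtain u where u: "u \<in> ?G" "u \<in> {1/2..3/4}" "Gp u y \<le> 12 * C * \<nu> * sqrt h"
        using y unfolding Low_def by (auto simp: not_less)
      have u1: "u \<in> G1" using mid u by auto
      have u01: "u \<in> {0..1}" using u(2) by auto
      have "A u * Gp u y \<le> A u * (12 * C * \<nu> * sqrt h)" using u(3) A_nonneg[OF u01] by (rule mult_left_mono)
      also have "\<dots> \<le> C * (12 * C * \<nu> * sqrt h)" using A_le[OF u01] C1 \<nu>1 h0 by (intro mult_right_mono) auto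
      also have "\<dots> = \<rho>" by (simp add: \<rho>_def power2_eq_square)
      finally have "- \<rho> \<le> 1 * Zp u y" by (simp add: Zp_def)
      also have "\<dots> \<le> L1.W y" by (rule Wmax_ge) (use u1 L1.\<Gamma> in auto)
      finally have "- \<rho> \<le> L1.W y" .
      then have "- \<rho> + \<epsilon>1 < L1.W y" using n y unfolding S1_def by auto
      then have W1: "x0 < L1.W y" using \<epsilon>1 by linarith
      obtain v \<sigma> where v: "v \<in> G1" "\<sigma> \<in> {1}" "\<sigma> * Zp v y = L1.W y"
        by (rule Wmax_attained[OF L1.\<Gamma>(1) L1.finite_Sg L1.\<Gamma>(2) L1.Sg(1), where y = y])
      \<comment> \<open>Here \<open>1 \<in> Sg\<close> is used: the one-sided maximum over
        \<open>G1\<close> is below the maximum in question for either choice of signs.\<close>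
      have "L1.W y \<le> Wmax ?G Sg y"
        unfolding v(3)[symmetric] by (rule Wmax_ge) (use finG L2.finite_Sg v Sg in \<open>auto simp: G1_def\<close>)
      then have WG: "x0 < Wmax ?G Sg y" using W1 by linarith
      have sub: "w \<in> G2" if w: "w \<in> ?G" "\<tau> \<in> Sg" "x0 < \<tau> * Zp w y" for w \<tau>
      proof (rule ccontr)
        assume "w \<notin> G2"
        then have Aw: "A w \<le> a1" using w by (auto simp: G2_def)
        have w01: "w \<in> {0..1}" using w(1) grid_subset h0 by force
        have "\<bar>Gp w y\<bar> \<le> \<nu> * sqrt C" using n y w(1) unfolding Gbad_def by force
        also have "\<dots> \<le> \<nu> * C" using \<nu>1 C1 by (intro mult_left_mono) (auto intro!: real_le_lsqrt simp: power2_eq_square)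
        finally have "\<bar>A w * Gp w y\<bar> \<le> x0" unfolding x0_def abs_mult
          using Aw A_nonneg[OF w01] \<nu>1 C1 by (intro mult_mono) auto
        moreover have "\<tau> * Zp w y \<le> \<bar>A w * Gp w y\<bar>" using L2.abs_Sg[OF w(2)] abs_ge_self[of "\<tau> * Zp w y"] by (simp add: Zp_def abs_mult)
        ultimately show False using w(3) by linarith
      qed
      have "Wmax ?G Sg y = L2.W y"
      proof (rule antisym)
        obtain w \<tau> where w: "w \<in> ?G" "\<tau> \<in> Sg" "\<tau> * Zp w y = Wmax ?G Sg y"
          by (rule Wmax_attained[of ?G Sg y]) (use finG L2.finite_Sg L2.Sg midne in auto)
        have "w \<in> G2" by (rule sub[OF w(1,2)]) (use w WG in simp)
        then show "Wmax ?G Sg y \<le> L2.W y"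
          unfolding w(3)[symmetric] by (intro Wmax_ge) (use L2.\<Gamma> L2.finite_Sg w in auto)
        obtain w' \<tau>' where w': "w' \<in> G2" "\<tau>' \<in> Sg" "\<tau>' * Zp w' y = L2.W y"
          by (rule Wmax_attained[of G2 Sg y]) (use L2.\<Gamma> L2.finite_Sg L2.Sg in auto)
        show "L2.W y \<le> Wmax ?G Sg y"
          unfolding w'(3)[symmetric] by (intro Wmax_ge) (use finG L2.finite_Sg w' in \<open>auto simp: G2_def\<close>)
      qed
      then show False using y n unfolding S2_def by auto
    qed
  qed
  then have "measure UM {y \<in> space UM. x \<le> Wmax ?G Sg y \<and> Wmax ?G Sg y \<le> x + 1 / \<nu> ^ 8} \<le> measure UM (S2 \<union> (S1 \<union> (Low \<union> Gbad g)))"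
    by (intro UM.finite_measure_mono sets.Un Lowm S1m S2m Gbad(1)[OF g(1)])
  also have "\<dots> \<le> measure UM S2 + (measure UM S1 + (measure UM Low + measure UM (Gbad g)))"
    by (intro order_trans[OF measure_subadditive] add_left_mono sets.Un Lowm S1m S2m Gbad(1)[OF g(1)] order_refl) auto
  also have "measure UM S2 \<le> 144 / real N + tiny"
    unfolding S2_def using L2.anti_concentration[of x] tinyI[OF card1(2)] by linarith
  also have "measure UM S1 \<le> 144 / real N + tiny"
    unfolding S1_def using L1.anti_concentration[of "- \<rho>"] tinyI[OF card1(1)] by linarith
  also have "measure UM Low \<le> 2 * exp (1 - \<nu>)" unfolding Low_def by (rule Gp_average_tail[OF g])
  also have "measure UM (Gbad g) \<le> (4 * real g + 1) * (2 * exp (1 - \<nu>))" by (rule Gbad(2)[OF g(1)])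
  finally show ?thesis unfolding tiny_def by (simp add: algebra_simps add_divide_distrib[symmetric])
qed

end

section \<open>Order statistics\<close>

text \<open>Turns statements about order statistics into statements about counts. Both the quantile
  expansion and measurability are obtained through it.\<close>

lemma ordstat_le_iff:
  assumes k: "1 \<le> k" "k \<le> n"
  shows "ordstat n b k \<le> t \<longleftrightarrow> k \<le> card {i. i < n \<and> b i \<le> t}"
proof -
  let ?xs = "map b [0..<n]"
  let ?ys = "sort ?xs"
  have len: "length ?ys = n" by simp
  have "length (filter (\<lambda>x. x \<le> t) ?xs) = length (filter (\<lambda>x. x \<le> t) ?ys)"
    by (simp add: filter_sort)
  moreover have "length (filter (\<lambda>x. x \<le> t) ?xs) = card {i. i < n \<and> b i \<le> t}"
    unfolding length_filter_conv_card by (rule arg_cong[of _ _ card]) auto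
  moreover have "length (filter (\<lambda>x. x \<le> t) ?ys) = card {i. i < n \<and> ?ys ! i \<le> t}"
    unfolding length_filter_conv_card len ..
  ultimately have c: "card {i. i < n \<and> b i \<le> t} = card {i. i < n \<and> ?ys ! i \<le> t}" by simp
  have mono: "?ys ! i \<le> ?ys ! j" if "i \<le> j" "j < n" for i j
    using that by (intro sorted_nth_mono) auto
  show ?thesis
  proof
    assume "ordstat n b k \<le> t"
    then have "{0..<k} \<subseteq> {i. i < n \<and> ?ys ! i \<le> t}"
    proof (intro subsetI CollectI conjI)
      fix i assume i: "i \<in> {0..<k}"
      show "i < n" using i k by simp
      have "?ys ! i \<le> ?ys ! (k - 1)" by (rule mono) (use i k in auto)
      also have "\<dots> \<le> t" using \<open>ordstat n b k \<le> t\<close> unfolding ordstat_def .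
      finally show "?ys ! i \<le> t" .
    qed
    then have "card {0..<k} \<le> card {i. i < n \<and> ?ys ! i \<le> t}" by (intro card_mono) auto
    then show "k \<le> card {i. i < n \<and> b i \<le> t}" using c by simp
  next
    assume le: "k \<le> card {i. i < n \<and> b i \<le> t}"
    show "ordstat n b k \<le> t"
    proof (rule ccontr)
      assume n: "\<not> ordstat n b k \<le> t"
      have "{i. i < n \<and> ?ys ! i \<le> t} \<subseteq> {..<k - 1}"
      proof
        fix i assume i: "i \<in> {i. i < n \<and> ?ys ! i \<le> t}"
        show "i \<in> {..<k - 1}"
        proof (rule ccontr)
          assume "i \<notin> {..<k - 1}"
          then have "?ys ! (k - 1) \<le> ?ys ! i" using i by (intro mono) auto
          then show False using i n unfolding ordstat_def by auto
        qed
      qed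
      then have "card {i. i < n \<and> ?ys ! i \<le> t} \<le> card {..<k - 1}" by (intro card_mono) auto
      then show False using le c k by simp
    qed
  qed
qed

lemma ordstat_mono:
  assumes "1 \<le> k" "k \<le> l" "l \<le> n"
  shows "ordstat n b k \<le> ordstat n b l"
  unfolding ordstat_def using assms by (intro sorted_nth_mono) auto

lemma ordstat_mem:
  assumes "1 \<le> k" "k \<le> n"
  shows "ordstat n b k \<in> b ` {..<n}"
proof -
  have "sort (map b [0..<n]) ! (k - 1) \<in> set (sort (map b [0..<n]))"
    using assms by (intro nth_mem) auto
  then show ?thesis unfolding ordstat_def by (auto simp: atLeast0LessThan)
qed

lemma ordstat_cong:
  assumes "\<And>i. i < n \<Longrightarrow> b i = b' i" shows "ordstat n b k = ordstat n b' k"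
proof -
  have "map b [0..<n] = map b' [0..<n]" by (rule map_cong) (use assms in auto)
  then show ?thesis unfolding ordstat_def by (simp only:)
qed

lemma ordstat_mono_on:
  assumes "1 \<le> k" "k \<le> n" and f: "mono_on S f" and S: "\<And>i. i < n \<Longrightarrow> b i \<in> S"
  shows "ordstat n (\<lambda>i. f (b i)) k = f (ordstat n b k)"
proof -
  let ?xs = "map b [0..<n]"
  have sub: "set (sort ?xs) \<subseteq> S" using S by auto
  have "sorted (map f (sort ?xs))"
    unfolding sorted_map
  proof (rule sorted_wrt_mono_rel[of "sort ?xs" "(\<le>)"])
    fix x y assume "x \<in> set (sort ?xs)" "y \<in> set (sort ?xs)" "x \<le> y"
    then show "f x \<le> f y" using sub by (intro mono_onD[OF f]) auto
  qed simp
  moreover have "mset (map f (sort ?xs)) = mset (map (\<lambda>i. f (b i)) [0..<n])"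
    unfolding mset_map mset_sort by (simp add: image_mset.compositionality comp_def)
  ultimately have "sort (map (\<lambda>i. f (b i)) [0..<n]) = map f (sort ?xs)"
    by (intro properties_for_sort) auto
  then show ?thesis unfolding ordstat_def using assms(1,2) by simp
qed

section \<open>Quantile expansion on regular samples\<close>

text \<open>\<open>F k\<close> counts the sample points below \<open>k/n\<close>; all expansions are carried out on this grid, which
  avoids derivatives of the merely Lipschitz kernel.\<close>

locale regular_sample = weighted_process +
  fixes y :: "nat \<Rightarrow> real" and F :: "nat \<Rightarrow> real"
  assumes F_def: "F = (\<lambda>k. real (card {i. i < n \<and> y i \<le> real k / real n}))"
    and y01: "\<And>i. i < n \<Longrightarrow> y i \<in> {0<..1}"
    and F_dev: "\<And>i j. i \<le> j \<Longrightarrow> j \<le> n \<Longrightarrow> \<bar>F j - F i - (real j - real i)\<bar> \<le> \<nu> * sqrt (real j - real i)"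
    and root_n_h: "\<nu> ^ 40 \<le> sqrt (real n) * h"
begin

abbreviation X :: "nat \<Rightarrow> real" where "X \<equiv> ordstat n y"

lemma nu1: "1 \<le> \<nu>"
  using \<nu>4 by simp

lemma F_dev_abs:
  assumes "i \<le> n" "j \<le> n"
  shows "\<bar>F j - F i - (real j - real i)\<bar> \<le> \<nu> * sqrt \<bar>real j - real i\<bar>"
proof (cases "i \<le> j")
  case True then show ?thesis using F_dev[OF True assms(2)] by simp
next
  case False
  then have "\<bar>F i - F j - (real i - real j)\<bar> \<le> \<nu> * sqrt (real i - real j)" using assms by (intro F_dev) auto
  moreover have "\<bar>real j - real i\<bar> = real i - real j" using False by simp
  moreover have "\<bar>F j - F i - (real j - real i)\<bar> = \<bar>F i - F j - (real i - real j)\<bar>" by linarith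
  ultimately show ?thesis by (simp only:)
qed

lemma F0: "F 0 = 0"
proof -
  have "{i. i < n \<and> y i \<le> real 0 / real n} = {}" using y01 by force
  then show ?thesis unfolding F_def by simp
qed

lemma X01:
  assumes "1 \<le> k" "k \<le> n"
  shows "0 < X k" "X k \<le> 1"
  using ordstat_mem[OF assms, of y] y01 by auto

lemma sqrt_n: "\<nu> ^ 40 \<le> sqrt (real n)" "1 \<le> sqrt (real n)"
proof -
  have "sqrt (real n) * h \<le> sqrt (real n) * 1" using h_le by (intro mult_left_mono) auto
  then show "\<nu> ^ 40 \<le> sqrt (real n)" using root_n_h by linarith
  moreover have "1 \<le> \<nu> ^ 40" using nu1 by simp
  ultimately show "1 \<le> sqrt (real n)" by linarith
qed

text \<open>The order statistic lies in the cell ending at \<open>j / n\<close> exactly when the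
  count \<open>F\<close> passes \<open>k\<close> there. Positivity of the sample rules out the cell
  index 0.\<close>

lemma X_cell:
  assumes k: "1 \<le> k" "k \<le> n"
  obtains j where "1 \<le> j" "j \<le> n" "real j - 1 < real n * X k" "real n * X k \<le> real j" "real k \<le> F j" "F (j - 1) < real k"
proof -
  define j where "j = nat \<lceil>real n * X k\<rceil>"
  have p: "0 < real n * X k" using X01[OF k] n0 by simp
  have j: "real n * X k \<le> real j" "real j - 1 < real n * X k"
    unfolding j_def using p ceiling_correct[of "real n * X k"] by (auto simp: of_nat_nat)
  have j1: "1 \<le> j" using j(1) p by (cases j) auto
  have "real n * X k \<le> real n * 1" using X01[OF k] n0 by (intro mult_left_mono) auto
  then have jn: "j \<le> n" using j(2) by linarith
  have "X k \<le> real j / real n" using j(1) n0 by (simp add: field_simps)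
  then have "k \<le> card {i. i < n \<and> y i \<le> real j / real n}" using ordstat_le_iff[OF k] by blast
  then have Fj: "real k \<le> F j" by (simp add: F_def)
  have "real (j - 1) / real n < X k" using j(2) j1 n0 by (simp add: field_simps of_nat_diff)
  then have "\<not> X k \<le> real (j - 1) / real n" by simp
  then have "\<not> k \<le> card {i. i < n \<and> y i \<le> real (j - 1) / real n}" using ordstat_le_iff[OF k] by blast
  then have "F (j - 1) < real k" by (simp add: F_def)
  then show ?thesis using that j j1 jn Fj by blast
qed

lemma X_near:
  assumes k: "1 \<le> k" "k \<le> n"
  shows "\<bar>real n * X k - real k\<bar> \<le> \<nu> * sqrt (real n) + 1"
proof -
  obtain j where j: "1 \<le> j" "j \<le> n" "real j - 1 < real n * X k" "real n * X k \<le> real j" "real k \<le> F j" "F (j - 1) < real k"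
    by (rule X_cell[OF k])
  have b: "\<bar>F i - real i\<bar> \<le> \<nu> * sqrt (real n)" if "i \<le> n" for i
  proof -
    have "\<bar>F i - real i\<bar> \<le> \<nu> * sqrt (real i)" using F_dev[of 0 i] that F0 by simp
    also have "\<dots> \<le> \<nu> * sqrt (real n)" using that nu1 by (intro mult_left_mono) auto
    finally show ?thesis .
  qed
  have "j - 1 \<le> n" "real (j - 1) = real j - 1" using j by auto
  then show ?thesis using b[of j] b[of "j - 1"] j(2-6) by linarith
qed

definition "r4 = sqrt (sqrt (real n))"

lemma r4: "1 \<le> r4" "r4\<^sup>2 = sqrt (real n)"
  using sqrt_n unfolding r4_def by auto

text \<open>Let \<open>j\<close> be the cell of \<open>X k\<close>, so that \<open>F j\<close> is
  about \<open>k\<close>. As \<open>j\<close> and \<open>k\<close> differ by about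
  \<open>\<nu> * sqrt n\<close>, the increment \<open>F j - F k\<close> equals \<open>j - k\<close>
  up to \<open>\<nu>\<^sup>2 * r4\<close>; solving for \<open>j\<close> gives
  \<open>2 * k - F k\<close>.\<close>

lemma bahadur:
  assumes k: "1 \<le> k" "k \<le> n"
  shows "\<bar>real n * X k - (2 * real k - F k)\<bar> \<le> 2 * \<nu>\<^sup>2 * r4"
proof -
  obtain j where j: "1 \<le> j" "j \<le> n" "real j - 1 < real n * X k" "real n * X k \<le> real j" "real k \<le> F j" "F (j - 1) < real k"
    by (rule X_cell[OF k])
  have e: "\<bar>F i - F k - (real i - real k)\<bar> \<le> \<nu>\<^sup>2 * r4" if i: "i \<le> n" "\<bar>real i - real k\<bar> \<le> \<nu> * sqrt (real n) + 2" for i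
  proof -
    have "2 * 1 \<le> \<nu> * sqrt (real n)" using \<nu>4 sqrt_n by (intro mult_mono) auto
    then have "\<bar>real i - real k\<bar> \<le> 2 * (\<nu> * sqrt (real n))" using i(2) by linarith
    also have "\<dots> \<le> \<nu> * (\<nu> * sqrt (real n))" using \<nu>4 sqrt_n by (intro mult_right_mono) auto
    also have "\<dots> = (\<nu> * r4)\<^sup>2" using r4 by (simp add: power_mult_distrib power2_eq_square[of \<nu>])
    finally have "sqrt \<bar>real i - real k\<bar> \<le> \<nu> * r4" using nu1 r4 by (intro real_le_lsqrt) auto
    then have "\<nu> * sqrt \<bar>real i - real k\<bar> \<le> \<nu> * (\<nu> * r4)" using nu1 by (intro mult_left_mono) auto
    then show ?thesis using F_dev_abs[OF k(2) i(1)] by (simp add: power2_eq_square)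
  qed
  have j1: "j - 1 \<le> n" "real (j - 1) = real j - 1" using j by auto
  have near: "\<bar>real n * X k - real k\<bar> \<le> \<nu> * sqrt (real n) + 1" by (rule X_near[OF k])
  have "\<bar>real j - real k\<bar> \<le> \<nu> * sqrt (real n) + 2" "\<bar>real (j - 1) - real k\<bar> \<le> \<nu> * sqrt (real n) + 2"
    using near j j1 by linarith+
  then have "\<bar>F j - F k - (real j - real k)\<bar> \<le> \<nu>\<^sup>2 * r4" "\<bar>F (j - 1) - F k - (real (j - 1) - real k)\<bar> \<le> \<nu>\<^sup>2 * r4"
    using e[OF j(2)] e[OF j1(1)] by blast+
  then have "\<bar>real n * X k - (2 * real k - F k)\<bar> \<le> \<nu>\<^sup>2 * r4 + 1"
    using j(3-6) j1(2) by linarith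
  moreover have "1 * 1 \<le> \<nu>\<^sup>2 * r4" using nu1 r4 by (intro mult_mono) auto
  ultimately show ?thesis by (simp add: algebra_simps)
qed

section \<open>Discretised kernel sums and summation by parts\<close>

definition "\<kappa> u k = kh (u - real k / real n)"

text \<open>This is \<open>hatq\<close> for the uniform sample itself, whose quantile density is
  1.\<close>

definition "Su u = (\<Sum>k=1..n-1. \<kappa> u k * (X (k + 1) - X k))"

definition "Tu u = (\<Sum>i<n. kh (u - y i))"

lemma inv_n_h: "1 / real n \<le> h / 4" "1 / real n \<le> 1"
proof -
  have "4 * 1 \<le> real n * h" using nh1 C1 by linarith
  then show "1 / real n \<le> h / 4" using n0 by (simp add: field_simps)
  then show "1 / real n \<le> 1" using h_le by linarith
qed

lemma kappa_ends:
  assumes "u \<in> {h..1-h}"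
  shows "\<kappa> u 0 = 0" "\<kappa> u n = 0"
  unfolding \<kappa>_def using assms n0 by (auto intro!: kh_zero)

lemma summation_by_parts:
  fixes f g :: "nat \<Rightarrow> real"
  shows "(\<Sum>k<m. f k * (g (k + 1) - g k)) = f m * g m - f 0 * g 0 + (\<Sum>k=1..m. (f (k - 1) - f k) * g k)"
  by (induction m) (auto simp: algebra_simps)

lemma Su_by_parts:
  assumes u: "u \<in> {h..1-h}"
  shows "Su u = (\<Sum>k=1..n. (\<kappa> u (k - 1) - \<kappa> u k) * X k)"
proof -
  \<comment> \<open>The added summand contains \<open>X 0\<close>, which by natural subtraction is
    the first order statistic; it is harmless because \<open>\<kappa> u 0 = 0\<close>.\<close>
  have "{..<n} = insert 0 {1..n-1}" using n0 by auto
  then have "(\<Sum>k<n. \<kappa> u k * (X (k + 1) - X k)) = Su u" using kappa_ends[OF u] by (simp add: Su_def)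
  then show ?thesis unfolding summation_by_parts using kappa_ends[OF u] by simp
qed

text \<open>About \<open>2 * n * h\<close> increments are nonzero and each is at most
  \<open>C / (h\<^sup>2 * n)\<close>. This bound multiplies the Bahadur error after summation by
  parts.\<close>

lemma kappa_variation:
  assumes u: "u \<in> {h..1-h}"
  shows "(\<Sum>k=1..n. \<bar>\<kappa> u (k - 1) - \<kappa> u k\<bar>) \<le> 3 * C / h"
proof -
  let ?D = "\<lambda>k. \<kappa> u (k - 1) - \<kappa> u k"
  let ?S = "{k \<in> {1..n}. real n * (u - h) < real k \<and> real k < real n * (u + h) + 1}"
  have "real i - real j \<le> 2 * (real n * h) + 1" if "i \<in> ?S" "j \<in> ?S" for i j
    using that by (auto simp: algebra_simps)
  then have "real (card ?S) \<le> (2 * (real n * h) + 1) + 1" using n0 h0 by (intro card_nats_in_interval(2)) auto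
  also have "\<dots> \<le> 3 * (real n * h)" using nh1 C1 by linarith
  finally have cS: "real (card ?S) \<le> 3 * (real n * h)" .
  have z: "?D k = 0" if "k \<in> {1..n} - ?S" for k
  proof -
    have "real k \<le> real n * (u - h) \<or> real n * (u + h) + 1 \<le> real k" using that by auto
    then have "\<bar>u - real k / real n\<bar> \<ge> h \<and> \<bar>u - real (k - 1) / real n\<bar> \<ge> h"
    proof
      assume a: "real k \<le> real n * (u - h)"
      then have "real k / real n \<le> u - h" using n0 by (simp add: field_simps)
      moreover have "real (k - 1) / real n \<le> real k / real n" by (simp add: divide_right_mono)
      ultimately show ?thesis by linarith
    next
      assume a: "real n * (u + h) + 1 \<le> real k"
      then have "u + h \<le> real (k - 1) / real n" using n0 that by (simp add: field_simps of_nat_diff)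
      moreover have "real (k - 1) / real n \<le> real k / real n" by (simp add: divide_right_mono)
      ultimately show ?thesis by linarith
    qed
    then show ?thesis unfolding \<kappa>_def by (simp add: kh_zero)
  qed
  have "(\<Sum>k=1..n. \<bar>?D k\<bar>) = (\<Sum>k\<in>?S. \<bar>?D k\<bar>)"
    by (rule sum.mono_neutral_right) (use z in auto)
  also have "\<dots> \<le> (\<Sum>k\<in>?S. C / h\<^sup>2 * (1 / real n))"
  proof (rule sum_mono)
    fix k assume k: "k \<in> ?S"
    have "\<bar>?D k\<bar> \<le> C / h\<^sup>2 * \<bar>(u - real (k - 1) / real n) - (u - real k / real n)\<bar>" unfolding \<kappa>_def by (rule kh_lip)
    also have "(u - real (k - 1) / real n) - (u - real k / real n) = 1 / real n"
      using k by (simp add: of_nat_diff diff_divide_distrib)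
    finally show "\<bar>?D k\<bar> \<le> C / h\<^sup>2 * (1 / real n)" by simp
  qed
  also have "\<dots> = real (card ?S) * (C / h\<^sup>2 * (1 / real n))" by simp
  also have "\<dots> \<le> 3 * (real n * h) * (C / h\<^sup>2 * (1 / real n))" using cS C1 by (intro mult_right_mono) auto
  also have "\<dots> = 3 * C / h" using n0 h0 by (simp add: power2_eq_square)
  finally show ?thesis .
qed

text \<open>The kernel frozen at the left end of every cell of length \<open>1 / n\<close>. Its sum
  over the sample is a Stieltjes sum against \<open>F\<close>, the same expression that summation by
  parts produces.\<close>

definition step :: "real \<Rightarrow> real \<Rightarrow> real" where
  "step u t = (\<Sum>k<n. \<kappa> u k * indicator {real k / real n<..real (k + 1) / real n} t)"

lemma step_close:
  assumes t: "t \<in> {0<..1}"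
  shows "\<bar>step u t - kh (u - t)\<bar> \<le> C / (h\<^sup>2 * real n) * indicator {u - 2 * h<..<u + 2 * h} t"
proof -
  define k where "k = nat \<lceil>real n * t\<rceil> - 1"
  have p: "0 < real n * t" using t n0 by simp
  then have c: "1 \<le> nat \<lceil>real n * t\<rceil>" by linarith
  have k: "real k < real n * t" "real n * t \<le> real k + 1"
    unfolding k_def using p c ceiling_correct[of "real n * t"] by (auto simp: of_nat_diff of_nat_nat)
  have "real n * t \<le> real n * 1" using t n0 by (intro mult_left_mono) auto
  then have kn: "k < n" using k(1) by linarith
  have cell: "t \<in> {real i / real n<..real (i + 1) / real n} \<longleftrightarrow> i = k" for i
  proof
    assume "t \<in> {real i / real n<..real (i + 1) / real n}"
    then have "real i < real n * t" "real n * t \<le> real i + 1" using n0 by (auto simp: field_simps)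
    then show "i = k" using k by linarith
  next
    assume "i = k" then show "t \<in> {real i / real n<..real (i + 1) / real n}" using k n0 by (auto simp: field_simps)
  qed
  have "step u t = (\<Sum>i<n. if i = k then \<kappa> u k else 0)"
    unfolding step_def by (rule sum.cong) (use cell in \<open>auto simp: indicator_def\<close>)
  also have "\<dots> = \<kappa> u k" using kn by simp
  finally have s: "step u t = kh (u - real k / real n)" by (simp add: \<kappa>_def)
  have tk: "real k / real n < t" "t \<le> real k / real n + 1 / real n" using k n0 by (auto simp: field_simps)
  show ?thesis
  proof (cases "t \<in> {u - 2 * h<..<u + 2 * h}")
    case True
    have "\<bar>step u t - kh (u - t)\<bar> \<le> C / h\<^sup>2 * \<bar>(u - real k / real n) - (u - t)\<bar>" unfolding s by (rule kh_lip)
    also have "\<dots> \<le> C / h\<^sup>2 * (1 / real n)" using tk C1 by (intro mult_left_mono) auto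
    finally show ?thesis using True by simp
  next
    case False
    then have "h \<le> \<bar>u - t\<bar>" "h \<le> \<bar>u - real k / real n\<bar>" using tk inv_n_h h0 by auto
    then show ?thesis unfolding s using False by (simp add: kh_zero)
  qed
qed

lemma step_sum: "(\<Sum>i<n. step u (y i)) = (\<Sum>k<n. \<kappa> u k * (F (k + 1) - F k))"
proof -
  have "(\<Sum>i<n. indicator {real k / real n<..real (k + 1) / real n} (y i)) = F (k + 1) - F k" for k
  proof -
    let ?B = "\<lambda>k. {i. i < n \<and> y i \<le> real k / real n}"
    have sub: "?B k \<subseteq> ?B (k + 1)"
      using divide_right_mono[of "real k" "real (k + 1)" "real n"] by (auto intro: order_trans)
    have "(\<Sum>i<n. indicator {real k / real n<..real (k + 1) / real n} (y i)) = (\<Sum>i\<in>?B (k + 1) - ?B k. (1::real))"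
      by (rule sum.mono_neutral_cong_right) (auto simp: indicator_def)
    also have "\<dots> = real (card (?B (k + 1)) - card (?B k))" using sub by (simp add: card_Diff_subset)
    also have "\<dots> = F (k + 1) - F k" unfolding F_def using card_mono[OF _ sub] by (subst of_nat_diff) auto
    finally show ?thesis .
  qed
  then show ?thesis unfolding step_def by (subst sum.swap) (simp add: sum_distrib_left[symmetric])
qed

lemma step_measurable [measurable]: "step u \<in> borel_measurable borel"
  unfolding step_def[abs_def] by measurable

text \<open>The sum is \<open>n\<close> times the uniform integral of \<open>step u\<close>, whereas
  the kernel itself integrates to 1; \<open>step_close\<close> bounds the difference on a window of
  length \<open>4 * h\<close>.\<close>

lemma kappa_sum:
  assumes u: "u \<in> {h..1-h}"
  shows "\<bar>(\<Sum>k<n. \<kappa> u k) - real n\<bar> \<le> 4 * C / h"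
proof -
  have i1: "integrable unif01 (\<lambda>t. \<kappa> u k * indicator {real k / real n<..real (k + 1) / real n} t)" for k
    by (rule integrable_unif01[of _ "\<bar>\<kappa> u k\<bar>"]) (auto simp: indicator_def)
  have i2: "integrable unif01 (step u)" unfolding step_def by (rule Bochner_Integration.integrable_sum) (rule i1)
  have i3: "integrable unif01 (\<lambda>t. kh (u - t))" by (rule integrable_unif01[of _ "C / h"]) (auto simp: kh_abs_le)
  have "integral\<^sup>L unif01 (step u) = (\<Sum>k<n. \<kappa> u k * (1 / real n))"
  proof -
    have "integral\<^sup>L unif01 (step u) = (\<Sum>k<n. integral\<^sup>L unif01 (\<lambda>t. \<kappa> u k * indicator {real k / real n<..real (k + 1) / real n} t))"
      unfolding step_def by (rule Bochner_Integration.integral_sum) (rule i1)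
    also have "\<dots> = (\<Sum>k<n. \<kappa> u k * (1 / real n))"
    proof (rule sum.cong[OF refl])
      fix k assume k: "k \<in> {..<n}"
      have "measure unif01 {real k / real n<..real (k + 1) / real n} = real (k + 1) / real n - real k / real n"
        using k n0 by (intro measure_unif01_Ioc) (auto simp: divide_right_mono)
      then show "integral\<^sup>L unif01 (\<lambda>t. \<kappa> u k * indicator {real k / real n<..real (k + 1) / real n} t) = \<kappa> u k * (1 / real n)"
        by (simp add: add_divide_distrib)
    qed
    finally show ?thesis .
  qed
  then have ES: "(\<Sum>k<n. \<kappa> u k) / real n - 1 = integral\<^sup>L unif01 (\<lambda>t. step u t - kh (u - t))"
    using i2 i3 kh_integral_unif[OF u] by (simp add: sum_divide_distrib)
  have "\<bar>(\<Sum>k<n. \<kappa> u k) / real n - 1\<bar> \<le> integral\<^sup>L unif01 (\<lambda>t. \<bar>step u t - kh (u - t)\<bar>)"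
    unfolding ES by (rule integral_abs_bound)
  also have "\<dots> \<le> integral\<^sup>L unif01 (\<lambda>t. C / (h\<^sup>2 * real n) * indicator {max 0 (u - 2 * h)..min 1 (u + 2 * h)} t)"
  proof (rule integral_mono_AE)
    show "integrable unif01 (\<lambda>t. \<bar>step u t - kh (u - t)\<bar>)" using i2 i3 by auto
    show "integrable unif01 (\<lambda>t. C / (h\<^sup>2 * real n) * indicator {max 0 (u - 2 * h)..min 1 (u + 2 * h)} t)"
      by (rule integrable_unif01[of _ "\<bar>C / (h\<^sup>2 * real n)\<bar>"]) (auto simp: indicator_def)
    have "AE t in unif01. t \<noteq> 0"
      using emeasure_unif01[of "{0}"] by (intro AE_I[of _ _ "{0}"]) auto
    then show "AE t in unif01. \<bar>step u t - kh (u - t)\<bar> \<le> C / (h\<^sup>2 * real n) * indicator {max 0 (u - 2 * h)..min 1 (u + 2 * h)} t"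
      using AE_unif01
    proof eventually_elim
      case (elim t)
      then have "\<bar>step u t - kh (u - t)\<bar> \<le> C / (h\<^sup>2 * real n) * indicator {u - 2 * h<..<u + 2 * h} t"
        by (intro step_close) auto
      also have "\<dots> \<le> C / (h\<^sup>2 * real n) * indicator {max 0 (u - 2 * h)..min 1 (u + 2 * h)} t"
        using elim C1 by (intro mult_left_mono) (auto simp: indicator_def)
      finally show ?case .
    qed
  qed
  also have "\<dots> = C / (h\<^sup>2 * real n) * (min 1 (u + 2 * h) - max 0 (u - 2 * h))"
    using u h0 by (simp add: measure_unif01_Icc)
  also have "\<dots> \<le> C / (h\<^sup>2 * real n) * (4 * h)" using C1 by (intro mult_left_mono) auto
  finally have *: "\<bar>(\<Sum>k<n. \<kappa> u k) / real n - 1\<bar> \<le> C / (h\<^sup>2 * real n) * (4 * h)" .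
  have "(\<Sum>k<n. \<kappa> u k) - real n = real n * ((\<Sum>k<n. \<kappa> u k) / real n - 1)" using n0 by (simp add: field_simps)
  then have "\<bar>(\<Sum>k<n. \<kappa> u k) - real n\<bar> = real n * \<bar>(\<Sum>k<n. \<kappa> u k) / real n - 1\<bar>" by (simp only: abs_mult abs_of_nat)
  also have "\<dots> \<le> real n * (C / (h\<^sup>2 * real n) * (4 * h))" using * by (intro mult_left_mono) auto
  also have "\<dots> = 4 * C / h" using n0 h0 by (simp add: power2_eq_square)
  finally show ?thesis .
qed

text \<open>The window is enclosed in whole cells, with an expected number of at most
  \<open>4 * n * h + 2\<close> points. The bound \<open>5 * n * h\<close> absorbs the rounding, and
  one further \<open>n * h\<close> absorbs the deviation of \<open>F\<close>.\<close>

lemma window_count: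
  "real (card {i. i < n \<and> y i \<in> {u - 2 * h<..<u + 2 * h}}) \<le> 6 * (real n * h)" if u: "u \<in> {h..1-h}"
proof -
  define p where "p = nat \<lfloor>real n * (u - 2 * h)\<rfloor>"
  define m where "m = nat \<lceil>real n * (u + 2 * h)\<rceil>"
  define q where "q = min n m"
  have un: "0 \<le> real n * (u + 2 * h)" "real n * (u - 2 * h) \<le> real n" "real n * (u - 2 * h) \<le> real n * (u + 2 * h)"
    using u h0 n0 by (auto intro!: mult_left_mono)
  have q1: "real m \<le> real n * (u + 2 * h) + 1" "real n * (u + 2 * h) \<le> real m"
    using un(1) ceiling_correct[of "real n * (u + 2 * h)"] by (auto simp: of_nat_nat m_def)
  have p1: "real n * (u - 2 * h) - 1 \<le> real p" "real p \<le> max 0 (real n * (u - 2 * h))"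
    unfolding p_def by linarith+
  have q2: "real q \<le> real n * (u + 2 * h) + 1" "q \<le> n" "real q = min (real n) (real m)" unfolding q_def using q1 by auto
  have pq: "p \<le> q"
  proof -
    have "real p \<le> real n" "real p \<le> real m" using p1(2) q1(2) un unfolding max_def by (auto split: if_splits)
    then show ?thesis unfolding q_def by auto
  qed
  let ?B = "\<lambda>k. {i. i < n \<and> y i \<le> real k / real n}"
  have "{i. i < n \<and> y i \<in> {u - 2 * h<..<u + 2 * h}} \<subseteq> ?B q - ?B p"
  proof
    fix i assume i: "i \<in> {i. i < n \<and> y i \<in> {u - 2 * h<..<u + 2 * h}}"
    then have yi: "0 < y i" "y i \<le> 1" "u - 2 * h < y i" "y i < u + 2 * h" "i < n" using y01 by auto
    have "real n * y i \<le> real n * (u + 2 * h)" "real n * y i \<le> real n * 1" using yi n0 by (auto intro!: mult_left_mono)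
    then have "real n * y i \<le> real q" unfolding q2(3) using q1 by auto
    moreover have "real n * (u - 2 * h) < real n * y i" "0 < real n * y i" using yi n0 by auto
    then have "real p < real n * y i" using p1 by auto
    ultimately show "i \<in> ?B q - ?B p" using yi n0 by (auto simp: field_simps)
  qed
  then have "card {i. i < n \<and> y i \<in> {u - 2 * h<..<u + 2 * h}} \<le> card (?B q - ?B p)" by (intro card_mono) auto
  also have sub: "?B p \<subseteq> ?B q"
    using divide_right_mono[of "real p" "real q" "real n"] pq by (auto intro: order_trans)
  then have "card (?B q - ?B p) = card (?B q) - card (?B p)" by (intro card_Diff_subset) auto
  finally have "real (card {i. i < n \<and> y i \<in> {u - 2 * h<..<u + 2 * h}}) \<le> F q - F p"
    unfolding F_def using card_mono[OF _ sub] by (auto simp: of_nat_diff)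
  also have "\<dots> \<le> (real q - real p) + \<nu> * sqrt (real q - real p)" using F_dev[OF pq q2(2)] by linarith
  also have "real q - real p \<le> 5 * (real n * h)"
  proof -
    have "real q - real p \<le> real n * (u + 2 * h) - real n * (u - 2 * h) + 2" using p1 q2 by linarith
    also have "real n * (u + 2 * h) - real n * (u - 2 * h) = 4 * (real n * h)" by (simp add: algebra_simps)
    finally show ?thesis using nh1 C1 by linarith
  qed
  then have "(real q - real p) + \<nu> * sqrt (real q - real p) \<le> 5 * (real n * h) + \<nu> * sqrt (5 * (real n * h))"
    using nu1 by (intro add_mono mult_left_mono) auto
  also have "\<nu> * sqrt (5 * (real n * h)) \<le> real n * h"
  proof -
    have "real n = sqrt (real n) * sqrt (real n)" by simp
    then have "real n * h = sqrt (real n) * (sqrt (real n) * h)" by (metis mult.assoc)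
    moreover have "1 * \<nu> ^ 40 \<le> sqrt (real n) * (sqrt (real n) * h)" using sqrt_n root_n_h nu1 by (intro mult_mono) auto
    moreover have "\<nu> ^ 4 \<le> \<nu> ^ 40" using nu1 by (intro power_increasing) auto
    ultimately have nh4: "\<nu> ^ 4 \<le> real n * h" by linarith
    have "5 * \<nu>\<^sup>2 \<le> \<nu>\<^sup>2 * \<nu>\<^sup>2" using \<nu>4 power_mono[of 4 \<nu> 2] by (intro mult_right_mono) auto
    then have "5 * \<nu>\<^sup>2 \<le> real n * h" using nh4 by (simp add: power_add[symmetric])
    then have "(5 * \<nu>\<^sup>2) * (real n * h) \<le> (real n * h) * (real n * h)" using n0 h0 by (intro mult_right_mono) auto
    then have "\<nu>\<^sup>2 * (5 * (real n * h)) \<le> (real n * h)\<^sup>2" by (simp add: power2_eq_square algebra_simps)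
    then have "sqrt (\<nu>\<^sup>2 * (5 * (real n * h))) \<le> real n * h" using n0 h0 by (intro real_le_lsqrt) auto
    moreover have "sqrt (\<nu>\<^sup>2 * (5 * (real n * h))) = \<nu> * sqrt (5 * (real n * h))"
      using nu1 by (simp only: real_sqrt_mult real_sqrt_abs abs_of_nonneg[of \<nu>])
    ultimately show ?thesis by simp
  qed
  finally show ?thesis by linarith
qed

text \<open>Inserting the quantile expansion into the summation by parts gives
  \<open>2 * R1 - R2\<close>. The Riemann sum \<open>R1\<close> is close to \<open>n\<close> and the
  Stieltjes sum \<open>R2\<close> close to \<open>Tu u\<close>, so \<open>n * Su u\<close> is close
  to \<open>2 * n - Tu u\<close>: the spacings estimate fluctuates opposite to the kernel
  sum.\<close>

lemma Su_expansion:
  assumes u: "u \<in> {h..1-h}"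
  shows "\<bar>real n * Su u - real n + (Tu u - real n)\<bar> \<le> 7 * C * \<nu>\<^sup>2 * r4 / h"
proof -
  define R1 where "R1 = (\<Sum>k<n. \<kappa> u k)"
  define R2 where "R2 = (\<Sum>k<n. \<kappa> u k * (F (k + 1) - F k))"
  let ?D = "\<lambda>k. \<kappa> u (k - 1) - \<kappa> u k"
  have s1: "(\<Sum>k=1..n. ?D k * real k) = R1"
    using summation_by_parts[of "\<kappa> u" real n] kappa_ends[OF u] by (simp add: R1_def)
  have s2: "(\<Sum>k=1..n. ?D k * F k) = R2"
    using summation_by_parts[of "\<kappa> u" F n] kappa_ends[OF u] by (simp add: R2_def)
  have "real n * Su u = (\<Sum>k=1..n. ?D k * (real n * X k))"
    unfolding Su_by_parts[OF u] sum_distrib_left by (rule sum.cong[OF refl], rule mult.left_commute)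
  also have "\<dots> = (\<Sum>k=1..n. 2 * (?D k * real k) - ?D k * F k + ?D k * (real n * X k - (2 * real k - F k)))"
  proof (rule sum.cong[OF refl])
    fix k
    have "d * x = 2 * (d * a) - d * b + d * (x - (2 * a - b))" for d x a b :: real by algebra
    then show "?D k * (real n * X k) = 2 * (?D k * real k) - ?D k * F k + ?D k * (real n * X k - (2 * real k - F k))" .
  qed
  also have "\<dots> = (\<Sum>k=1..n. 2 * (?D k * real k)) - (\<Sum>k=1..n. ?D k * F k) + (\<Sum>k=1..n. ?D k * (real n * X k - (2 * real k - F k)))"
    by (simp only: sum.distrib[of "\<lambda>k. 2 * (?D k * real k) - ?D k * F k"] sum_subtractf[of "\<lambda>k. 2 * (?D k * real k)"])
  finally have e0: "real n * Su u = (\<Sum>k=1..n. 2 * (?D k * real k)) - (\<Sum>k=1..n. ?D k * F k) + (\<Sum>k=1..n. ?D k * (real n * X k - (2 * real k - F k)))" .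
  have s3: "(\<Sum>k=1..n. 2 * (?D k * real k)) = 2 * R1" unfolding s1[symmetric] by (rule sum_distrib_left[symmetric])
  have e: "real n * Su u = 2 * R1 - R2 + (\<Sum>k=1..n. ?D k * (real n * X k - (2 * real k - F k)))"
    using e0 unfolding s2 s3 .
  have "\<bar>\<Sum>k=1..n. ?D k * (real n * X k - (2 * real k - F k))\<bar> \<le> (\<Sum>k=1..n. \<bar>?D k\<bar> * (2 * \<nu>\<^sup>2 * r4))"
  proof (rule order_trans[OF sum_abs], rule sum_mono)
    fix k assume "k \<in> {1..n}"
    then show "\<bar>?D k * (real n * X k - (2 * real k - F k))\<bar> \<le> \<bar>?D k\<bar> * (2 * \<nu>\<^sup>2 * r4)"
      unfolding abs_mult by (intro mult_left_mono[OF bahadur abs_ge_zero]) simp_all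
  qed
  also have "\<dots> = (\<Sum>k=1..n. \<bar>?D k\<bar>) * (2 * \<nu>\<^sup>2 * r4)" by (simp only: sum_distrib_right)
  also have "\<dots> \<le> 3 * C / h * (2 * \<nu>\<^sup>2 * r4)" using r4(1) by (intro mult_right_mono kappa_variation[OF u]) simp_all
  finally have b1: "\<bar>\<Sum>k=1..n. ?D k * (real n * X k - (2 * real k - F k))\<bar> \<le> 3 * C / h * (2 * \<nu>\<^sup>2 * r4)" .
  have TR: "Tu u - R2 = (\<Sum>i<n. kh (u - y i) - step u (y i))"
    unfolding Tu_def R2_def step_sum[symmetric] by (simp add: sum_subtractf)
  have "\<bar>Tu u - R2\<bar> \<le> (\<Sum>i<n. C / (h\<^sup>2 * real n) * indicator {u - 2 * h<..<u + 2 * h} (y i))"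
    unfolding TR
  proof (rule order_trans[OF sum_abs], rule sum_mono)
    fix i assume "i \<in> {..<n}"
    then show "\<bar>kh (u - y i) - step u (y i)\<bar> \<le> C / (h\<^sup>2 * real n) * indicator {u - 2 * h<..<u + 2 * h} (y i)"
      using step_close[of "y i" u] y01 by (simp add: abs_minus_commute)
  qed
  also have "\<dots> = C / (h\<^sup>2 * real n) * real (card {i. i < n \<and> y i \<in> {u - 2 * h<..<u + 2 * h}})"
  proof -
    have "(\<Sum>i<n. indicator {u - 2 * h<..<u + 2 * h} (y i)) = (\<Sum>i\<in>{i. i < n \<and> y i \<in> {u - 2 * h<..<u + 2 * h}}. (1::real))"
      by (rule sum.mono_neutral_cong_right) (auto simp: indicator_def)
    then show ?thesis unfolding sum_distrib_left[symmetric] by simp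
  qed
  also have "\<dots> \<le> C / (h\<^sup>2 * real n) * (6 * (real n * h))" using C1 by (intro mult_left_mono window_count[OF u]) auto
  also have "\<dots> = 6 * C / h" using n0 h0 by (simp add: power2_eq_square)
  finally have b2: "\<bar>Tu u - R2\<bar> \<le> 6 * C / h" .
  have b3: "\<bar>R1 - real n\<bar> \<le> 4 * C / h" unfolding R1_def by (rule kappa_sum[OF u])
  have "real n * Su u - real n + (Tu u - real n) =
      2 * (R1 - real n) + (Tu u - R2) + (\<Sum>k=1..n. ?D k * (real n * X k - (2 * real k - F k)))"
    unfolding e by algebra
  moreover have "\<bar>2 * a + b + c\<bar> \<le> 2 * A + B + D" if "\<bar>c\<bar> \<le> D" "\<bar>b\<bar> \<le> B" "\<bar>a\<bar> \<le> A" for a b c A B D :: real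
    using that by linarith
  ultimately have "\<bar>real n * Su u - real n + (Tu u - real n)\<bar> \<le> 2 * (4 * C / h) + 6 * C / h + 3 * C / h * (2 * \<nu>\<^sup>2 * r4)"
    using b1 b2 b3 by (simp only:)
  also have "\<dots> = C / h * (14 + 6 * (\<nu>\<^sup>2 * r4))" using h0 by (simp add: field_simps)
  also have "\<dots> \<le> C / h * (7 * (\<nu>\<^sup>2 * r4))"
  proof (rule mult_left_mono)
    have "(4::real)\<^sup>2 * 1 \<le> \<nu>\<^sup>2 * r4" using \<nu>4 r4(1) by (intro mult_mono power_mono) simp_all
    then have "16 \<le> \<nu>\<^sup>2 * r4" by simp
    then show "14 + 6 * (\<nu>\<^sup>2 * r4) \<le> 7 * (\<nu>\<^sup>2 * r4)" by linarith
  qed (use C1 h0 in auto)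
  also have "\<dots> = 7 * C * \<nu>\<^sup>2 * r4 / h" by simp
  finally show ?thesis .
qed

end

text \<open>Pure arithmetic, to be read with \<open>s = sqrt (n * h)\<close>,
  \<open>S = Su u\<close>, \<open>G = Gp u y\<close>, \<open>H = hatq\<close>, \<open>d\<close> the
  error of \<open>hatQ\<close>, and \<open>\<delta>\<close> the error of \<open>q * S\<close> as an
  approximation of \<open>H\<close>. Dividing by \<open>H\<close> instead of \<open>q\<close>
  removes the unknown density and leaves \<open>- A * G\<close> as the leading term.\<close>

lemma studentized_ratio_bound:
  fixes C \<nu> s h G S e \<delta> A q d H :: real
  assumes C1: "1 \<le> C" and \<nu>C: "160 * C ^ 5 \<le> \<nu>" and s: "\<nu> ^ 20 \<le> s" and h0: "0 < h"
    and hs: "h * s * \<nu> ^ 12 \<le> 1" and h40: "h * \<nu> ^ 40 \<le> 1"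
    and S: "S = 1 - G / s + e" and G: "\<bar>G\<bar> \<le> 2 * \<nu> * C" and e: "\<bar>s * e\<bar> \<le> 7 * C / \<nu> ^ 18"
    and H: "H = q * S + \<delta>" and \<delta>: "\<bar>\<delta>\<bar> \<le> 2 * C * h * S" and q: "1 \<le> C * q" "q \<le> C"
    and A: "0 \<le> A" "A \<le> C" and d: "\<bar>s * d\<bar> \<le> 2 * C * \<nu> * sqrt h"
  shows "0 < H" "\<bar>s * (d + A * (H - q)) / H + A * G\<bar> \<le> 1 / \<nu> ^ 11"
proof -
  have Cp: "1 \<le> C ^ k" "C ^ i \<le> C ^ j" if "i \<le> j" for i j k using C1 that by (auto intro: power_increasing one_le_power)
  have "160 * 1 \<le> 160 * C ^ 5" using Cp(1)[of 0 0 5] by simp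
  then have \<nu>160: "160 \<le> \<nu>" using \<nu>C by linarith
  then have \<nu>1: "1 \<le> \<nu>" by simp
  have p0: "0 < \<nu> ^ k" for k using \<nu>160 by simp
  have pw: "\<nu> ^ i \<le> \<nu> ^ j" if "i \<le> j" for i j using \<nu>1 that by (rule power_increasing[rotated])
  have ip: "1 / \<nu> ^ j \<le> 1 / \<nu> ^ i" if "i \<le> j" for i j using pw[OF that] p0[of i] by (intro divide_left_mono) auto
  have C5: "160 * C \<le> \<nu>" "160 * C\<^sup>2 \<le> \<nu>" using \<nu>C Cp(2)[of 1 5] Cp(2)[of 2 5] by auto
  have s0: "0 < s" using s p0[of 20] by linarith
  define w where "w = 1 / \<nu> ^ 12"
  have w0: "0 < w" unfolding w_def using p0[of 12] by simp
  have Gs: "\<bar>G / s\<bar> \<le> 2 * C / \<nu> ^ 19"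
  proof -
    have "\<bar>G / s\<bar> \<le> (2 * \<nu> * C) / \<nu> ^ 20"
      unfolding abs_divide using G s s0 p0[of 20] C1 \<nu>1 by (intro frac_le) auto
    also have "\<dots> = 2 * C / \<nu> ^ 19" using \<nu>160 by (simp add: eval_nat_numeral)
    finally show ?thesis .
  qed
  have ee: "\<bar>e\<bar> \<le> 7 * C / \<nu> ^ 19"
  proof -
    have "\<bar>e\<bar> * \<nu> \<le> \<bar>e\<bar> * s" using s pw[of 1 20] by (intro mult_left_mono) auto
    also have "\<dots> = \<bar>s * e\<bar>" using s0 by (simp add: abs_mult)
    finally have "\<bar>e\<bar> * \<nu> \<le> 7 * C / \<nu> ^ 18" using e by linarith
    then have "\<bar>e\<bar> * \<nu> / \<nu> \<le> 7 * C / \<nu> ^ 18 / \<nu>" using \<nu>160 by (intro divide_right_mono) auto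
    then have "\<bar>e\<bar> \<le> 7 * C / \<nu> ^ 18 / \<nu>" using \<nu>160 by simp
    also have "\<dots> = 7 * C / \<nu> ^ 19" by (simp add: eval_nat_numeral)
    finally show ?thesis .
  qed
  have S1: "\<bar>S - 1\<bar> \<le> 9 * C / \<nu> ^ 19" 
  proof -
    have "9 * C / \<nu> ^ 19 = 2 * C / \<nu> ^ 19 + 7 * C / \<nu> ^ 19" by (simp add: add_divide_distrib[symmetric])
    then show ?thesis using Gs ee unfolding S by linarith
  qed
  have "9 * C / \<nu> ^ 19 \<le> 1/2"
  proof -
    have "9 * C / \<nu> ^ 19 \<le> 9 * C / \<nu>" using pw[of 1 19] \<nu>160 C1 by (intro divide_left_mono) auto
    also have "\<dots> \<le> 1/2" using C5 \<nu>160 by (simp add: pos_divide_le_eq)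
    finally show ?thesis .
  qed
  then have S2: "1/2 \<le> S" "S \<le> 2" using S1 by linarith+
  have q0: "1 / C \<le> q" using q(1) C1 by (simp add: pos_divide_le_eq mult.commute)
  have hC: "2 * C * h \<le> 1 / (2 * C)"
  proof -
    have "4 * C\<^sup>2 * h \<le> \<nu> * h" using C5 h0 C1 by (intro mult_right_mono) auto
    also have "\<dots> \<le> \<nu> ^ 40 * h" using pw[of 1 40] h0 by (intro mult_right_mono) auto
    also have "\<dots> \<le> 1" using h40 by (simp add: mult.commute)
    finally show ?thesis using C1 by (simp add: pos_le_divide_eq power2_eq_square algebra_simps)
  qed
  have Hge: "1 / (4 * C) \<le> H"
  proof -
    have "1 / (4 * C) = (1 / C - 1 / (2 * C)) * (1/2)" using C1 by (simp add: field_simps)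
    also have "\<dots> \<le> (q - 2 * C * h) * S"
    proof -
      have "1 / (2 * C) \<le> 1 / C" using C1 by (simp add: field_simps)
      then have "2 * C * h \<le> q" using q0 hC by linarith
      then show ?thesis using q0 hC S2 by (intro mult_mono) auto
    qed
    also have "\<dots> = q * S - 2 * C * h * S" by (simp add: algebra_simps)
    also have "\<dots> \<le> H" using \<delta> unfolding H by linarith
    finally show ?thesis .
  qed
  moreover have "0 < 1 / (4 * C)" using C1 by simp
  ultimately show H0: "0 < H" by linarith
  have sS: "s * (S - 1) = - G + s * e" using s0 unfolding S by (simp add: field_simps)
  \<comment> \<open>What is left of the numerator after adding \<open>A * G * H\<close>: the terms
    of order 1, \<open>- q * G\<close> from \<open>s * (S - 1)\<close> and \<open>q * G\<close> from
    \<open>G * H\<close>, have cancelled.\<close>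
  define Num where "Num = s * d + A * (q * (G * (S - 1) + s * e) + \<delta> * (s + G))"
  have id: "s * (d + A * (H - q)) + A * G * H = Num"
  proof -
    have "s * (H - q) + G * H = q * (s * (S - 1) + G * S) + \<delta> * (s + G)" unfolding H by (simp add: algebra_simps)
    also have "s * (S - 1) + G * S = G * (S - 1) + s * e" unfolding sS by (simp add: algebra_simps)
    finally have "A * (s * (H - q) + G * H) = A * (q * (G * (S - 1) + s * e) + \<delta> * (s + G))" by simp
    then show ?thesis unfolding Num_def by (simp add: algebra_simps)
  qed
  have n1: "\<bar>s * d\<bar> \<le> 2 * C ^ 4 * w"
  proof -
    have "sqrt h * \<nu> ^ 20 \<le> 1"
    proof (rule power2_le_imp_le)
      show "(sqrt h * \<nu> ^ 20)\<^sup>2 \<le> 1\<^sup>2" using h40 h0 by (simp add: power_mult_distrib flip: power_mult)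
    qed simp
    then have "sqrt h * \<nu> * \<nu> ^ 19 \<le> 1" by (simp add: eval_nat_numeral mult.assoc)
    then have "\<nu> * sqrt h \<le> 1 / \<nu> ^ 19" using p0[of 19] by (simp add: pos_le_divide_eq mult.commute)
    also have "\<dots> \<le> w" unfolding w_def by (rule ip) simp
    finally have "2 * C * (\<nu> * sqrt h) \<le> 2 * C ^ 4 * w" using C1 Cp(2)[of 1 4] w0 h0 \<nu>1 by (intro mult_mono) auto
    then show ?thesis using d by (simp add: mult.assoc)
  qed
  have n2: "\<bar>G * (S - 1)\<bar> \<le> 18 * C\<^sup>2 * w"
  proof -
    have "\<bar>G * (S - 1)\<bar> \<le> (2 * \<nu> * C) * (9 * C / \<nu> ^ 19)"
      unfolding abs_mult using G S1 \<nu>1 C1 by (intro mult_mono) auto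
    also have "\<dots> = 18 * C\<^sup>2 * (1 / \<nu> ^ 18)" using \<nu>160 by (simp add: eval_nat_numeral)
    also have "\<dots> \<le> 18 * C\<^sup>2 * w" unfolding w_def using C1 by (intro mult_left_mono ip) auto
    finally show ?thesis .
  qed
  have n3: "\<bar>s * e\<bar> \<le> 7 * C\<^sup>2 * w"
  proof -
    have "7 * C * (1 / \<nu> ^ 18) \<le> 7 * C\<^sup>2 * w" unfolding w_def using C1 Cp(2)[of 1 2] p0[of 18] by (intro mult_mono ip) auto
    then show ?thesis using e by simp
  qed
  have n4: "\<bar>\<delta> * (s + G)\<bar> \<le> 12 * C\<^sup>2 * w"
  proof -
    have "2 * C * h * S \<le> 2 * C * h * 2" using S2 C1 h0 by (intro mult_left_mono) auto
    then have "\<bar>\<delta>\<bar> \<le> 4 * C * h" using \<delta> by linarith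
    moreover have "\<bar>s + G\<bar> \<le> s + 2 * \<nu> * C" using G s0 by linarith
    ultimately have "\<bar>\<delta> * (s + G)\<bar> \<le> (4 * C * h) * (s + 2 * \<nu> * C)" unfolding abs_mult using C1 h0 by (intro mult_mono) auto
    also have "\<dots> = 4 * C * (h * s) + 8 * C\<^sup>2 * (h * \<nu>)" by (simp add: algebra_simps power2_eq_square)
    finally have m: "\<bar>\<delta> * (s + G)\<bar> \<le> 4 * C * (h * s) + 8 * C\<^sup>2 * (h * \<nu>)" .
    have "h * s \<le> w" unfolding w_def using hs p0[of 12] by (simp add: pos_le_divide_eq)
    then have m1: "4 * C * (h * s) \<le> 4 * C * w" using C1 by (intro mult_left_mono) auto
    have "h * \<nu> * \<nu> ^ 12 = h * \<nu> ^ 13" by (simp add: eval_nat_numeral)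
    also have "\<dots> \<le> h * \<nu> ^ 40" using pw[of 13 40] h0 by (intro mult_left_mono) auto
    finally have "h * \<nu> * \<nu> ^ 12 \<le> 1" using h40 by linarith
    then have "h * \<nu> \<le> w" unfolding w_def using p0[of 12] by (simp add: pos_le_divide_eq)
    then have m2: "8 * C\<^sup>2 * (h * \<nu>) \<le> 8 * C\<^sup>2 * w" by (intro mult_left_mono) auto
    have "\<bar>\<delta> * (s + G)\<bar> \<le> 4 * C * w + 8 * C\<^sup>2 * w" using m m1 m2 by linarith
    moreover have "4 * C * w \<le> 4 * C\<^sup>2 * w" using Cp(2)[of 1 2] w0 by (intro mult_right_mono) auto
    ultimately show ?thesis by linarith
  qed
  have "\<bar>q\<bar> \<le> C" using q(2) q0 C1 by (simp add: abs_le_iff) (use order_trans[of 0 "1 / C" q] in simp)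
  then have "\<bar>q * (G * (S - 1) + s * e)\<bar> \<le> C * (25 * C\<^sup>2 * w)"
    unfolding abs_mult using n2 n3 C1 by (intro mult_mono) auto
  then have i1: "\<bar>q * (G * (S - 1) + s * e)\<bar> \<le> 25 * C ^ 3 * w" by (simp add: eval_nat_numeral mult.left_commute)
  have i2: "12 * C\<^sup>2 * w \<le> 12 * C ^ 3 * w" using Cp(2)[of 2 3] w0 by (intro mult_right_mono mult_left_mono) auto
  have "\<bar>A * (q * (G * (S - 1) + s * e) + \<delta> * (s + G))\<bar> \<le> C * (37 * C ^ 3 * w)"
    unfolding abs_mult[of A] using i1 i2 n4 A C1 by (intro mult_mono) auto
  also have "\<dots> = 37 * C ^ 4 * w" by (simp add: eval_nat_numeral)
  finally have Num: "\<bar>Num\<bar> \<le> 39 * C ^ 4 * w" unfolding Num_def using n1 by linarith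
  have "s * (d + A * (H - q)) / H + A * G = Num / H" using H0 id by (simp add: field_simps)
  then have "\<bar>s * (d + A * (H - q)) / H + A * G\<bar> = \<bar>Num\<bar> / H" using H0 by simp
  also have "\<dots> \<le> (39 * C ^ 4 * w) / (1 / (4 * C))" using Num Hge C1 w0 by (intro frac_le) auto
  also have "\<dots> = 156 * C ^ 5 * w" by (simp add: eval_nat_numeral)
  \<comment> \<open>All constants are absorbed by one power of \<nu>, which is why the final
    exponent is 11 and not 12.\<close>
  also have "\<dots> \<le> \<nu> * w" using \<nu>C w0 Cp(1)[of 0 0 5] by (intro mult_right_mono) auto
  also have "\<dots> = 1 / \<nu> ^ 11" using \<nu>160 by (simp add: w_def eval_nat_numeral)
  finally show "\<bar>s * (d + A * (H - q)) / H + A * G\<bar> \<le> 1 / \<nu> ^ 11" .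
qed

context weighted_process
begin

lemma Gp_lipschitz: "\<bar>Gp u y - Gp v y\<bar> \<le> sqrt (real n * h) * (C / h\<^sup>2 * \<bar>u - v\<bar>)"
proof -
  let ?s = "sqrt (real n * h)"
  have "Gp u y - Gp v y = ?s / real n * (\<Sum>i<n. kh (u - y i) - kh (v - y i))"
    unfolding Gp_def sum_subtractf by (simp add: algebra_simps)
  then have "\<bar>Gp u y - Gp v y\<bar> = ?s / real n * \<bar>\<Sum>i<n. kh (u - y i) - kh (v - y i)\<bar>"
    using h0 by (simp add: abs_mult)
  also have "\<dots> \<le> ?s / real n * (\<Sum>i<n. C / h\<^sup>2 * \<bar>u - v\<bar>)"
  proof (intro mult_left_mono order_trans[OF sum_abs] sum_mono)
    fix i show "\<bar>kh (u - y i) - kh (v - y i)\<bar> \<le> C / h\<^sup>2 * \<bar>u - v\<bar>"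
      using kh_lip[of "u - y i" "v - y i"] by simp
  qed (use h0 in auto)
  also have "\<dots> = ?s * (C / h\<^sup>2 * \<bar>u - v\<bar>)" using n0 by simp
  finally show ?thesis .
qed

text \<open>The mesh is of order n^(-2), and the Lipschitz constant of the process is
  \<open>sqrt (n * h) * C / h\<^sup>2\<close>. Since \<open>1 \<le> n * h\<^sup>2\<close>, the
  change between neighbouring grid points is at most \<open>C / sqrt n\<close>.\<close>

lemma grid_approximation:
  assumes g: "g = n\<^sup>2" and rn: "\<nu> ^ 40 \<le> sqrt (real n) * h" and C\<nu>: "160 * C ^ 5 \<le> \<nu>"
    and y: "y \<in> space UM - Gbad g" and u: "u \<in> {h..1-h}"
  shows "\<bar>Gp u y\<bar> \<le> 2 * \<nu> * C" "\<exists>v\<in>grid g. \<bar>Zp u y - Zp v y\<bar> \<le> 1 / \<nu> ^ 11"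
proof -
  have \<nu>1: "1 \<le> \<nu>" using \<nu>4 by simp
  have p0: "0 < \<nu> ^ k" for k using \<nu>1 by simp
  have Cp: "C ^ i \<le> C ^ j" if "i \<le> j" for i j using C1 that by (rule power_increasing[rotated])
  have C2: "C \<le> C ^ 5" "C\<^sup>2 \<le> C ^ 5" using Cp[of 1 5] Cp[of 2 5] by auto
  have nu40: "1 \<le> \<nu> ^ 40" using \<nu>1 by simp
  have "sqrt (real n) * h \<le> sqrt (real n) * 1" using h_le by (intro mult_left_mono) auto
  then have sn: "\<nu> ^ 40 \<le> sqrt (real n)" using rn by linarith
  have "1 * 1 \<le> (sqrt (real n) * h) * (sqrt (real n) * h)" using rn nu40 by (intro mult_mono) auto
  then have "1 \<le> (sqrt (real n))\<^sup>2 * h\<^sup>2" by (simp add: power2_eq_square algebra_simps)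
  then have nh2: "1 \<le> real n * h\<^sup>2" by simp
  have g0: "0 < g" using g n0 by simp
  have "real n * h * 1 \<le> real n * h * (4 * real n)" using n0 h0 by (intro mult_left_mono) auto
  then have g1: "1 \<le> 4 * real g * h" using nh1 C1 unfolding g by (simp add: power2_eq_square algebra_simps)
  obtain v where v: "v \<in> grid g" "\<bar>u - v\<bar> \<le> 1 / (4 * real g)" by (rule grid_close[OF g0 g1 u])
  have vh: "v \<in> {h..1-h}" using v grid_subset by blast
  have v01: "v \<in> {0..1}" "u \<in> {0..1}" using vh u h0 by auto
  have "\<bar>u - v\<bar> \<le> 1 / (real n)\<^sup>2" using v(2) n0 unfolding g by (simp add: field_simps)
  then have "sqrt (real n * h) * (C / h\<^sup>2 * \<bar>u - v\<bar>) \<le> sqrt (real n) * (C / h\<^sup>2 * (1 / (real n)\<^sup>2))"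
    using h_le h0 C1 by (intro mult_mono mult_left_mono) (auto simp: mult_left_le)
  also have "\<dots> = C / (sqrt (real n) * (real n * h\<^sup>2))"
  proof -
    have "real n = sqrt (real n) * sqrt (real n)" by simp
    then have "(real n)\<^sup>2 = sqrt (real n) * (sqrt (real n) * real n)" by (simp add: power2_eq_square)
    then show ?thesis using n0 h0 by (simp add: field_simps)
  qed
  also have "\<dots> \<le> C / (sqrt (real n) * 1)" using nh2 n0 C1 h0 by (intro divide_left_mono mult_left_mono) auto
  also have "\<dots> \<le> C / \<nu> ^ 40" using sn p0[of 40] n0 C1 by (intro divide_left_mono) auto
  finally have d: "\<bar>Gp u y - Gp v y\<bar> \<le> C / \<nu> ^ 40" using Gp_lipschitz[of u y v] by linarith
  have "\<bar>Gp v y\<bar> \<le> \<nu> * sqrt C" using y v(1) unfolding Gbad_def by force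
  also have "\<dots> \<le> \<nu> * C" using \<nu>1 C1 by (intro mult_left_mono) (auto intro!: real_le_lsqrt simp: power2_eq_square)
  finally have Gv: "\<bar>Gp v y\<bar> \<le> \<nu> * C" .
  have "C / \<nu> ^ 40 \<le> C / 1" using nu40 C1 by (intro divide_left_mono) auto
  also have "\<dots> \<le> \<nu> * C" using \<nu>1 C1 by simp
  finally show "\<bar>Gp u y\<bar> \<le> 2 * \<nu> * C" using d Gv by linarith
  have "Zp u y - Zp v y = - A u * (Gp u y - Gp v y) + (A v - A u) * Gp v y" by (simp add: Zp_def algebra_simps)
  then have "\<bar>Zp u y - Zp v y\<bar> \<le> \<bar>A u\<bar> * \<bar>Gp u y - Gp v y\<bar> + \<bar>A u - A v\<bar> * \<bar>Gp v y\<bar>"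
    using abs_triangle_ineq[of "- A u * (Gp u y - Gp v y)" "(A v - A u) * Gp v y"]
    by (simp add: abs_mult abs_minus_commute)
  also have "\<dots> \<le> C * (C / \<nu> ^ 40) + C / \<nu> ^ 40 * (\<nu> * C)"
  proof (intro add_mono mult_mono d Gv)
    show "\<bar>A u\<bar> \<le> C" using A_nonneg[OF v01(2)] A_le[OF v01(2)] by simp
    have "\<bar>A u - A v\<bar> \<le> C * \<bar>u - v\<bar>" by (rule A_lip) (use v01 in auto)
    also have "\<dots> \<le> C * (1 / \<nu> ^ 40)"
    proof (rule mult_left_mono)
      have "\<bar>u - v\<bar> \<le> 1 / (real n)\<^sup>2" by fact
      also have "\<dots> \<le> 1 / \<nu> ^ 40"
      proof (rule divide_left_mono)
        have "sqrt (real n) * 1 \<le> sqrt (real n) * (sqrt (real n) * real n)" using sn nu40 n0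
          by (intro mult_left_mono mult_ge1_I) auto
        also have "\<dots> = (real n)\<^sup>2" by (simp add: power2_eq_square)
        finally show "\<nu> ^ 40 \<le> (real n)\<^sup>2" using sn by linarith
      qed (use n0 p0[of 40] in auto)
      finally show "\<bar>u - v\<bar> \<le> 1 / \<nu> ^ 40" .
    qed (use C1 in auto)
    finally show "\<bar>A u - A v\<bar> \<le> C / \<nu> ^ 40" by simp
  qed (use C1 p0[of 40] in auto)
  also have "\<dots> = C\<^sup>2 * (1 + \<nu>) / \<nu> ^ 40" by (simp add: algebra_simps power2_eq_square add_divide_distrib)
  also have "\<dots> \<le> \<nu> * \<nu>\<^sup>2 / \<nu> ^ 40"
  proof (intro divide_right_mono mult_mono)
    show "C\<^sup>2 \<le> \<nu>" using C\<nu> C2 C1 zero_le_power[of C 5] by linarith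
    have "1 + \<nu> \<le> \<nu> + \<nu>" using \<nu>1 by simp
    also have "\<dots> \<le> \<nu>\<^sup>2" using \<nu>4 by (simp add: power2_eq_square)
    finally show "1 + \<nu> \<le> \<nu>\<^sup>2" .
  qed (use \<nu>1 in auto)
  also have "\<dots> = 1 / \<nu> ^ 37" using \<nu>4 by (simp add: eval_nat_numeral)
  also have "\<dots> \<le> 1 / \<nu> ^ 11" using \<nu>1 power_increasing[of 11 37 \<nu>] by (intro divide_left_mono) auto
  finally show "\<exists>v\<in>grid g. \<bar>Zp u y - Zp v y\<bar> \<le> 1 / \<nu> ^ 11" using v(1) by blast
qed

end

section \<open>From the uniform order statistics to the estimators for the bids\<close>

locale quantile_sample = regular_sample +
  fixes Q q :: "real \<Rightarrow> real" and b :: "nat \<Rightarrow> real"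
  assumes Q_deriv: "\<And>t. t \<in> {0..1} \<Longrightarrow> (Q has_real_derivative q t) (at t within {0..1})"
    and q_lip: "\<And>s t. s \<in> {0..1} \<Longrightarrow> t \<in> {0..1} \<Longrightarrow> \<bar>q s - q t\<bar> \<le> C * \<bar>s - t\<bar>"
    and q_le: "\<And>t. t \<in> {0..1} \<Longrightarrow> q t \<le> C" and q_ge: "\<And>t. t \<in> {0..1} \<Longrightarrow> 1 \<le> C * q t"
    and b_eq: "\<And>i. i < n \<Longrightarrow> b i = Q (y i)"
    and Gp_le: "\<And>u. u \<in> {h..1-h} \<Longrightarrow> \<bar>Gp u y\<bar> \<le> 2 * \<nu> * C"
    and hs12: "h * sqrt (real n * h) * \<nu> ^ 12 \<le> 1" and h40: "h * \<nu> ^ 40 \<le> 1"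
    and C\<nu>: "160 * C ^ 5 \<le> \<nu>"
begin

lemma q_pos: "t \<in> {0..1} \<Longrightarrow> 0 < q t"
  using q_ge[of t] C1 by (cases "q t \<le> 0") (auto simp: mult_nonneg_nonpos dest: order_trans[of 1 "C * q t" 0])

lemma Q_mvt:
  assumes "0 \<le> s" "s \<le> t" "t \<le> 1"
  obtains \<xi> where "\<xi> \<in> {s..t}" "Q t - Q s = q \<xi> * (t - s)"
proof -
  have "\<exists>x\<in>{s..t}. Q t - Q s = (\<lambda>x. (*) (q x)) x (t - s)"
  proof (rule mvt_very_simple[OF assms(2)])
    fix x assume x: "s \<le> x" "x \<le> t"
    have "(Q has_real_derivative q x) (at x within {s..t})"
      by (rule has_field_derivative_subset[OF Q_deriv]) (use x assms in auto)
    then show "(Q has_derivative (*) (q x)) (at x within {s..t})" by (simp add: has_field_derivative_def)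
  qed
  then show ?thesis using that by auto
qed

lemma Q_mono: "mono_on {0..1} Q"
proof (rule mono_onI)
  fix s t :: real assume st: "s \<in> {0..1}" "t \<in> {0..1}" "s \<le> t"
  then have st': "0 \<le> s" "s \<le> t" "t \<le> 1" by auto
  obtain \<xi> where x: "\<xi> \<in> {s..t}" "Q t - Q s = q \<xi> * (t - s)" by (rule Q_mvt[OF st'])
  have "0 \<le> q \<xi> * (t - s)" using q_pos[of \<xi>] x(1) st by (intro mult_nonneg_nonneg) auto
  then show "Q s \<le> Q t" using x(2) by simp
qed

lemma Q_lip:
  assumes "s \<in> {0..1}" "t \<in> {0..1}"
  shows "\<bar>Q s - Q t\<bar> \<le> C * \<bar>s - t\<bar>"
proof -
  have *: "\<bar>Q s - Q t\<bar> \<le> C * \<bar>s - t\<bar>" if "s \<in> {0..1}" "t \<in> {0..1}" "s \<le> t" for s t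
  proof -
    have st': "0 \<le> s" "s \<le> t" "t \<le> 1" using that by auto
    obtain \<xi> where x: "\<xi> \<in> {s..t}" "Q t - Q s = q \<xi> * (t - s)" by (rule Q_mvt[OF st'])
    have "\<bar>q \<xi>\<bar> \<le> C" using q_pos[of \<xi>] q_le[of \<xi>] x(1) that by auto
    then have "\<bar>Q t - Q s\<bar> \<le> C * \<bar>t - s\<bar>" unfolding x(2) abs_mult by (intro mult_right_mono) auto
    then show ?thesis by (simp add: abs_minus_commute)
  qed
  show ?thesis using *[of s t] *[of t s] assms by (cases "s \<le> t") (auto simp: abs_minus_commute)
qed

lemma ordstat_b: "1 \<le> k \<Longrightarrow> k \<le> n \<Longrightarrow> ordstat n b k = Q (X k)"
proof -
  assume k: "1 \<le> k" "k \<le> n"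
  have "ordstat n b k = ordstat n (\<lambda>i. Q (y i)) k" by (rule ordstat_cong) (rule b_eq)
  also have "\<dots> = Q (X k)" by (rule ordstat_mono_on[OF k Q_mono]) (use y01 in force)
  finally show ?thesis .
qed

lemma X_near_scaled:
  assumes k: "1 \<le> k" "k \<le> n"
  shows "\<bar>X k - real k / real n\<bar> \<le> (\<nu> * sqrt (real n) + 1) / real n" "\<bar>X k - real k / real n\<bar> \<le> h / 2"
proof -
  have "X k - real k / real n = (real n * X k - real k) / real n" using n0 by (simp add: field_simps)
  then have e: "\<bar>X k - real k / real n\<bar> = \<bar>real n * X k - real k\<bar> / real n" by simp
  show 1: "\<bar>X k - real k / real n\<bar> \<le> (\<nu> * sqrt (real n) + 1) / real n"
    unfolding e using X_near[OF k] by (rule divide_right_mono) simp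
  have "4 * \<nu> \<le> \<nu> ^ 40"
  proof -
    have "4 * \<nu> \<le> \<nu> * \<nu>" using \<nu>4 by (intro mult_right_mono) auto
    also have "\<dots> = \<nu> ^ 2" by (simp add: power2_eq_square)
    also have "\<dots> \<le> \<nu> ^ 40" using nu1 by (intro power_increasing) auto
    finally show ?thesis .
  qed
  then have "4 * \<nu> \<le> sqrt (real n) * h" using root_n_h by linarith
  then have "4 * \<nu> * sqrt (real n) \<le> sqrt (real n) * h * sqrt (real n)" by (rule mult_right_mono) simp
  also have "\<dots> = real n * h" by simp
  finally have "\<nu> * sqrt (real n) / real n \<le> h / 4" using n0 by (simp add: field_simps)
  then have "(\<nu> * sqrt (real n) + 1) / real n \<le> h / 2" using inv_n_h(1) unfolding add_divide_distrib by linarith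
  then show "\<bar>X k - real k / real n\<bar> \<le> h / 2" using 1 by linarith
qed

text \<open>By the mean value theorem each gap between ordered bids is \<open>q \<xi>\<close> times
  the uniform gap, with \<open>\<xi>\<close> near \<open>u\<close>. Weights and gaps are
  nonnegative, so the error \<open>2 * C * h\<close> factors out of the sum and leaves
  \<open>Su u\<close>.\<close>

lemma hatq_close:
  assumes u: "u \<in> {h..1-h}"
  shows "\<bar>hatq K h n b u - q u * Su u\<bar> \<le> 2 * C * h * Su u"
proof -
  have "hatq K h n b u - q u * Su u = (\<Sum>k=1..n-1. \<kappa> u k * (ordstat n b (k + 1) - ordstat n b k) - q u * (\<kappa> u k * (X (k + 1) - X k)))"
    unfolding hatq_def Su_def sum_distrib_left \<kappa>_def by (rule sum_subtractf[symmetric])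
  then have "\<bar>hatq K h n b u - q u * Su u\<bar> \<le>
      (\<Sum>k=1..n-1. \<bar>\<kappa> u k * (ordstat n b (k + 1) - ordstat n b k) - q u * (\<kappa> u k * (X (k + 1) - X k))\<bar>)"
    by (simp only: sum_abs)
  also have "\<dots> \<le> (\<Sum>k=1..n-1. 2 * C * h * (\<kappa> u k * (X (k + 1) - X k)))"
  proof (rule sum_mono)
    fix k assume k: "k \<in> {1..n-1}"
    then have k1: "1 \<le> k" "k \<le> n" "1 \<le> k + 1" "k + 1 \<le> n" by auto
    have X: "X k \<le> X (k + 1)" "0 < X k" "X (k + 1) \<le> 1" using ordstat_mono[of k "k + 1" n y] k1 X01 by auto
    obtain \<xi> where x: "\<xi> \<in> {X k..X (k + 1)}" "Q (X (k + 1)) - Q (X k) = q \<xi> * (X (k + 1) - X k)"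
      by (rule Q_mvt[of "X k" "X (k + 1)"]) (use X in auto)
    have k0: "0 \<le> \<kappa> u k" by (simp add: \<kappa>_def kh_nonneg)
    show "\<bar>\<kappa> u k * (ordstat n b (k + 1) - ordstat n b k) - q u * (\<kappa> u k * (X (k + 1) - X k))\<bar> \<le> 2 * C * h * (\<kappa> u k * (X (k + 1) - X k))"
    proof (cases "\<kappa> u k = 0")
      case False
      then have "\<bar>u - real k / real n\<bar> < h" using kh_zero[of "u - real k / real n"] unfolding \<kappa>_def by force
      moreover have "\<bar>X k - real k / real n\<bar> \<le> h / 2" "\<bar>X (k + 1) - real (k + 1) / real n\<bar> \<le> h / 2"
        using X_near_scaled(2) k1 by blast+
      moreover have "real (k + 1) / real n = real k / real n + 1 / real n" by (simp add: add_divide_distrib)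
      \<comment> \<open>The distance is composed of the kernel radius \<open>h\<close>, the
        displacement \<open>h / 2\<close> of an order statistic and one grid step of at most
        \<open>h / 4\<close>.\<close>
      ultimately have "\<bar>\<xi> - u\<bar> \<le> 2 * h" using x(1) inv_n_h(1) h0 unfolding atLeastAtMost_iff by linarith
      then have "C * \<bar>\<xi> - u\<bar> \<le> C * (2 * h)" using C1 by (intro mult_left_mono) auto
      moreover have "\<bar>q \<xi> - q u\<bar> \<le> C * \<bar>\<xi> - u\<bar>" by (rule q_lip) (use x(1) X u h0 in auto)
      ultimately have qq: "\<bar>q \<xi> - q u\<bar> \<le> 2 * C * h" by simp
      have "\<kappa> u k * (ordstat n b (k + 1) - ordstat n b k) - q u * (\<kappa> u k * (X (k + 1) - X k)) = (q \<xi> - q u) * (\<kappa> u k * (X (k + 1) - X k))"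
        unfolding ordstat_b[OF k1(1,2)] ordstat_b[OF k1(3,4)] x(2) by (simp add: algebra_simps)
      moreover have "0 \<le> \<kappa> u k * (X (k + 1) - X k)" using k0 X by simp
      ultimately show ?thesis using mult_right_mono[OF qq] by (simp only: abs_mult[of "q \<xi> - q u"] abs_of_nonneg)
    qed simp
  qed
  also have "\<dots> = 2 * C * h * Su u" unfolding Su_def by (rule sum_distrib_left[symmetric])
  finally show ?thesis .
qed

text \<open>The empirical quantile has error of order \<open>\<nu> / sqrt n\<close>, so under the
  slower normalisation \<open>sqrt (n * h)\<close> it contributes only
  \<open>\<nu> * sqrt h\<close>.\<close>

lemma hatQ_close:
  assumes u: "u \<in> {h..1-h}"
  shows "\<bar>sqrt (real n * h) * (hatQ n b u - Q u)\<bar> \<le> 2 * C * \<nu> * sqrt h"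
proof -
  define k where "k = nat \<lfloor>real n * u\<rfloor> + 1"
  have u01: "0 < u" "u < 1" using u h0 by auto
  have p: "0 \<le> real n * u" using u01 by simp
  have k: "real n * u < real k" "real k \<le> real n * u + 1" 
  proof -
    have "real k = real_of_int \<lfloor>real n * u\<rfloor> + 1" unfolding k_def using p by simp
    then show "real n * u < real k" "real k \<le> real n * u + 1" using floor_correct[of "real n * u"] by linarith+
  qed
  have "real n * u < real n * 1" using u01 n0 by (intro mult_strict_left_mono) auto
  then have kn: "1 \<le> k" "k \<le> n" using k(2) by (auto simp: k_def)
  have Xk: "0 < X k" "X k \<le> 1" using X01[OF kn] by auto
  have "real k / real n - u = (real k - real n * u) / real n" using n0 by (simp add: field_simps)
  then have "\<bar>real k / real n - u\<bar> \<le> 1 / real n" using k n0 by (simp add: divide_right_mono)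
  then have "\<bar>X k - u\<bar> \<le> (\<nu> * sqrt (real n) + 1) / real n + 1 / real n"
    using X_near_scaled(1)[OF kn] by linarith
  also have "\<dots> = (\<nu> * sqrt (real n) + 2) / real n" by (simp add: add_divide_distrib[symmetric])
  also have "\<dots> \<le> (2 * \<nu> * sqrt (real n)) / real n"
  proof (rule divide_right_mono)
    have "2 * 1 \<le> \<nu> * sqrt (real n)" using \<nu>4 sqrt_n by (intro mult_mono) auto
    then show "\<nu> * sqrt (real n) + 2 \<le> 2 * \<nu> * sqrt (real n)" by simp
  qed simp
  also have "\<dots> = 2 * \<nu> / sqrt (real n)"
    using n0 by (simp add: field_simps)
  finally have X: "\<bar>X k - u\<bar> \<le> 2 * \<nu> / sqrt (real n)" .
  have "hatQ n b u = Q (X k)" unfolding hatQ_def using u01 ordstat_b[OF kn] by (simp add: k_def)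
  then have "\<bar>hatQ n b u - Q u\<bar> \<le> C * \<bar>X k - u\<bar>" using Q_lip[of "X k" u] Xk u01 by simp
  also have "\<dots> \<le> C * (2 * \<nu> / sqrt (real n))" using X C1 by (intro mult_left_mono) auto
  finally have "sqrt (real n * h) * \<bar>hatQ n b u - Q u\<bar> \<le> sqrt (real n * h) * (C * (2 * \<nu> / sqrt (real n)))"
    using h0 by (intro mult_left_mono) auto
  also have "\<dots> = 2 * C * \<nu> * sqrt h" using n0 by (simp add: real_sqrt_mult)
  finally show ?thesis using h0 by (simp add: abs_mult)
qed

lemma Zn_close:
  assumes u: "u \<in> {h..1-h}"
  shows "0 < hatq K h n b u" "\<bar>Zn Q q A K h n b u - Zp u y\<bar> \<le> 1 / \<nu> ^ 11"
proof -
  define s where "s = sqrt (real n * h)"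
  have s0: "0 < s" using n0 h0 by (simp add: s_def)
  have u01: "u \<in> {0..1}" using u h0 by auto
  have s20: "\<nu> ^ 20 \<le> s" unfolding s_def
  proof (rule real_le_rsqrt)
    have "1 * \<nu> ^ 40 \<le> sqrt (real n) * (sqrt (real n) * h)" using sqrt_n root_n_h nu1 by (intro mult_mono) auto
    also have "\<dots> = real n * h" by simp
    finally show "(\<nu> ^ 20)\<^sup>2 \<le> real n * h" by (simp flip: power_mult)
  qed
  define e where "e = (real n * Su u - real n + (Tu u - real n)) / real n"
  have G: "Gp u y = s / real n * (Tu u - real n)" by (simp add: Gp_def Tu_def s_def)
  have S: "Su u = 1 - Gp u y / s + e" unfolding G e_def using n0 s0 by (simp add: field_simps)
  have se: "\<bar>s * e\<bar> \<le> 7 * C / \<nu> ^ 18"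
  proof -
    have "\<bar>e\<bar> = \<bar>real n * Su u - real n + (Tu u - real n)\<bar> / real n" unfolding e_def by simp
    also have "\<dots> \<le> (7 * C * \<nu>\<^sup>2 * r4 / h) / real n" by (rule divide_right_mono[OF Su_expansion[OF u]]) simp
    finally have "\<bar>s * e\<bar> \<le> s * ((7 * C * \<nu>\<^sup>2 * r4 / h) / real n)" using s0 unfolding abs_mult by (simp only: abs_of_pos mult_left_mono less_imp_le)
    also have "\<dots> = 7 * C * \<nu>\<^sup>2 * (s * r4 / (real n * h))" by (simp add: mult.commute[of h] mult.left_commute[of s])
    also have "\<dots> \<le> 7 * C * \<nu>\<^sup>2 * (1 / \<nu> ^ 20)"
    proof (rule mult_left_mono)
      \<comment> \<open>After squaring, this is the assumption
        \<open>\<nu> ^ 40 \<le> sqrt n * h\<close>; here the lower bound on the bandwidth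
        enters.\<close>
      have "s * r4 * \<nu> ^ 20 \<le> real n * h"
      proof (rule power2_le_imp_le)
        have "(s * r4 * \<nu> ^ 20)\<^sup>2 = s\<^sup>2 * r4\<^sup>2 * (\<nu> ^ 20)\<^sup>2" by (simp only: power_mult_distrib)
        also have "\<dots> = (real n * h) * sqrt (real n) * \<nu> ^ 40"
          using n0 h0 r4(2) by (simp add: s_def flip: power_mult)
        also have "\<dots> \<le> (real n * h) * sqrt (real n) * (sqrt (real n) * h)"
          using root_n_h h0 by (intro mult_left_mono) auto
        also have "\<dots> = (real n * h)\<^sup>2" by (simp add: power2_eq_square)
        finally show "(s * r4 * \<nu> ^ 20)\<^sup>2 \<le> (real n * h)\<^sup>2" .
      qed (use h0 in auto)
      then show "s * r4 / (real n * h) \<le> 1 / \<nu> ^ 20"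
        using n0 h0 nu1 by (simp add: divide_le_eq pos_le_divide_eq field_simps)
    qed (use C1 in auto)
    also have "\<dots> = 7 * C / \<nu> ^ 18" using \<nu>4 by (simp add: eval_nat_numeral)
    finally show ?thesis .
  qed
  define \<delta> where "\<delta> = hatq K h n b u - q u * Su u"
  have H: "hatq K h n b u = q u * Su u + \<delta>" by (simp add: \<delta>_def)
  note R = studentized_ratio_bound[OF C1 C\<nu> s20 h0 hs12[folded s_def] h40 S Gp_le[OF u] se H
    hatq_close[OF u, folded \<delta>_def] q_ge[OF u01] q_le[OF u01] A_nonneg[OF u01] A_le[OF u01]
    hatQ_close[OF u, folded s_def]]
  show "0 < hatq K h n b u" by (rule R(1))
  have "Zn Q q A K h n b u - Zp u y = s * (hatQ n b u - Q u + A u * (hatq K h n b u - q u)) / hatq K h n b u + A u * Gp u y"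
    by (simp add: Zn_def hatv_def Zp_def s_def algebra_simps)
  then show "\<bar>Zn Q q A K h n b u - Zp u y\<bar> \<le> 1 / \<nu> ^ 11" using R(2) by simp
qed

end

section \<open>Measurability of the supremum events\<close>

text \<open>The estimate \<open>hatq\<close> may vanish on samples with ties, where division yields \<open>0\<close>. Those samples have
  to be treated as well, since the product measure is not complete.\<close>

lemma sup_ratio_sets:
  fixes I S :: "real set" and num den :: "real \<Rightarrow> 'a \<Rightarrow> real"
  assumes S: "countable S" "S \<subseteq> I"
    and m: "\<And>u. u \<in> S \<Longrightarrow> num u \<in> borel_measurable M" "\<And>u. u \<in> S \<Longrightarrow> den u \<in> borel_measurable M"
    and nn: "\<And>u b. b \<in> space M \<Longrightarrow> u \<in> I \<Longrightarrow> 0 \<le> den u b"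
    and appr: "\<And>u b. b \<in> space M \<Longrightarrow> u \<in> I \<Longrightarrow>
      \<exists>f. (\<forall>k::nat. f k \<in> S) \<and> (\<lambda>k. num (f k) b) \<longlonglongrightarrow> num u b \<and> (\<lambda>k. den (f k) b) \<longlonglongrightarrow> den u b"
    and cpt: "\<And>b. b \<in> space M \<Longrightarrow> (\<And>u. u \<in> I \<Longrightarrow> 0 < den u b) \<Longrightarrow> \<exists>m::nat. \<forall>u\<in>I. 1 / (real m + 1) \<le> den u b"
  shows "{b \<in> space M. \<forall>u\<in>I. num u b / den u b \<le> x} \<in> sets M"
proof -
  let ?P1 = "{b \<in> space M. \<forall>u\<in>S. 0 < den u b \<longrightarrow> num u b \<le> x * den u b}"
  \<comment> \<open>A zero denominator yields the ratio 0, which violates the bound exactly when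
    \<open>x < 0\<close>. In that case the denominator must be positive on all of \<open>I\<close>;
    by \<open>cpt\<close> it is then bounded away from 0, and this can be tested on the countable
    set.\<close>
  let ?P2 = "{b \<in> space M. 0 \<le> x \<or> (\<exists>m::nat. \<forall>u\<in>S. 1 / (real m + 1) \<le> den u b)}"
  have P1: "?P1 \<in> sets M"
  proof (rule sets.sets_Collect_countable_All'[OF _ S(1)])
    fix u assume u: "u \<in> S"
    note m(1)[OF u, measurable] m(2)[OF u, measurable]
    show "{b \<in> space M. 0 < den u b \<longrightarrow> num u b \<le> x * den u b} \<in> sets M" by measurable
  qed
  have P2: "?P2 \<in> sets M"
  proof (intro sets.sets_Collect_disj sets.sets_Collect_countable_Ex sets.sets_Collect_countable_All'[OF _ S(1)] sets.sets_Collect_const)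
    fix u and k :: nat assume u: "u \<in> S"
    note m(2)[OF u, measurable]
    show "{b \<in> space M. 1 / (real k + 1) \<le> den u b} \<in> sets M" by measurable
  qed
  have "(\<forall>u\<in>I. num u b / den u b \<le> x) \<longleftrightarrow> b \<in> ?P1 \<inter> ?P2" if b: "b \<in> space M" for b
  proof
    assume L: "\<forall>u\<in>I. num u b / den u b \<le> x"
    have 1: "num u b \<le> x * den u b" if "u \<in> S" "0 < den u b" for u
    proof -
      have "num u b / den u b \<le> x" using L that S by auto
      then show ?thesis using that by (simp add: pos_divide_le_eq)
    qed
    have 2: "\<exists>m::nat. \<forall>u\<in>S. 1 / (real m + 1) \<le> den u b" if "x < 0"
    proof -
      have "0 < den u b" if "u \<in> I" for u
      proof (rule ccontr)
        assume "\<not> 0 < den u b"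
        then have "den u b = 0" using nn[OF b that] by simp
        then have "num u b / den u b = 0" by simp
        moreover have "num u b / den u b \<le> x" using L that by blast
        ultimately show False using \<open>x < 0\<close> by linarith
      qed
      then obtain m :: nat where "\<forall>u\<in>I. 1 / (real m + 1) \<le> den u b" using cpt[OF b] by blast
      then show ?thesis using S by blast
    qed
    show "b \<in> ?P1 \<inter> ?P2" using b 1 2 by (cases "0 \<le> x") auto
  next
    assume R: "b \<in> ?P1 \<inter> ?P2"
    show "\<forall>u\<in>I. num u b / den u b \<le> x"
    proof
      fix u assume u: "u \<in> I"
      obtain f where f: "\<And>k::nat. f k \<in> S" "(\<lambda>k. num (f k) b) \<longlonglongrightarrow> num u b" "(\<lambda>k. den (f k) b) \<longlonglongrightarrow> den u b"
        using appr[OF b u] by blast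
      show "num u b / den u b \<le> x"
      proof (cases "0 < den u b")
        case True
        have "eventually (\<lambda>k. 0 < den (f k) b) sequentially" using f(3) True by (rule order_tendstoD)
        then have "eventually (\<lambda>k. num (f k) b \<le> x * den (f k) b) sequentially"
          by (rule eventually_mono) (use R f(1) in auto)
        then have "num u b \<le> x * den u b"
          by (intro tendsto_le[OF _ tendsto_mult[OF tendsto_const f(3)] f(2)]) auto
        then show ?thesis using True by (simp add: pos_divide_le_eq)
      next
        case False
        then have z: "den u b = 0" using nn[OF b u] by simp
        have "0 \<le> x"
        proof (rule ccontr)
          assume "\<not> 0 \<le> x"
          then obtain m :: nat where m: "\<forall>u\<in>S. 1 / (real m + 1) \<le> den u b" using R by auto
          have "1 / (real m + 1) \<le> den u b"
            by (rule tendsto_lowerbound[OF f(3)]) (use m f(1) in auto)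
          moreover have "0 < 1 / (real m + 1)" by simp
          ultimately show False using z by linarith
        qed
        then show ?thesis using z by simp
      qed
    qed
  qed
  then have "{b \<in> space M. \<forall>u\<in>I. num u b / den u b \<le> x} = ?P1 \<inter> ?P2" by blast
  then show ?thesis using P1 P2 by (simp only: sets.Int)
qed

lemma ordstat_measurable:
  assumes D: "sets D = sets borel" and k: "1 \<le> k" "k \<le> n"
  shows "(\<lambda>b. ordstat n b k) \<in> borel_measurable (PiM {..<n} (\<lambda>_. D))"
proof (rule borel_measurable_iff_le[THEN iffD2], rule allI)
  fix t :: real
  note D[measurable_cong]
  let ?M = "PiM {..<n} (\<lambda>_. D)"
  have "ordstat n b k \<le> t \<longleftrightarrow> real k \<le> (\<Sum>i<n. indicator {..t} (b i))" for b :: "nat \<Rightarrow> real"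
  proof -
    have "(\<Sum>i<n. indicator {..t} (b i)) = (\<Sum>i\<in>{i. i < n \<and> b i \<le> t}. (1::real))"
      by (rule sum.mono_neutral_cong_right) (auto simp: indicator_def)
    then show ?thesis using ordstat_le_iff[OF k, of b t] by simp
  qed
  moreover have "{b \<in> space ?M. real k \<le> (\<Sum>i<n. indicator {..t} (b i))} \<in> sets ?M" by measurable
  ultimately show "{b \<in> space ?M. ordstat n b k \<le> t} \<in> sets ?M" by simp
qed

text \<open>As a function of \<open>u\<close> the empirical quantile is constant on intervals closed
  on the left, so limits are available only from the right.\<close>

lemma hatQ_right_continuous:
  assumes u: "0 \<le> u" "u < 1" and n: "0 < n"
    and f: "\<And>k::nat. u \<le> f k" "f \<longlonglongrightarrow> u"
  shows "(\<lambda>k. hatQ n b (f k)) \<longlonglongrightarrow> hatQ n b u"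
proof -
  have "real n * u < real_of_int \<lfloor>real n * u\<rfloor> + 1" by linarith
  moreover have "(\<lambda>k. real n * f k) \<longlonglongrightarrow> real n * u" by (intro tendsto_mult tendsto_const f)
  ultimately have "eventually (\<lambda>k. real n * f k < real_of_int \<lfloor>real n * u\<rfloor> + 1) sequentially"
    using order_tendstoD(2) by blast
  moreover have "eventually (\<lambda>k. f k < 1) sequentially" using f(2) u(2) by (rule order_tendstoD)
  ultimately have "eventually (\<lambda>k. hatQ n b u = hatQ n b (f k)) sequentially"
  proof eventually_elim
    case (elim k)
    have "real n * u \<le> real n * f k" using f(1) by (intro mult_left_mono) auto
    then have "\<lfloor>real n * f k\<rfloor> = \<lfloor>real n * u\<rfloor>" using elim by linarith
    then show ?case using elim u unfolding hatQ_def by simp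
  qed
  then show ?thesis by (rule Lim_transform_eventually[OF tendsto_const])
qed

section \<open>Reduction of the suprema to countably many points\<close>

context weighted_process
begin

text \<open>The approximating points have to come from the right because of \<open>hatQ\<close>. No
  points of the interval lie to the right of \<open>1 - h\<close>, so that point is added to the
  countable set.\<close>

lemma right_dense_sequence:
  assumes u: "u \<in> {h..1-h}"
  shows "\<exists>f. (\<forall>k::nat. f k \<in> (\<rat> \<inter> {h..1-h}) \<union> {1-h}) \<and> (\<forall>k. u \<le> f k) \<and> f \<longlonglongrightarrow> u"
proof (cases "u = 1 - h")
  case True then show ?thesis by (intro exI[of _ "\<lambda>_. 1 - h"]) auto
next
  case False
  have "\<exists>r\<in>\<rat>. u < r \<and> r < min (u + 1 / (real k + 1)) (1 - h)" for k :: nat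
    by (rule Rats_dense_in_real) (use False u in auto)
  then obtain f where f: "\<And>k::nat. f k \<in> \<rat>" "\<And>k. u < f k" "\<And>k. f k < min (u + 1 / (real k + 1)) (1 - h)" by metis
  have "f \<longlonglongrightarrow> u"
  proof (rule tendsto_sandwich[of "\<lambda>_. u" _ _ "\<lambda>k. u + 1 / (real k + 1)"])
    have "(\<lambda>k. 1 / (real k + 1)) \<longlonglongrightarrow> 0"
      using LIMSEQ_inverse_real_of_nat by (simp add: inverse_eq_divide add.commute)
    then show "(\<lambda>k. u + 1 / (real k + 1)) \<longlonglongrightarrow> u" using tendsto_add[of "\<lambda>_. u" u sequentially] by force
  qed (use f in \<open>auto intro!: always_eventually less_imp_le\<close>)
  then show ?thesis using f u by (intro exI[of _ f]) (auto intro: less_imp_le order_trans[of h u])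
qed

lemma countable_right_dense: "countable ((\<rat> \<inter> {h..1-h}) \<union> {1-h})"
  by (intro countable_Un countable_Int1 countable_rat countable_finite) auto

lemma kh_tendsto:
  assumes "f \<longlonglongrightarrow> u" shows "(\<lambda>k. kh (f k - t)) \<longlonglongrightarrow> kh (u - t)"
proof -
  have "isCont K z" for z using K_cont by (simp add: continuous_on_eq_continuous_at)
  then have "(\<lambda>k. K ((f k - t) / h)) \<longlonglongrightarrow> K ((u - t) / h)"
    by (rule isCont_tendsto_compose) (intro tendsto_intros assms, use h0 in simp)
  then show ?thesis unfolding Kh_def using h0 by (intro tendsto_divide tendsto_const) auto
qed

lemma A_tendsto:
  assumes "f \<longlonglongrightarrow> u" "\<And>k::nat. f k \<in> {h..1-h}" "u \<in> {h..1-h}"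
  shows "(\<lambda>k. A (f k)) \<longlonglongrightarrow> A u"
proof -
  have "(\<lambda>k. C * \<bar>f k - u\<bar>) \<longlonglongrightarrow> C * \<bar>u - u\<bar>" by (intro tendsto_intros assms)
  then have "(\<lambda>k. C * \<bar>f k - u\<bar>) \<longlonglongrightarrow> 0" by simp
  moreover have "norm (A (f k) - A u) \<le> C * \<bar>f k - u\<bar>" for k
  proof -
    have "f k \<in> {0..1}" "u \<in> {0..1}" using assms(2)[of k] assms(3) h0 by auto
    then show ?thesis using A_lip by simp
  qed
  ultimately have "(\<lambda>k. A (f k) - A u) \<longlonglongrightarrow> 0"
    by (intro Lim_null_comparison[of "\<lambda>k. A (f k) - A u" "\<lambda>k. C * \<bar>f k - u\<bar>"]) auto
  then show ?thesis by (rule LIM_zero_cancel)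
qed

lemma Zstar_sets:
  assumes "finite Sg"
  shows "{y \<in> space UM. \<forall>u\<in>{h..1-h}. \<forall>\<sigma>\<in>Sg. \<sigma> * Zp u y \<le> x} \<in> sets UM"
proof -
  have *: "{y \<in> space UM. \<forall>u\<in>{h..1-h}. (\<sigma> * Zp u y) / 1 \<le> x} \<in> sets UM" for \<sigma>
  proof (rule sup_ratio_sets[where S = "(\<rat> \<inter> {h..1-h}) \<union> {1-h}" and I = "{h..1-h}" and M = UM
        and num = "\<lambda>u y. \<sigma> * Zp u y" and den = "\<lambda>_ _. 1"])
    fix u y assume u: "u \<in> {h..1-h}"
    obtain f where f: "\<And>k::nat. f k \<in> (\<rat> \<inter> {h..1-h}) \<union> {1-h}" "\<And>k. u \<le> f k" "f \<longlonglongrightarrow> u"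
      using right_dense_sequence[OF u] by blast
    have fh: "f k \<in> {h..1-h}" for k using f(1)[of k] h_le by auto
    have "(\<lambda>k. \<sigma> * Zp (f k) y) \<longlonglongrightarrow> \<sigma> * Zp u y"
      unfolding Zp_def Gp_def by (intro tendsto_intros A_tendsto kh_tendsto f fh u)
    then show "\<exists>f. (\<forall>k::nat. f k \<in> (\<rat> \<inter> {h..1-h}) \<union> {1-h}) \<and> (\<lambda>k. \<sigma> * Zp (f k) y) \<longlonglongrightarrow> \<sigma> * Zp u y \<and> (\<lambda>k. 1::real) \<longlonglongrightarrow> 1"
      using f(1) by (intro exI[of _ f]) auto
  next
    fix y show "\<exists>m::nat. \<forall>u\<in>{h..1-h}. 1 / (real m + 1) \<le> (1::real)" by (intro exI[of _ 0]) simp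
  qed (use countable_right_dense h_le in auto)
  have "{y \<in> space UM. \<forall>\<sigma>\<in>Sg. \<forall>u\<in>{h..1-h}. \<sigma> * Zp u y \<le> x} \<in> sets UM"
    by (rule sets.sets_Collect_finite_All[OF _ assms]) (use * in simp)
  then show ?thesis by (rule back_subst[where P = "\<lambda>S. S \<in> sets UM"]) blast
qed

lemma Zn_sets:
  assumes D: "sets D = sets borel" and fin: "finite Sg"
    and Q: "continuous_on {0..1} Q" and q: "continuous_on {0..1} q"
  shows "{b \<in> space (PiM {..<n} (\<lambda>_. D)). \<forall>u\<in>{h..1-h}. \<forall>\<sigma>\<in>Sg. \<sigma> * Zn Q q A K h n b u \<le> x} \<in> sets (PiM {..<n} (\<lambda>_. D))"
proof -
  let ?M = "PiM {..<n} (\<lambda>_. D)"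
  let ?num = "\<lambda>\<sigma> u b. \<sigma> * (sqrt (real n * h) * (hatv A K h n b u - (Q u + A u * q u)))"
  have om: "(\<lambda>b. ordstat n b k) \<in> borel_measurable ?M" if "1 \<le> k" "k \<le> n" for k
    by (rule ordstat_measurable[OF D that])
  have hq: "(\<lambda>b. hatq K h n b u) \<in> borel_measurable ?M" for u
    unfolding hatq_def by (intro borel_measurable_sum borel_measurable_times borel_measurable_const borel_measurable_diff om) auto
  have hQ: "(\<lambda>b. hatQ n b u) \<in> borel_measurable ?M" if u: "u \<in> {h..1-h}" for u
  proof -
    have "real n * u < real n * 1" using u h0 n0 by (intro mult_strict_left_mono) auto
    then have "nat \<lfloor>real n * u\<rfloor> + 1 \<le> n" using n0 by linarith
    then show ?thesis unfolding hatQ_def using u h0 om by auto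
  qed
  have nn: "0 \<le> hatq K h n b u" for b u
    unfolding hatq_def
  proof (intro sum_nonneg mult_nonneg_nonneg kh_nonneg)
    fix i assume "i \<in> {1..n-1}"
    then show "0 \<le> ordstat n b (i + 1) - ordstat n b i" using ordstat_mono[of i "i + 1" n b] by auto
  qed
  have hqc: "(\<lambda>k. hatq K h n b (f k)) \<longlonglongrightarrow> hatq K h n b u" if "f \<longlonglongrightarrow> u" for f b u
    unfolding hatq_def by (intro tendsto_intros kh_tendsto that)
  have *: "{b \<in> space ?M. \<forall>u\<in>{h..1-h}. ?num \<sigma> u b / hatq K h n b u \<le> x} \<in> sets ?M" for \<sigma>
  proof (rule sup_ratio_sets[where S = "(\<rat> \<inter> {h..1-h}) \<union> {1-h}" and I = "{h..1-h}" and M = ?M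
        and num = "?num \<sigma>" and den = "\<lambda>u b. hatq K h n b u"])
    fix u assume "u \<in> (\<rat> \<inter> {h..1-h}) \<union> {1-h}"
    then have u: "u \<in> {h..1-h}" using h_le by auto
    show "?num \<sigma> u \<in> borel_measurable ?M"
      unfolding hatv_def by (intro borel_measurable_times borel_measurable_const borel_measurable_diff borel_measurable_add hq hQ u)
    show "(\<lambda>b. hatq K h n b u) \<in> borel_measurable ?M" by (rule hq)
  next
    fix u b assume u: "u \<in> {h..1-h}"
    obtain f where f: "\<And>k::nat. f k \<in> (\<rat> \<inter> {h..1-h}) \<union> {1-h}" "\<And>k. u \<le> f k" "f \<longlonglongrightarrow> u"
      using right_dense_sequence[OF u] by blast
    have fh: "f k \<in> {h..1-h}" for k using f(1)[of k] h_le by auto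
    have f01: "f k \<in> {0..1}" for k using fh[of k] h0 by auto
    have u01: "u \<in> {0..1}" "0 \<le> u" "u < 1" using u h0 by auto
    have Qt: "(\<lambda>k. Q (f k)) \<longlonglongrightarrow> Q u" "(\<lambda>k. q (f k)) \<longlonglongrightarrow> q u"
      by (rule continuous_on_tendsto_compose[OF Q f(3)] continuous_on_tendsto_compose[OF q f(3)], use f01 u01 in auto)+
    have "(\<lambda>k. ?num \<sigma> (f k) b) \<longlonglongrightarrow> ?num \<sigma> u b"
      unfolding hatv_def
      by (intro tendsto_intros A_tendsto hqc Qt hatQ_right_continuous[OF u01(2,3) n0(1)] f fh u)
    then show "\<exists>f. (\<forall>k::nat. f k \<in> (\<rat> \<inter> {h..1-h}) \<union> {1-h}) \<and> (\<lambda>k. ?num \<sigma> (f k) b) \<longlonglongrightarrow> ?num \<sigma> u b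
        \<and> (\<lambda>k. hatq K h n b (f k)) \<longlonglongrightarrow> hatq K h n b u"
      using f(1) hqc[OF f(3)] by blast
  next
    fix b assume pos: "\<And>u. u \<in> {h..1-h} \<Longrightarrow> 0 < hatq K h n b u"
    have "continuous_on {h..1-h} (\<lambda>u. hatq K h n b u)"
      by (rule continuous_on_sequentiallyI) (use hqc in \<open>auto simp: comp_def\<close>)
    then obtain u0 where u0: "u0 \<in> {h..1-h}" "\<And>u. u \<in> {h..1-h} \<Longrightarrow> hatq K h n b u0 \<le> hatq K h n b u"
      using continuous_attains_inf[of "{h..1-h}" "\<lambda>u. hatq K h n b u"] h_le by auto
    obtain m :: nat where m: "inverse (real (Suc m)) < hatq K h n b u0" using reals_Archimedean[OF pos[OF u0(1)]] by blast
    have "\<forall>u\<in>{h..1-h}. 1 / (real m + 1) \<le> hatq K h n b u"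
    proof
      fix u assume u: "u \<in> {h..1-h}"
      have "1 / (real m + 1) = inverse (real (Suc m))" by (simp add: inverse_eq_divide)
      then show "1 / (real m + 1) \<le> hatq K h n b u" using m u0(2)[OF u] by linarith
    qed
    then show "\<exists>m::nat. \<forall>u\<in>{h..1-h}. 1 / (real m + 1) \<le> hatq K h n b u" by blast
  qed (use countable_right_dense h_le nn in auto)
  have e: "?num \<sigma> u b / hatq K h n b u = \<sigma> * Zn Q q A K h n b u" for \<sigma> u b by (simp add: Zn_def)
  have "{b \<in> space ?M. \<forall>\<sigma>\<in>Sg. \<forall>u\<in>{h..1-h}. \<sigma> * Zn Q q A K h n b u \<le> x} \<in> sets ?M"
    by (rule sets.sets_Collect_finite_All[OF _ fin]) (use * in \<open>simp only: e\<close>)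
  then show ?thesis by (rule back_subst[where P = "\<lambda>S. S \<in> sets ?M"]) blast
qed

section \<open>Regular samples are typical\<close>

definition cnt_bad :: "nat \<Rightarrow> nat \<Rightarrow> (nat \<Rightarrow> real) set" where
  "cnt_bad i j = {y \<in> space UM. \<nu> * sqrt (real j - real i) \<le>
     \<bar>(\<Sum>l<n. indicator {real i / real n<..real j / real n} (y l)) - (real j - real i)\<bar>}"

lemma cnt_bad_measurable: "cnt_bad i j \<in> sets UM"
  unfolding cnt_bad_def by measurable

text \<open>For short ranges the variance \<open>real j - real i\<close> can be as small as 1, below
  the requirement \<open>4 * b\<^sup>2 \<le> V\<close>. Taking four times the variance for
  \<open>V\<close> halves \<nu>, which is the source of \<open>\<nu> / 2\<close> in the later error
  terms.\<close>

lemma cnt_bad_tail: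
  assumes ij: "i < j" "j \<le> n"
  shows "measure UM (cnt_bad i j) \<le> 2 * exp (1 - \<nu> / 2)"
proof -
  let ?f = "indicator {real i / real n<..real j / real n} :: real \<Rightarrow> real"
  let ?d = "real j - real i"
  have d: "1 \<le> ?d" using ij by simp
  have "measure unif01 {real i / real n<..real j / real n} = real j / real n - real i / real n"
    using ij n0 by (intro measure_unif01_Ioc) (auto simp: divide_right_mono)
  then have m: "measure unif01 {real i / real n<..real j / real n} = ?d / real n" by (simp add: diff_divide_distrib)
  have sq: "(?f t)\<^sup>2 = ?f t" for t by (auto simp: indicator_def)
  have E: "integral\<^sup>L unif01 ?f = ?d / real n" using m by simp
  have var: "integral\<^sup>L unif01 (\<lambda>t. (?f t)\<^sup>2) \<le> ?d / real n" unfolding sq E by simp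
  have bd: "\<bar>?f t\<bar> \<le> 1" for t by (auto simp: indicator_def)
  have V: "real n * (?d / real n) \<le> 4 * ?d" "4 * 1\<^sup>2 \<le> 4 * ?d" "0 < 4 * ?d" using d n0 by auto
  have "measure UM {y \<in> space UM. \<nu> / 2 * sqrt (4 * ?d) \<le> \<bar>(\<Sum>l<n. ?f (y l)) - real n * integral\<^sup>L unif01 ?f\<bar>} \<le> 2 * exp (1 - \<nu> / 2)"
    by (rule chernoff[OF prob_space_unif01 _ _ bd var V]) auto
  moreover have "\<nu> / 2 * sqrt (4 * ?d) = \<nu> * sqrt ?d" unfolding real_sqrt_mult by simp
  moreover have "real n * integral\<^sup>L unif01 ?f = ?d" unfolding E using n0 by simp
  ultimately show ?thesis unfolding cnt_bad_def by (simp only:)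
qed

text \<open>A null event. The value 0 is excluded so that \<open>F 0 = 0\<close> and every sample
  point lies in one of the half-open cells.\<close>

definition range_bad :: "(nat \<Rightarrow> real) set" where
  "range_bad = {y \<in> space UM. \<exists>i\<in>{..<n}. y i \<notin> {0<..1}}"

lemma range_bad: "range_bad \<in> sets UM" "measure UM range_bad = 0"
proof -
  show m: "range_bad \<in> sets UM" unfolding range_bad_def by measurable
  have "AE t in unif01. t \<noteq> 0"
    using emeasure_unif01[of "{0}"] by (intro AE_I[of _ _ "{0}"]) auto
  then have "AE t in unif01. t \<in> {0<..1}" using AE_unif01 by eventually_elim auto
  then have "AE y in UM. y i \<in> {0<..1}" if "i \<in> {..<n}" for i
    using that prob_space_unif01 by (intro AE_PiM_component) auto
  then have "AE y in UM. \<forall>i\<in>{..<n}. y i \<in> {0<..1}" by (intro AE_finite_allI) auto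
  then have "AE y in UM. y \<notin> range_bad" unfolding range_bad_def by eventually_elim auto
  then show "measure UM range_bad = 0" using m by (simp add: UM.prob_eq_0)
qed

definition irregular :: "(nat \<Rightarrow> real) set" where
  "irregular = range_bad \<union> (\<Union>p\<in>{p. fst p < snd p \<and> snd p \<le> n}. cnt_bad (fst p) (snd p))"

lemma irregular:
  shows "irregular \<in> sets UM" "measure UM irregular \<le> (real n + 1)\<^sup>2 * (2 * exp (1 - \<nu> / 2))"
proof -
  let ?P = "{p. fst p < snd p \<and> snd p \<le> n}"
  have sub: "?P \<subseteq> {..n} \<times> {..n}" by auto
  have fin: "finite ?P" using sub by (rule finite_subset) auto
  have "card ?P \<le> card ({..n} \<times> {..n})" by (rule card_mono[OF _ sub]) auto
  then have "card ?P \<le> (n + 1) * (n + 1)" by simp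
  then have "real (card ?P) \<le> real ((n + 1) * (n + 1))" by (rule of_nat_mono)
  then have cP: "real (card ?P) \<le> (real n + 1)\<^sup>2" by (simp add: power2_eq_square algebra_simps)
  have U: "(\<Union>p\<in>?P. cnt_bad (fst p) (snd p)) \<in> sets UM" by (rule sets.finite_UN[OF fin]) (rule cnt_bad_measurable)
  show "irregular \<in> sets UM" unfolding irregular_def by (rule sets.Un[OF range_bad(1) U])
  have "measure UM irregular \<le> measure UM range_bad + measure UM (\<Union>p\<in>?P. cnt_bad (fst p) (snd p))"
    unfolding irregular_def by (rule measure_subadditive[OF range_bad(1) U]) auto
  also have "\<dots> = measure UM (\<Union>p\<in>?P. cnt_bad (fst p) (snd p))" by (simp add: range_bad)
  also have "\<dots> \<le> (\<Sum>p\<in>?P. measure UM (cnt_bad (fst p) (snd p)))"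
    by (rule UM.finite_measure_subadditive_finite[OF fin]) (use cnt_bad_measurable in auto)
  also have "\<dots> \<le> (\<Sum>p\<in>?P. 2 * exp (1 - \<nu> / 2))" by (rule sum_mono) (use cnt_bad_tail in auto)
  also have "\<dots> = real (card ?P) * (2 * exp (1 - \<nu> / 2))" by simp
  also have "\<dots> \<le> (real n + 1)\<^sup>2 * (2 * exp (1 - \<nu> / 2))" using cP by (intro mult_right_mono) auto
  finally show "measure UM irregular \<le> (real n + 1)\<^sup>2 * (2 * exp (1 - \<nu> / 2))" .
qed

lemma regular_sampleI:
  assumes rn: "\<nu> ^ 40 \<le> sqrt (real n) * h" and y: "y \<in> space UM - irregular"
  shows "regular_sample K C h n A \<nu> y (\<lambda>k. real (card {i. i < n \<and> y i \<le> real k / real n}))"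
proof (unfold_locales)
  show "\<And>i. i < n \<Longrightarrow> y i \<in> {0<..1}" using y unfolding irregular_def range_bad_def by blast
  fix i j :: nat assume ij: "i \<le> j" "j \<le> n"
  let ?B = "\<lambda>k. {i. i < n \<and> y i \<le> real k / real n}"
  show "\<bar>real (card (?B j)) - real (card (?B i)) - (real j - real i)\<bar> \<le> \<nu> * sqrt (real j - real i)"
  proof (cases "i = j")
    case False
    then have "y \<notin> cnt_bad i j" using y ij unfolding irregular_def by force
    then have "\<bar>(\<Sum>l<n. indicator {real i / real n<..real j / real n} (y l)) - (real j - real i)\<bar> \<le> \<nu> * sqrt (real j - real i)"
      using y unfolding cnt_bad_def by force
    moreover have "(\<Sum>l<n. indicator {real i / real n<..real j / real n} (y l)) = real (card (?B j)) - real (card (?B i))"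
    proof -
      have sub: "?B i \<subseteq> ?B j"
        using divide_right_mono[of "real i" "real j" "real n"] ij by (auto intro: order_trans)
      have "(\<Sum>l<n. indicator {real i / real n<..real j / real n} (y l)) = (\<Sum>l\<in>?B j - ?B i. (1::real))"
        by (rule sum.mono_neutral_cong_right) (auto simp: indicator_def)
      also have "\<dots> = real (card (?B j) - card (?B i))" using sub by (simp add: card_Diff_subset)
      also have "\<dots> = real (card (?B j)) - real (card (?B i))" using card_mono[OF _ sub] by (subst of_nat_diff) auto
      finally show ?thesis .
    qed
    ultimately show ?thesis by simp
  qed simp
qed (use rn in auto)

end

section \<open>Comparison for a fixed sample size\<close>

lemma Wabs_le_iff: "Wabs Z h \<le> ereal x \<longleftrightarrow> (\<forall>u\<in>{h..1-h}. \<forall>\<sigma>\<in>{1, -1}. \<sigma> * Z u \<le> x)"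
  unfolding Wabs_def SUP_le_iff by (auto simp: abs_le_iff)

lemma Wsup_le_iff: "Wsup Z h \<le> ereal x \<longleftrightarrow> (\<forall>u\<in>{h..1-h}. \<forall>\<sigma>\<in>{1}. \<sigma> * Z u \<le> x)"
  unfolding Wsup_def SUP_le_iff by auto

text \<open>The condition on the supremum is spelled out pointwise, which avoids extended reals and
  treats both kinds of supremum through the sign set.\<close>

definition PrS :: "real measure \<Rightarrow> nat \<Rightarrow> ((nat \<Rightarrow> real) \<Rightarrow> real \<Rightarrow> real) \<Rightarrow> real \<Rightarrow> real set \<Rightarrow> real \<Rightarrow> real" where
  "PrS D n Z h Sg x = measure (PiM {..<n} (\<lambda>_. D))
     {b \<in> space (PiM {..<n} (\<lambda>_. D)). \<forall>u\<in>{h..1-h}. \<forall>\<sigma>\<in>Sg. \<sigma> * Z b u \<le> x}"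

lemma PrLe_eq_PrS:
  "PrLe D n (\<lambda>b. Wabs (Z b) h) x = PrS D n Z h {1, -1} x"
  "PrLe D n (\<lambda>b. Wsup (Z b) h) x = PrS D n Z h {1} x"
  unfolding PrLe_def PrS_def Wabs_le_iff Wsup_le_iff by (rule refl)+

context weighted_process
begin

text \<open>One \<open>\<delta>\<close> pays for replacing \<open>Z\<close> by \<open>Zp\<close> and
  one for moving to a grid point, hence \<open>2 * \<delta> \<le> \<epsilon>\<close>. One inclusion
  loses the stretch above \<open>x\<close>, the other the stretch below it, so anti-concentration is
  applied at \<open>x\<close> and at \<open>x - \<epsilon>\<close>.\<close>

lemma sandwich:
  assumes E: "{y \<in> space UM. \<forall>u\<in>{h..1-h}. \<forall>\<sigma>\<in>Sg. \<sigma> * Z u y \<le> x} \<in> sets UM" and B: "B \<in> sets UM"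
    and close: "\<And>y u. y \<in> space UM - B \<Longrightarrow> u \<in> {h..1-h} \<Longrightarrow> \<bar>Z u y - Zp u y\<bar> \<le> \<delta>"
    and gr: "\<And>y u. y \<in> space UM - B \<Longrightarrow> u \<in> {h..1-h} \<Longrightarrow> \<exists>v\<in>\<Gamma>. \<bar>Zp u y - Zp v y\<bar> \<le> \<delta>"
    and \<Gamma>: "finite \<Gamma>" "\<Gamma> \<noteq> {}" "\<Gamma> \<subseteq> {h..1-h}" and Sg: "Sg \<noteq> {}" "Sg \<subseteq> {1, -1}"
    and ac: "\<And>x. measure UM {y \<in> space UM. x \<le> Wmax \<Gamma> Sg y \<and> Wmax \<Gamma> Sg y \<le> x + \<epsilon>} \<le> r"
    and \<delta>: "2 * \<delta> \<le> \<epsilon>" "0 \<le> \<delta>"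
  shows "\<bar>measure UM {y \<in> space UM. \<forall>u\<in>{h..1-h}. \<forall>\<sigma>\<in>Sg. \<sigma> * Z u y \<le> x} - measure UM {y \<in> space UM. Wmax \<Gamma> Sg y \<le> x}\<bar>
    \<le> r + measure UM B"
proof -
  have finS: "finite Sg" using Sg(2) by (rule finite_subset) auto
  let ?E = "{y \<in> space UM. \<forall>u\<in>{h..1-h}. \<forall>\<sigma>\<in>Sg. \<sigma> * Z u y \<le> x}"
  let ?W = "{y \<in> space UM. Wmax \<Gamma> Sg y \<le> x}"
  let ?R = "\<lambda>t. {y \<in> space UM. t \<le> Wmax \<Gamma> Sg y \<and> Wmax \<Gamma> Sg y \<le> t + \<epsilon>}"
  note Wm[measurable] = Wmax_measurable[OF \<Gamma>(1) finS]
  have wm: "?W \<in> sets UM" by measurable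
  have rm: "?R t \<in> sets UM" for t by measurable
  note iff = Wmax_le_iff[OF \<Gamma>(1) finS \<Gamma>(2) Sg(1)]
  have sg: "\<bar>\<sigma>\<bar> = 1" if "\<sigma> \<in> Sg" for \<sigma> using that Sg by auto
  have mono: "\<sigma> * s \<le> \<sigma> * t + d" if "\<sigma> \<in> Sg" "\<bar>s - t\<bar> \<le> d" for \<sigma> s t d
  proof -
    have "\<sigma> * (s - t) \<le> \<bar>\<sigma> * (s - t)\<bar>" by simp
    also have "\<dots> = \<bar>s - t\<bar>" using sg[OF that(1)] by (simp add: abs_mult)
    finally have "\<sigma> * (s - t) \<le> d" using that(2) by linarith
    then show ?thesis by (simp add: right_diff_distrib)
  qed
  have un3: "measure UM (P1 \<union> (P2 \<union> B)) \<le> measure UM P1 + (measure UM P2 + measure UM B)"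
    if "P1 \<in> sets UM" "P2 \<in> sets UM" for P1 P2
    by (intro order_trans[OF measure_subadditive] add_left_mono sets.Un that B order_refl) auto
  have "?E \<subseteq> ?W \<union> (?R x \<union> B)"
  proof
    fix y assume y: "y \<in> ?E"
    show "y \<in> ?W \<union> (?R x \<union> B)"
    proof (cases "y \<in> B")
      case False
      then have ys: "y \<in> space UM - B" using y by auto
      have "\<sigma> * Zp v y \<le> x + \<epsilon>" if "v \<in> \<Gamma>" "\<sigma> \<in> Sg" for v \<sigma>
      proof -
        have vh: "v \<in> {h..1-h}" using that \<Gamma> by auto
        have "\<sigma> * Zp v y \<le> \<sigma> * Z v y + \<delta>"
          by (rule mono[OF that(2)]) (use close[OF ys vh] in \<open>simp add: abs_minus_commute\<close>)
        also have "\<sigma> * Z v y \<le> x" using y vh that by blast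
        finally show ?thesis using \<delta> by linarith
      qed
      then have "Wmax \<Gamma> Sg y \<le> x + \<epsilon>" using iff by blast
      then show ?thesis using y by force
    qed simp
  qed
  then have "measure UM ?E \<le> measure UM (?W \<union> (?R x \<union> B))" by (intro UM.finite_measure_mono sets.Un wm rm B)
  also have "\<dots> \<le> measure UM ?W + (measure UM (?R x) + measure UM B)" by (rule un3[OF wm rm])
  finally have up: "measure UM ?E \<le> measure UM ?W + (r + measure UM B)" using ac[of x] by linarith
  have "?W \<subseteq> ?E \<union> (?R (x - \<epsilon>) \<union> B)"
  proof
    fix y assume y: "y \<in> ?W"
    show "y \<in> ?E \<union> (?R (x - \<epsilon>) \<union> B)"
    proof (rule ccontr)
      assume n: "y \<notin> ?E \<union> (?R (x - \<epsilon>) \<union> B)"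
      then have ys: "y \<in> space UM - B" using y by auto
      have lt: "Wmax \<Gamma> Sg y \<le> x - \<epsilon>" using n y by force
      have "\<sigma> * Z u y \<le> x" if u: "u \<in> {h..1-h}" "\<sigma> \<in> Sg" for u \<sigma>
      proof -
        obtain v where v: "v \<in> \<Gamma>" "\<bar>Zp u y - Zp v y\<bar> \<le> \<delta>" using gr[OF ys u(1)] by blast
        have "\<sigma> * Z u y \<le> \<sigma> * Zp u y + \<delta>" by (rule mono[OF u(2) close[OF ys u(1)]])
        moreover have "\<sigma> * Zp u y \<le> \<sigma> * Zp v y + \<delta>" by (rule mono[OF u(2) v(2)])
        moreover have "\<sigma> * Zp v y \<le> x - \<epsilon>" using lt iff v(1) u(2) by blast
        ultimately show ?thesis using \<delta> by linarith
      qed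
      then have "y \<in> ?E" using ys by blast
      then show False using n by blast
    qed
  qed
  then have "measure UM ?W \<le> measure UM (?E \<union> (?R (x - \<epsilon>) \<union> B))" by (intro UM.finite_measure_mono sets.Un E rm B)
  also have "\<dots> \<le> measure UM ?E + (measure UM (?R (x - \<epsilon>)) + measure UM B)" by (rule un3[OF E rm])
  finally have "measure UM ?W \<le> measure UM ?E + (r + measure UM B)" using ac[of "x - \<epsilon>"] by linarith
  then show ?thesis using up by linarith
qed

end

text \<open>Eventually used with \<open>\<nu> = n powr \<tau>\<close> for a small \<open>\<tau>\<close>: every remainder is a negative power of \<open>\<nu>\<close>,
  while all exceptional probabilities are polynomial in \<open>n\<close> times \<open>exp (- \<nu>/2)\<close>.\<close>

locale regime = weighted_process +
  fixes a0 :: real and N :: nat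
  assumes rn: "\<nu> ^ 40 \<le> sqrt (real n) * h" and hs12: "h * sqrt (real n * h) * \<nu> ^ 12 \<le> 1"
    and h40: "h * \<nu> ^ 40 \<le> 1" and C\<nu>: "160 * C ^ 5 \<le> \<nu>"
    and a0: "0 < a0" "\<And>u. u \<in> {1/2..3/4} \<Longrightarrow> a0 \<le> A u"
    and \<nu>a: "1 \<le> a0 * \<nu>" and \<nu>N: "160 * real N * (13 * C\<^sup>2) \<le> a0 * \<nu>" and N0: "0 < N"
begin

abbreviation "grd \<equiv> grid (n\<^sup>2)"
text \<open>The first term comes from two runs of the transport, 144 / \<open>N\<close> each. The
  second collects all exceptional events, polynomially many with exponentially small
  probability.\<close>

definition "err = 288 / real N + 400 * real n ^ 3 * exp (1 - \<nu> / 2)"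

lemma grd: "0 < n\<^sup>2" "1 \<le> 4 * real (n\<^sup>2) * h"
proof -
  show "0 < n\<^sup>2" using n0 by simp
  have "real n * h * 1 \<le> real n * h * (4 * real n)" using n0 h0 by (intro mult_left_mono) auto
  then show "1 \<le> 4 * real (n\<^sup>2) * h" using nh1 C1 by (simp add: power2_eq_square algebra_simps)
qed

lemma grd_props: "finite grd" "grd \<noteq> {}" "grd \<subseteq> {h..1-h}"
  using grid_finite_card(1)[OF grd(1)] grid_middle[OF grd(1), of "2 * n\<^sup>2"] grid_subset by auto

text \<open>The probability of the exceptional event is subtracted here because
  \<open>sandwich\<close> adds it back, so that the comparison ends with \<open>err\<close> itself.
  The factor 400 has room for 348 from anti-concentration and 18 from the exceptional event.\<close>

lemma total_error:
  assumes Sg: "1 \<in> Sg" "Sg \<subseteq> {1, -1}"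
  shows "measure UM {y \<in> space UM. x \<le> Wmax grd Sg y \<and> Wmax grd Sg y \<le> x + 1 / \<nu> ^ 8}
      \<le> err - measure UM (irregular \<union> Gbad (n\<^sup>2))"
proof -
  let ?e = "exp (1 - \<nu> / 2)"
  have n1: "1 \<le> real n" using n0 by simp
  have sn: "1 \<le> sqrt (real n)" using n1 by simp
  have nh40: "\<nu> ^ 40 \<le> real n * h"
  proof -
    have "1 * \<nu> ^ 40 \<le> sqrt (real n) * (sqrt (real n) * h)" using sn rn \<nu>4 by (intro mult_mono) auto
    also have "\<dots> = real n * h" by simp
    finally show ?thesis by simp
  qed
  have "C\<^sup>2 \<le> C ^ 5" using C1 by (intro power_increasing) auto
  then have C2: "40 * C\<^sup>2 \<le> \<nu>" using C\<nu> C1 zero_le_power[of C 5] by linarith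
  have ac: "measure UM {y \<in> space UM. x \<le> Wmax grd Sg y \<and> Wmax grd Sg y \<le> x + 1 / \<nu> ^ 8}
    \<le> 288 / real N + (8 * (2 / \<Lambda> + 1) * (6 + 8 * real (n\<^sup>2)) + 8 * real (n\<^sup>2) + 4) * exp (1 - \<nu>)"
    by (rule grid_anti_concentration[OF grd N0 h40 nh40 C2 a0 \<nu>a \<nu>N Sg])
  have "2 / \<Lambda> \<le> 2 * real n"
  proof -
    have "1 \<le> real n * h" using nh1 C1 by linarith
    also have "\<dots> \<le> real n * \<Lambda>" using \<Lambda>_bounds h0 by (intro mult_left_mono) auto
    finally show ?thesis using \<Lambda>_bounds by (simp add: pos_divide_le_eq)
  qed
  then have L: "2 / \<Lambda> + 1 \<le> 3 * real n" using n1 by linarith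
  have n23: "1 \<le> (real n)\<^sup>2" "(real n)\<^sup>2 \<le> real n ^ 3" using n1 by (auto intro: power_increasing one_le_power)
  have "8 * (2 / \<Lambda> + 1) * (6 + 8 * real (n\<^sup>2)) \<le> 8 * (3 * real n) * (14 * (real n)\<^sup>2)"
    using L n23 \<Lambda>_bounds by (intro mult_mono) auto
  also have "\<dots> = 336 * real n ^ 3" by (simp add: power2_eq_square power3_eq_cube)
  finally have p1: "8 * (2 / \<Lambda> + 1) * (6 + 8 * real (n\<^sup>2)) + 8 * real (n\<^sup>2) + 4 \<le> 348 * real n ^ 3" using n23 by simp
  have e: "exp (1 - \<nu>) \<le> ?e" using \<nu>4 by simp
  have q1: "(8 * (2 / \<Lambda> + 1) * (6 + 8 * real (n\<^sup>2)) + 8 * real (n\<^sup>2) + 4) * exp (1 - \<nu>) \<le> 348 * real n ^ 3 * ?e"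
    using p1 e by (intro mult_mono) auto
  have "measure UM (irregular \<union> Gbad (n\<^sup>2)) \<le> measure UM irregular + measure UM (Gbad (n\<^sup>2))"
    by (rule measure_subadditive[OF irregular(1) Gbad(1)[OF grd(1)]]) auto
  also have "\<dots> \<le> (real n + 1)\<^sup>2 * (2 * ?e) + (4 * real (n\<^sup>2) + 1) * (2 * exp (1 - \<nu>))"
    using irregular(2) Gbad(2)[OF grd(1)] by (rule add_mono)
  also have "\<dots> \<le> 8 * real n ^ 3 * ?e + 10 * real n ^ 3 * ?e"
  proof (rule add_mono)
    have "(real n + 1)\<^sup>2 \<le> (2 * real n)\<^sup>2" using n1 by (intro power_mono) auto
    then have "(real n + 1)\<^sup>2 * 2 \<le> 8 * real n ^ 3" using n23 by (simp add: power_mult_distrib)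
    then have "(real n + 1)\<^sup>2 * 2 * ?e \<le> 8 * real n ^ 3 * ?e" by (rule mult_right_mono) simp
    then show "(real n + 1)\<^sup>2 * (2 * ?e) \<le> 8 * real n ^ 3 * ?e" by (simp only: mult.assoc)
    have "(4 * real (n\<^sup>2) + 1) * 2 \<le> 10 * real n ^ 3" using n23 by simp
    then have "(4 * real (n\<^sup>2) + 1) * 2 * exp (1 - \<nu>) \<le> 10 * real n ^ 3 * ?e" by (rule mult_mono[OF _ e]) auto
    then show "(4 * real (n\<^sup>2) + 1) * (2 * exp (1 - \<nu>)) \<le> 10 * real n ^ 3 * ?e" by (simp only: mult.assoc)
  qed
  finally have "measure UM (irregular \<union> Gbad (n\<^sup>2)) \<le> 18 * (real n ^ 3 * ?e)" by simp
  moreover have "0 \<le> real n ^ 3 * ?e" by simp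
  ultimately show ?thesis using ac q1 unfolding err_def mult.assoc by linarith
qed

lemma delta_eps: "2 * (1 / \<nu> ^ 11) \<le> 1 / \<nu> ^ 8"
proof -
  have "2 * \<nu> ^ 8 \<le> \<nu> ^ 3 * \<nu> ^ 8" using \<nu>4 power_mono[of 4 \<nu> 3] by (intro mult_right_mono) auto
  also have "\<dots> = \<nu> ^ 11" by (simp flip: power_add)
  finally show ?thesis using \<nu>4 by (simp add: field_simps)
qed

lemma compare_process:
  assumes Sg: "1 \<in> Sg" "Sg \<subseteq> {1, -1}"
    and E: "{y \<in> space UM. \<forall>u\<in>{h..1-h}. \<forall>\<sigma>\<in>Sg. \<sigma> * Z u y \<le> x} \<in> sets UM"
    and close: "\<And>y u. y \<in> space UM - (irregular \<union> Gbad (n\<^sup>2)) \<Longrightarrow> u \<in> {h..1-h} \<Longrightarrow> \<bar>Z u y - Zp u y\<bar> \<le> 1 / \<nu> ^ 11"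
  shows "\<bar>measure UM {y \<in> space UM. \<forall>u\<in>{h..1-h}. \<forall>\<sigma>\<in>Sg. \<sigma> * Z u y \<le> x} - measure UM {y \<in> space UM. Wmax grd Sg y \<le> x}\<bar> \<le> err"
proof -
  let ?B = "irregular \<union> Gbad (n\<^sup>2)"
  have "\<bar>measure UM {y \<in> space UM. \<forall>u\<in>{h..1-h}. \<forall>\<sigma>\<in>Sg. \<sigma> * Z u y \<le> x} - measure UM {y \<in> space UM. Wmax grd Sg y \<le> x}\<bar>
    \<le> (err - measure UM ?B) + measure UM ?B"
  proof (rule sandwich[OF E _ close _ grd_props _ Sg(2) total_error[OF Sg] delta_eps])
    show "?B \<in> sets UM" by (rule sets.Un[OF irregular(1) Gbad(1)[OF grd(1)]])
    show "\<exists>v\<in>grd. \<bar>Zp u y - Zp v y\<bar> \<le> 1 / \<nu> ^ 11" if "y \<in> space UM - ?B" "u \<in> {h..1-h}" for y u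
      by (rule grid_approximation(2)[OF refl rn C\<nu> _ that(2)]) (use that(1) in auto)
  qed (use Sg \<nu>4 in auto)
  then show ?thesis by simp
qed

lemma compare_star:
  assumes Sg: "1 \<in> Sg" "Sg \<subseteq> {1, -1}"
  shows "\<bar>PrS unif01 n (Zstar A K h n) h Sg x - measure UM {y \<in> space UM. Wmax grd Sg y \<le> x}\<bar> \<le> err"
proof -
  have fin: "finite Sg" using Sg(2) by (rule finite_subset) auto
  have "{b \<in> space UM. \<forall>u\<in>{h..1-h}. \<forall>\<sigma>\<in>Sg. \<sigma> * Zstar A K h n b u \<le> x} = {y \<in> space UM. \<forall>u\<in>{h..1-h}. \<forall>\<sigma>\<in>Sg. \<sigma> * Zp u y \<le> x}"
    by (auto simp: Zstar_def Zp_def Gnh_eq_Gp)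
  then have 1: "PrS unif01 n (Zstar A K h n) h Sg x = measure UM {y \<in> space UM. \<forall>u\<in>{h..1-h}. \<forall>\<sigma>\<in>Sg. \<sigma> * Zp u y \<le> x}"
    unfolding PrS_def by (simp only:)
  show ?thesis unfolding 1
    by (rule compare_process[OF Sg Zstar_sets[OF fin]]) (use \<nu>4 in auto)
qed

text \<open>Pulling the event back along \<open>compose {..<n} Q'\<close> puts \<open>Zn\<close> and
  \<open>Zp\<close> on the same uniform sample. The map \<open>Q'\<close> is separate from
  \<open>Q\<close> because the image measure requires a Borel map on the whole line, whereas
  \<open>Q\<close> is controlled only on the unit interval.\<close>

lemma compare_Zn:
  assumes Sg: "1 \<in> Sg" "Sg \<subseteq> {1, -1}"
    and Q'[measurable]: "Q' \<in> borel_measurable borel" and D: "D = distr unif01 borel Q'"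
    and QQ': "\<And>t. t \<in> {0..1} \<Longrightarrow> Q' t = Q t"
    and Q_deriv: "\<And>t. t \<in> {0..1} \<Longrightarrow> (Q has_real_derivative q t) (at t within {0..1})"
    and q_lip: "\<And>s t. s \<in> {0..1} \<Longrightarrow> t \<in> {0..1} \<Longrightarrow> \<bar>q s - q t\<bar> \<le> C * \<bar>s - t\<bar>"
    and q_le: "\<And>t. t \<in> {0..1} \<Longrightarrow> q t \<le> C" and q_ge: "\<And>t. t \<in> {0..1} \<Longrightarrow> 1 \<le> C * q t"
  shows "\<bar>PrS D n (\<lambda>b u. Zn Q q A K h n b u) h Sg x - measure UM {y \<in> space UM. Wmax grd Sg y \<le> x}\<bar> \<le> err"
proof -
  have fin: "finite Sg" using Sg(2) by (rule finite_subset) auto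
  have Ds[measurable_cong]: "sets D = sets borel" by (simp add: D)
  interpret U: prob_space unif01 by (rule prob_space_unif01)
  have Dp: "prob_space D" unfolding D by (rule U.prob_space_distr) simp
  let ?M = "PiM {..<n} (\<lambda>_. D)" and ?f = "compose {..<n} Q'"
  have fm: "?f \<in> measurable UM ?M" unfolding compose_def by measurable
  have MD: "?M = distr UM ?M ?f"
  proof -
    have "distr unif01 D Q' = D"
      by (subst D, rule distr_cong) (simp_all add: D)
    then have "?M = PiM {..<n} (\<lambda>_. distr unif01 D Q')" by simp
    also have "\<dots> = distr UM ?M ?f"
      by (rule distr_PiM_finite_prob_space'[symmetric]) (use prob_space_unif01 Dp in auto)
    finally show ?thesis .
  qed
  have Qc: "continuous_on {0..1} Q"
    by (rule DERIV_continuous_on[OF Q_deriv])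
  have qc: "continuous_on {0..1} q"
    by (rule lipschitz_on_continuous_on[of C], rule lipschitz_onI) (use q_lip C1 in \<open>auto simp: dist_real_def\<close>)
  let ?S = "{b \<in> space ?M. \<forall>u\<in>{h..1-h}. \<forall>\<sigma>\<in>Sg. \<sigma> * Zn Q q A K h n b u \<le> x}"
  let ?Z = "\<lambda>u y. Zn Q q A K h n (?f y) u"
  have S: "?S \<in> sets ?M" by (rule Zn_sets[OF Ds fin Qc qc])
  have e: "?f -` ?S \<inter> space UM = {y \<in> space UM. \<forall>u\<in>{h..1-h}. \<forall>\<sigma>\<in>Sg. \<sigma> * ?Z u y \<le> x}"
    using measurable_space[OF fm] by blast
  have Es: "{y \<in> space UM. \<forall>u\<in>{h..1-h}. \<forall>\<sigma>\<in>Sg. \<sigma> * ?Z u y \<le> x} \<in> sets UM"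
    using measurable_sets[OF fm S] unfolding e .
  have "PrS D n (\<lambda>b u. Zn Q q A K h n b u) h Sg x = measure (distr UM ?M ?f) ?S"
    unfolding PrS_def MD[symmetric] ..
  also have "\<dots> = measure UM {y \<in> space UM. \<forall>u\<in>{h..1-h}. \<forall>\<sigma>\<in>Sg. \<sigma> * ?Z u y \<le> x}"
    unfolding measure_distr[OF fm S] e ..
  finally have 1: "PrS D n (\<lambda>b u. Zn Q q A K h n b u) h Sg x = measure UM {y \<in> space UM. \<forall>u\<in>{h..1-h}. \<forall>\<sigma>\<in>Sg. \<sigma> * ?Z u y \<le> x}" .
  show ?thesis unfolding 1
  proof (rule compare_process[OF Sg Es])
    fix y u assume y: "y \<in> space UM - (irregular \<union> Gbad (n\<^sup>2))" and u: "u \<in> {h..1-h}"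
    have y1: "y \<in> space UM - irregular" "y \<in> space UM - Gbad (n\<^sup>2)" using y by auto
    interpret R: regular_sample K C h n A \<nu> y "\<lambda>k. real (card {i. i < n \<and> y i \<le> real k / real n})"
      by (rule regular_sampleI[OF rn y1(1)])
    interpret QS: quantile_sample K C h n A \<nu> y "\<lambda>k. real (card {i. i < n \<and> y i \<le> real k / real n})" Q q "?f y"
    proof (unfold_locales)
      show "?f y i = Q (y i)" if "i < n" for i
        using that QQ'[of "y i"] R.y01[OF that] by (simp add: compose_def)
      show "\<bar>Gp u y\<bar> \<le> 2 * \<nu> * C" if "u \<in> {h..1-h}" for u
        by (rule grid_approximation(1)[OF refl rn C\<nu> y1(2) that])
    qed (use Q_deriv q_lip q_le q_ge hs12 h40 C\<nu> in auto)
    show "\<bar>Zn Q q A K h n (?f y) u - Zp u y\<bar> \<le> 1 / \<nu> ^ 11" by (rule QS.Zn_close(2)[OF u])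
  qed
qed

end

section \<open>Regularity of the model functions\<close>

lemma C1_lipschitz:
  fixes f f' :: "real \<Rightarrow> real"
  assumes f: "\<And>t. t \<in> {0..1} \<Longrightarrow> (f has_real_derivative f' t) (at t within {0..1})"
    and c: "continuous_on {0..1} f'"
  obtains L where "0 \<le> L" "\<And>s t. s \<in> {0..1} \<Longrightarrow> t \<in> {0..1} \<Longrightarrow> \<bar>f s - f t\<bar> \<le> L * \<bar>s - t\<bar>"
proof -
  have "bounded (f' ` {0..1})" by (rule compact_imp_bounded[OF compact_continuous_image[OF c compact_Icc]])
  then obtain L where L: "\<And>t. t \<in> {0..1} \<Longrightarrow> \<bar>f' t\<bar> \<le> L"  unfolding bounded_iff by (metis imageI real_norm_def)
  have "0 \<le> L" using L[of 0] by auto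
  moreover have "\<bar>f s - f t\<bar> \<le> L * \<bar>s - t\<bar>" if "s \<in> {0..1}" "t \<in> {0..1}" for s t
    using field_differentiable_bound[of "{0..1}" f f' L s t] f L that by auto
  ultimately show ?thesis by (rule that)
qed

lemma lipschitz_bounded:
  fixes f :: "real \<Rightarrow> real"
  assumes "\<And>s t. s \<in> {0..1} \<Longrightarrow> t \<in> {0..1} \<Longrightarrow> \<bar>f s - f t\<bar> \<le> L * \<bar>s - t\<bar>" "0 \<le> L" "t \<in> {0..1}"
  shows "f t \<le> \<bar>f 0\<bar> + L"
proof -
  have "\<bar>f t - f 0\<bar> \<le> L * \<bar>t - 0\<bar>" using assms by (intro assms(1)) auto
  also have "\<dots> \<le> L * 1" using assms by (intro mult_left_mono) auto
  finally show ?thesis by linarith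
qed

lemma continuous_pos_lower_bound:
  fixes f :: "real \<Rightarrow> real"
  assumes "continuous_on {a..b} f" "a \<le> b" "\<And>t. t \<in> {a..b} \<Longrightarrow> 0 < f t"
  obtains m where "0 < m" "\<And>t. t \<in> {a..b} \<Longrightarrow> m \<le> f t"
proof -
  obtain t0 where "t0 \<in> {a..b}" "\<forall>t\<in>{a..b}. f t0 \<le> f t"
    using continuous_attains_inf[of "{a..b}" f] assms by auto
  then show ?thesis using assms(3) by (intro that[of "f t0"]) auto
qed

lemma A1_deriv: "(A1 p M has_real_derivative A1d p M u) (at u within S)"
proof -
  have "((\<lambda>u. \<Sum>m=1..M. p m * u ^ (m - 1)) has_real_derivative (\<Sum>m=1..M. p m * (real (m - 1) * u ^ (m - 1 - 1)))) (at u within S)"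
    by (intro DERIV_sum) (auto intro!: derivative_eq_intros)
  \<comment> \<open>The summand \<open>m = 1\<close> drops out through its factor
    \<open>real (m - 1)\<close>.\<close>
  moreover have "(\<Sum>m=1..M. p m * (real (m - 1) * u ^ (m - 1 - 1))) = A1d p M u"
    unfolding A1d_def by (rule sum.mono_neutral_cong_right) (auto simp: diff_diff_add numeral_2_eq_2)
  ultimately show ?thesis unfolding A1_def[abs_def] by simp
qed

definition A1dd :: "(nat \<Rightarrow> real) \<Rightarrow> nat \<Rightarrow> real \<Rightarrow> real" where
  "A1dd p M u = (\<Sum>m=2..M. real (m - 1) * p m * (real (m - 2) * u ^ (m - 2 - 1)))"

lemma A1d_deriv: "(A1d p M has_real_derivative A1dd p M u) (at u within S)"
  unfolding A1d_def[abs_def] A1dd_def by (intro DERIV_sum) (auto intro!: derivative_eq_intros)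

text \<open>At 0 the derivative \<open>A1d\<close> reduces to \<open>p 2\<close>, so its
  nonvanishing forces \<open>p 2 > 0\<close> and thereby \<open>A1 p M u \<ge> p 2 * u\<close>. This
  gives a positive lower bound on \<open>{1/2..3/4}\<close> even when \<open>A\<close> vanishes at
  0.\<close>

lemma Afun_regular:
  assumes p: "\<And>m. m \<in> {1..M} \<Longrightarrow> 0 \<le> p m" and nz: "\<And>u. u \<in> {0..1} \<Longrightarrow> A1d p M u \<noteq> 0"
  obtains L a0 where "0 \<le> L" "\<And>s t. s \<in> {0..1} \<Longrightarrow> t \<in> {0..1} \<Longrightarrow> \<bar>Afun p M s - Afun p M t\<bar> \<le> L * \<bar>s - t\<bar>"
    "\<And>u. u \<in> {0..1} \<Longrightarrow> 0 \<le> Afun p M u" "0 < a0" "\<And>u. u \<in> {1/2..3/4} \<Longrightarrow> a0 \<le> Afun p M u"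
proof -
  let ?A = "Afun p M"
  let ?A' = "\<lambda>u. (A1d p M u * A1d p M u - A1 p M u * A1dd p M u) / (A1d p M u * A1d p M u)"
  have deriv: "(?A has_real_derivative ?A' u) (at u within {0..1})" if "u \<in> {0..1}" for u
    unfolding Afun_def[abs_def] by (rule DERIV_divide[OF A1_deriv A1d_deriv nz[OF that]])
  have c0: "continuous_on S (A1 p M)" "continuous_on S (A1d p M)" "continuous_on S (A1dd p M)" for S
    unfolding A1_def[abs_def] A1d_def[abs_def] A1dd_def[abs_def] by (intro continuous_intros)+
  have "continuous_on {0..1} ?A'" by (intro continuous_intros c0) (use nz in auto)
  then obtain L where L: "0 \<le> L" "\<And>s t. s \<in> {0..1} \<Longrightarrow> t \<in> {0..1} \<Longrightarrow> \<bar>?A s - ?A t\<bar> \<le> L * \<bar>s - t\<bar>"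
    using C1_lipschitz[OF deriv] by metis
  have nn: "0 \<le> A1 p M u" "0 \<le> A1d p M u" if "u \<in> {0..1}" for u
    unfolding A1_def A1d_def using that p by (auto intro!: sum_nonneg mult_nonneg_nonneg)
  have An: "0 \<le> ?A u" if "u \<in> {0..1}" for u using nn[OF that] by (simp add: Afun_def)
  have "A1d p M 0 \<noteq> 0" by (rule nz) simp
  then obtain m where m: "m \<in> {2..M}" "real (m - 1) * p m * 0 ^ (m - 2) \<noteq> 0"
    unfolding A1d_def by (meson sum.not_neutral_contains_not_neutral)
  then have "m = 2" by (cases "m - 2") auto
  then have p2: "2 \<in> {1..M}" "0 < p 2" using m p[of 2] by auto
  have "0 < ?A u" if u: "u \<in> {1/2..3/4}" for u
  proof -
    have u01: "u \<in> {0..1}" using u by auto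
    have "0 < p 2 * u" using p2 u by simp
    also have "\<dots> = (\<Sum>m\<in>{2::nat}. p m * u ^ (m - 1))" by simp
    also have "\<dots> \<le> A1 p M u" unfolding A1_def
      by (rule sum_mono2) (use p2 p u in \<open>auto intro!: mult_nonneg_nonneg\<close>)
    finally have "0 < A1 p M u" .
    moreover have "0 < A1d p M u" using nn[OF u01] nz[OF u01] by simp
    ultimately show ?thesis by (simp add: Afun_def)
  qed
  moreover have "continuous_on {1/2..3/4} ?A"
    by (rule continuous_on_subset[OF DERIV_continuous_on[OF deriv]]) auto
  ultimately obtain a0 where "0 < a0" "\<And>u. u \<in> {1/2..3/4} \<Longrightarrow> a0 \<le> ?A u"
    using continuous_pos_lower_bound[of "1/2" "3/4" ?A] by auto
  then show ?thesis using that[of L a0] L An by blast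
qed

text \<open>Monotonicity of the distribution function places \<open>{t. Q' t \<le> x}\<close>,
  within the unit interval, between \<open>{0..<F}\<close> and \<open>{0..F}\<close>. These have the
  same uniform measure, namely the value \<open>F\<close> of the distribution function at
  \<open>x\<close>. Clamping the argument makes \<open>Q'\<close> continuous on the whole
  line.\<close>

lemma distr_quantile:
  assumes D: "real_distribution D" and Q_inv: "\<And>u. u \<in> {0..1} \<Longrightarrow> cdf D (Q u) = u"
    and Q_cont: "continuous_on {0..1} Q"
  defines "Q' \<equiv> \<lambda>t. Q (max 0 (min 1 t))"
  shows "Q' \<in> borel_measurable borel" "D = distr unif01 borel Q'"
proof -
  interpret D: real_distribution D by fact
  have "continuous_on UNIV Q'" unfolding Q'_def
    by (rule continuous_on_compose2[OF Q_cont]) (auto intro!: continuous_intros)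
  then show m[measurable]: "Q' \<in> borel_measurable borel" by (rule borel_measurable_continuous_onI)
  interpret U: prob_space unif01 by (rule prob_space_unif01)
  let ?N = "distr unif01 borel Q'"
  have "prob_space ?N" by (rule U.prob_space_distr) simp
  then have rd: "real_distribution ?N" by (simp add: real_distribution_def real_distribution_axioms_def)
  have "cdf D x = cdf ?N x" for x
  proof -
    define F where "F = cdf D x"
    have F01: "0 \<le> F" "F \<le> 1" unfolding F_def using D.cdf_nonneg D.cdf_bounded_prob by auto
    let ?B = "{t. Q' t \<le> x}"
    have Bm: "?B \<in> sets borel" by measurable
    have Q': "Q' t = Q t" if "t \<in> {0..1}" for t using that by (simp add: Q'_def)
    have 1: "{0..1} \<inter> ?B \<subseteq> {0..F}"
    proof
      fix t assume t: "t \<in> {0..1} \<inter> ?B"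
      then have "cdf D (Q t) \<le> cdf D x" using Q' by (intro D.cdf_nondecreasing) auto
      then show "t \<in> {0..F}" using t Q_inv by (auto simp: F_def)
    qed
    have 2: "{0..<F} \<subseteq> ?B"
    proof
      fix t assume t: "t \<in> {0..<F}"
      then have t01: "t \<in> {0..1}" using F01 by auto
      have "Q t \<le> x"
      proof (rule ccontr)
        assume "\<not> Q t \<le> x"
        then have "cdf D x \<le> cdf D (Q t)" by (intro D.cdf_nondecreasing) auto
        then show False using Q_inv[OF t01] t by (simp add: F_def)
      qed
      then show "t \<in> ?B" using Q'[OF t01] by simp
    qed
    have "measure unif01 ?B \<le> measure unif01 {0..F}"
    proof -
      have "emeasure unif01 ?B \<le> emeasure unif01 {0..F}"
        unfolding emeasure_unif01[OF Bm] emeasure_unif01[of "{0..F}", simplified]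
        by (rule emeasure_mono) (use 1 in auto)
      then show ?thesis by (simp add: U.emeasure_eq_measure)
    qed
    then have le: "measure unif01 ?B \<le> F" using measure_unif01_Icc[of 0 F] F01 by simp
    have "measure unif01 {0..<F} \<le> measure unif01 ?B" by (rule U.finite_measure_mono[OF 2]) (simp add: Bm)
    then have "F \<le> measure unif01 ?B" using measure_unif01_Ico[of 0 F] F01 by simp
    moreover have "cdf ?N x = measure unif01 ?B" unfolding cdf_def by (subst measure_distr) (auto simp: vimage_def)
    ultimately show ?thesis using le by (simp add: F_def)
  qed
  then show "D = ?N" by (intro cdf_unique[OF D rd]) auto
qed

section \<open>Asymptotics\<close>

text \<open>The transport bound does not decay in \<open>n\<close> but only in the number
  \<open>N\<close> of levels. Thus \<open>N\<close> is fixed first according to the target accuracy,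
  and only then does \<open>n\<close> tend to infinity.\<close>

lemma SUP_diff_tendsto_0:
  fixes f g :: "nat \<Rightarrow> real \<Rightarrow> real" and c :: real
  assumes ev: "\<And>N. 0 < N \<Longrightarrow> eventually (\<lambda>n. \<forall>x. \<bar>f n x - g n x\<bar> \<le> 2 * (c / real N + r n)) sequentially"
    and r: "r \<longlonglongrightarrow> 0" and c: "0 \<le> c"
  shows "(\<lambda>n. SUP x. \<bar>f n x - g n x\<bar>) \<longlonglongrightarrow> 0"
proof (rule LIMSEQ_I)
  fix e :: real assume e: "0 < e"
  obtain N :: nat where N: "4 * c / e + 1 < real N" using reals_Archimedean2 by blast
  have cn: "0 \<le> 4 * c / e" using c e by simp
  then have N0: "0 < N" using N by (cases N) auto
  have "4 * c / e < real N" using N by linarith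
  then have "4 * c < e * real N" using e by (simp add: pos_divide_less_eq mult.commute)
  then have cN: "4 * (c / real N) < e" using N0 by (simp add: field_simps)
  have "eventually (\<lambda>n. r n < e / 4) sequentially" using order_tendstoD(2)[OF r, of "e / 4"] e by simp
  with ev[OF N0] have "eventually (\<lambda>n. norm ((SUP x. \<bar>f n x - g n x\<bar>) - 0) < e) sequentially"
  proof eventually_elim
    case (elim n)
    let ?b = "2 * (c / real N + r n)"
    have "(SUP x. \<bar>f n x - g n x\<bar>) \<le> ?b" by (rule cSUP_least) (use elim in auto)
    \<comment> \<open>Bounds the supremum from below by a nonnegative value; boundedness above is
      needed for a real supremum to be meaningful.\<close>
    moreover have "\<bar>f n 0 - g n 0\<bar> \<le> (SUP x. \<bar>f n x - g n x\<bar>)"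
      by (rule cSUP_upper) (use elim in \<open>auto intro!: bdd_aboveI[of _ ?b]\<close>)
    moreover have "?b < e" using elim cN by simp
    ultimately show ?case by simp
  qed
  then show "\<exists>n0. \<forall>n\<ge>n0. norm ((SUP x. \<bar>f n x - g n x\<bar>) - 0) < e" by (simp add: eventually_sequentially)
qed

text \<open>The conditions on \<open>\<tau>\<close> match those of \<open>regime\<close>:
  \<open>40 * \<tau> < \<alpha>\<close> for the lower bound on \<open>sqrt n * h\<close>,
  \<open>40 * \<tau> < 1/3\<close> for \<open>h * \<nu> ^ 40\<close>, and
  \<open>24 * \<tau> < 3 * \<beta>\<close> for the bias, whose square is n h^3 \<nu>^24.\<close>

lemma eventually_regime:
  fixes h :: "nat \<Rightarrow> real"
  assumes K_nonneg: "\<And>z. 0 \<le> K z" and K_int: "(K has_integral 1) UNIV"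
    and K_lip: "\<And>x y. \<bar>K x - K y\<bar> \<le> C * \<bar>x - y\<bar>" and K_supp: "\<And>z. \<bar>z\<bar> > 1 \<Longrightarrow> K z = 0" and C1: "1 \<le> C"
    and A: "\<And>u. u \<in> {0..1} \<Longrightarrow> 0 \<le> A u" "\<And>u. u \<in> {0..1} \<Longrightarrow> A u \<le> C"
      "\<And>u v. u \<in> {0..1} \<Longrightarrow> v \<in> {0..1} \<Longrightarrow> \<bar>A u - A v\<bar> \<le> C * \<bar>u - v\<bar>"
    and a0: "0 < a0" "\<And>u. u \<in> {1/2..3/4} \<Longrightarrow> a0 \<le> A u"
    and h_lim: "h \<longlonglongrightarrow> 0"
    and rate: "0 < c" "0 < \<alpha>" "0 < B" "0 < \<beta>"
      "\<And>n. 1 \<le> n \<Longrightarrow> c * real n powr (-1/2 + \<alpha>) \<le> h n" "\<And>n. 1 \<le> n \<Longrightarrow> h n \<le> B * real n powr (-1/3 - \<beta>)"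
    and \<tau>: "0 < \<tau>" "40 * \<tau> < \<alpha>" "40 * \<tau> < 1/3" "24 * \<tau> < 3 * \<beta>" and N0: "0 < N"
  shows "eventually (\<lambda>n. regime K C (h n) n A (real n powr \<tau>) a0 N) sequentially"
proof -
  define R where "R = Max {4, 160 * C ^ 5, 1 / a0, 160 * real N * (13 * C\<^sup>2) / a0}"
  have R: "4 \<le> R" "160 * C ^ 5 \<le> R" "1 / a0 \<le> R" "160 * real N * (13 * C\<^sup>2) / a0 \<le> R"
    unfolding R_def by (rule Max_ge; simp)+
  have e1: "eventually (\<lambda>n::nat. R \<le> real n powr \<tau>) sequentially" using \<tau>(1) by real_asymp
  have e2: "eventually (\<lambda>n::nat. real n powr (40 * \<tau>) \<le> c * real n powr \<alpha>) sequentially" using \<tau>(2) rate(1) by real_asymp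
  have e3: "eventually (\<lambda>n::nat. B * real n powr (-1/3 - \<beta>) * real n powr (40 * \<tau>) \<le> 1) sequentially"
  proof -
    have "-1/3 - \<beta> + 40 * \<tau> < 0" using \<tau> rate by linarith
    then have "eventually (\<lambda>n::nat. B * real n powr (-1/3 - \<beta> + 40 * \<tau>) \<le> 1) sequentially" using rate(3) by real_asymp
    then show ?thesis by (simp add: powr_add mult.assoc)
  qed
  have e4: "eventually (\<lambda>n::nat. B ^ 3 * real n powr (- 3 * \<beta> + 24 * \<tau>) \<le> 1) sequentially"
  proof -
    have "- 3 * \<beta> + 24 * \<tau> < 0" "0 < B ^ 3" using \<tau> rate by auto
    then show ?thesis by real_asymp
  qed
  have e5: "eventually (\<lambda>n. h n < 1/4) sequentially" using order_tendstoD(2)[OF h_lim, of "1/4"] by simp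
  have e6: "eventually (\<lambda>n::nat. 1 \<le> n) sequentially" by (rule eventually_ge_at_top)
  from e1 e2 e3 e4 e5 e6 show ?thesis
  proof eventually_elim
    case (elim n)
    let ?\<nu> = "real n powr \<tau>" and ?h = "h n"
    have n1: "1 \<le> real n" using elim by simp
    have n0: "0 < real n" using n1 by linarith
    have pk: "?\<nu> ^ k = real n powr (real k * \<tau>)" for k using n0 by (simp add: powr_power mult.commute)
    have \<nu>4: "4 \<le> ?\<nu>" using elim(1) R by linarith
    then have \<nu>1: "1 \<le> ?\<nu>" by simp
    have lo: "c * real n powr (-1/2 + \<alpha>) \<le> ?h" and hi: "?h \<le> B * real n powr (-1/3 - \<beta>)" using rate elim(6) by auto
    have "0 < c * real n powr (-1/2 + \<alpha>)" using rate(1) n0 by simp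
    then have h0: "0 < ?h" using lo by linarith
    have C5: "160 * C ^ 5 \<le> ?\<nu>" using elim(1) R by linarith
    have sq: "sqrt (real n) = real n powr (1/2)" using n0 by (simp add: powr_half_sqrt)
    have rn: "?\<nu> ^ 40 \<le> sqrt (real n) * ?h"
    proof -
      have 1: "real n powr \<alpha> = real n powr (1/2) * real n powr (-1/2 + \<alpha>)" by (simp add: powr_add[symmetric])
      have "?\<nu> ^ 40 \<le> c * real n powr \<alpha>" using elim(2) unfolding pk by simp
      also have "\<dots> = sqrt (real n) * (c * real n powr (-1/2 + \<alpha>))" unfolding sq 1 by simp
      also have "\<dots> \<le> sqrt (real n) * ?h" using lo by (intro mult_left_mono) auto
      finally show ?thesis .
    qed
    have h40: "?h * ?\<nu> ^ 40 \<le> 1"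
    proof -
      have "?h * ?\<nu> ^ 40 \<le> B * real n powr (-1/3 - \<beta>) * ?\<nu> ^ 40" using hi by (intro mult_right_mono) auto
      also have "\<dots> \<le> 1" using elim(3) unfolding pk by simp
      finally show ?thesis .
    qed
    have nh: "real n * ?h * (?h\<^sup>2 * ?\<nu> ^ 24) \<le> 1"
    proof -
      have "?h ^ 3 \<le> (B * real n powr (-1/3 - \<beta>)) ^ 3" using hi h0 by (intro power_mono) auto
      also have "\<dots> = B ^ 3 * real n powr (-1 - 3 * \<beta>)"
        using n0 by (simp add: power_mult_distrib powr_power algebra_simps)
      finally have h3: "?h ^ 3 \<le> B ^ 3 * real n powr (-1 - 3 * \<beta>)" .
      have "real n * ?h * (?h\<^sup>2 * ?\<nu> ^ 24) = ?h ^ 3 * (real n * ?\<nu> ^ 24)" by (simp add: eval_nat_numeral)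
      also have "\<dots> \<le> B ^ 3 * real n powr (-1 - 3 * \<beta>) * (real n * ?\<nu> ^ 24)" using h3 by (intro mult_right_mono) auto
      also have "\<dots> = B ^ 3 * (real n powr (-1 - 3 * \<beta>) * (real n powr 1 * real n powr (24 * \<tau>)))" unfolding pk using n0 by simp
      also have "\<dots> = B ^ 3 * real n powr (- 3 * \<beta> + 24 * \<tau>)"
        unfolding powr_add[symmetric] by (rule arg_cong[of _ _ "\<lambda>e. B ^ 3 * real n powr e"]) simp
      finally show ?thesis using elim(4) by linarith
    qed
    have hs: "?h * sqrt (real n * ?h) * ?\<nu> ^ 12 \<le> 1"
    proof (rule power2_le_imp_le)
      have 1: "(sqrt (real n * ?h))\<^sup>2 = real n * ?h" using n0 h0 by simp
      have 2: "(?\<nu> ^ 12)\<^sup>2 = ?\<nu> ^ 24" by (simp flip: power_mult)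
      have "(?h * sqrt (real n * ?h) * ?\<nu> ^ 12)\<^sup>2 = ?h\<^sup>2 * (real n * ?h) * ?\<nu> ^ 24" unfolding power_mult_distrib[of _ "?\<nu> ^ 12"] power_mult_distrib[of ?h] 1 2 ..
      also have "\<dots> = real n * ?h * (?h\<^sup>2 * ?\<nu> ^ 24)" by (simp only: mult.assoc mult.left_commute)
      finally show "(?h * sqrt (real n * ?h) * ?\<nu> ^ 12)\<^sup>2 \<le> 1\<^sup>2" using nh by simp
    qed simp
    have h2: "?h * ?\<nu>\<^sup>2 \<le> 1/4"
    proof -
      have "4 * ?\<nu>\<^sup>2 \<le> ?\<nu> * ?\<nu>\<^sup>2" using \<nu>4 by (intro mult_right_mono) auto
      also have "\<dots> = ?\<nu> ^ 3" by (simp add: eval_nat_numeral)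
      also have "\<dots> \<le> ?\<nu> ^ 40" using \<nu>1 by (intro power_increasing) auto
      finally have "?h * (4 * ?\<nu>\<^sup>2) \<le> ?h * ?\<nu> ^ 40" using h0 by (intro mult_left_mono) auto
      then show ?thesis using h40 by simp
    qed
    have nh1: "4 * C \<le> real n * ?h"
    proof -
      have "C ^ 1 \<le> C ^ 5" using C1 by (intro power_increasing) auto
      then have "4 * C \<le> 160 * C ^ 5" using C1 by simp
      also have "\<dots> \<le> ?\<nu> ^ 1" using C5 by simp
      also have "\<dots> \<le> ?\<nu> ^ 40" using \<nu>1 by (intro power_increasing) auto
      also have "\<dots> \<le> 1 * (sqrt (real n) * ?h)" using rn by simp
      also have "\<dots> \<le> sqrt (real n) * (sqrt (real n) * ?h)" using n1 h0 by (intro mult_right_mono) auto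
      also have "\<dots> = real n * ?h" by simp
      finally show ?thesis .
    qed
    have "1 / a0 \<le> ?\<nu>" "160 * real N * (13 * C\<^sup>2) / a0 \<le> ?\<nu>" using R(3,4) elim(1) by linarith+
    then have \<nu>a: "1 \<le> a0 * ?\<nu>" "160 * real N * (13 * C\<^sup>2) \<le> a0 * ?\<nu>"
      using a0(1) by (simp_all only: pos_divide_le_eq mult.commute[of a0])
    show "regime K C ?h n A ?\<nu> a0 N"
    proof (unfold_locales)
      show "1 \<le> a0 * ?\<nu>" "160 * real N * (13 * C\<^sup>2) \<le> a0 * ?\<nu>" by (rule \<nu>a)+
    qed (use K_nonneg K_int K_lip K_supp C1 A a0 h0 elim(5) nh1 \<nu>4 h2 rn hs h40 C5 N0 in auto)
  qed
qed

theorem mainTheorem5: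
  fixes D :: "real measure" and Q q q2 :: "real \<Rightarrow> real"
    and p :: "nat \<Rightarrow> real" and M :: nat
    and K :: "real \<Rightarrow> real" and h :: "nat \<Rightarrow> real"
  assumes D: "real_distribution D"
    and F_cont: "\<And>x. isCont (cdf D) x"
    and Q_inv: "\<And>u. u \<in> {0..1} \<Longrightarrow> cdf D (Q u) = u"
    and Q_quant: "\<And>u. u \<in> {0<..<1} \<Longrightarrow> Q u = Inf {x. u \<le> cdf D x}"
    and Q_deriv: "\<And>u. u \<in> {0..1} \<Longrightarrow> (Q has_real_derivative q u) (at u within {0..1})"
    and q_deriv: "\<And>u. u \<in> {0..1} \<Longrightarrow> (q has_real_derivative q2 u) (at u within {0..1})"
    and q2_cont: "continuous_on {0..1} q2"
    and q_pos: "\<And>u. u \<in> {0..1} \<Longrightarrow> q u > 0"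
    and p_nonneg: "\<And>m. m \<in> {1..M} \<Longrightarrow> p m \<ge> 0"
    and A1d_nz: "\<And>u. u \<in> {0..1} \<Longrightarrow> A1d p M u \<noteq> 0"
    and K_nonneg: "\<And>z. K z \<ge> 0"
    and K_int: "(K has_integral 1) UNIV"
    and K_sq: "integrable lborel (\<lambda>z. (K z)\<^sup>2)"
    and K_lip: "\<exists>L. \<forall>x y. \<bar>K x - K y\<bar> \<le> L * \<bar>x - y\<bar>"
    and K_supp: "\<And>z. \<bar>z\<bar> > 1 \<Longrightarrow> K z = 0"
    and h_lim: "h \<longlonglongrightarrow> 0"
    and h_rate: "\<exists>c \<alpha> C \<beta>. c > 0 \<and> \<alpha> > 0 \<and> C > 0 \<and> \<beta> > 0 \<and>
        (\<forall>n\<ge>1. c * real n powr (-1/2 + \<alpha>) \<le> h n \<and> h n \<le> C * real n powr (-1/3 - \<beta>))"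
  shows
    "(\<lambda>n. SUP x::real. \<bar>PrLe D n (\<lambda>b. Wabs (Zn Q q (Afun p M) K (h n) n b) (h n)) x
        - PrLe unif01 n (\<lambda>U. Wabs (Zstar (Afun p M) K (h n) n U) (h n)) x\<bar>) \<longlonglongrightarrow> 0
   \<and> (\<lambda>n. SUP x::real. \<bar>PrLe D n (\<lambda>b. Wabs (Zn Q q (Afun p M) K (h n) n b) (h n)) x
        - PrLe unif01 n (\<lambda>U. Wabs (Zn (\<lambda>u. u) (\<lambda>u. 1) (Afun p M) K (h n) n U) (h n)) x\<bar>) \<longlonglongrightarrow> 0
   \<and> (\<lambda>n. SUP x::real. \<bar>PrLe D n (\<lambda>b. Wsup (Zn Q q (Afun p M) K (h n) n b) (h n)) x
        - PrLe unif01 n (\<lambda>U. Wsup (Zstar (Afun p M) K (h n) n U) (h n)) x\<bar>) \<longlonglongrightarrow> 0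
   \<and> (\<lambda>n. SUP x::real. \<bar>PrLe D n (\<lambda>b. Wsup (Zn Q q (Afun p M) K (h n) n b) (h n)) x
        - PrLe unif01 n (\<lambda>U. Wsup (Zn (\<lambda>u. u) (\<lambda>u. 1) (Afun p M) K (h n) n U) (h n)) x\<bar>) \<longlonglongrightarrow> 0"
proof -
  let ?A = "Afun p M"
  obtain LK where LK: "\<And>x y. \<bar>K x - K y\<bar> \<le> LK * \<bar>x - y\<bar>" using K_lip by blast
  obtain LA a0 where LA: "0 \<le> LA" "\<And>s t. s \<in> {0..1} \<Longrightarrow> t \<in> {0..1} \<Longrightarrow> \<bar>?A s - ?A t\<bar> \<le> LA * \<bar>s - t\<bar>"
    and A0: "\<And>u. u \<in> {0..1} \<Longrightarrow> 0 \<le> ?A u" and a0: "0 < a0" "\<And>u. u \<in> {1/2..3/4} \<Longrightarrow> a0 \<le> ?A u"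
    using Afun_regular[OF p_nonneg A1d_nz] by metis
  obtain Lq where Lq: "0 \<le> Lq" "\<And>s t. s \<in> {0..1} \<Longrightarrow> t \<in> {0..1} \<Longrightarrow> \<bar>q s - q t\<bar> \<le> Lq * \<bar>s - t\<bar>"
    using C1_lipschitz[OF q_deriv q2_cont] by metis
  have q_cont: "continuous_on {0..1} q" by (rule DERIV_continuous_on[OF q_deriv])
  obtain mq where mq: "0 < mq" "\<And>t. t \<in> {0..1} \<Longrightarrow> mq \<le> q t"
    using continuous_pos_lower_bound[OF q_cont _ q_pos] by auto
  \<comment> \<open>One constant dominates the Lipschitz constants of \<open>K\<close>,
    \<open>A\<close> and \<open>q\<close>, the upper bounds of \<open>A\<close> and
    \<open>q\<close>, and the reciprocal of the lower bound of \<open>q\<close>.\<close>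
  define C where "C = Max {1, LK, LA, \<bar>?A 0\<bar> + LA, Lq, \<bar>q 0\<bar> + Lq, 1 / mq}"
  have C: "1 \<le> C" "LK \<le> C" "LA \<le> C" "\<bar>?A 0\<bar> + LA \<le> C" "Lq \<le> C" "\<bar>q 0\<bar> + Lq \<le> C" "1 / mq \<le> C"
    unfolding C_def by (rule Max_ge; simp)+
  have K_lip': "\<bar>K x - K y\<bar> \<le> C * \<bar>x - y\<bar>" for x y
    using LK[of x y] mult_right_mono[OF C(2), of "\<bar>x - y\<bar>"] by linarith
  have A_lip: "\<bar>?A s - ?A t\<bar> \<le> C * \<bar>s - t\<bar>" if "s \<in> {0..1}" "t \<in> {0..1}" for s t
    using LA(2)[OF that] mult_right_mono[OF C(3), of "\<bar>s - t\<bar>"] by linarith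
  have A_le: "?A t \<le> C" if "t \<in> {0..1}" for t using lipschitz_bounded[OF LA(2,1) that] C(4) by linarith
  have q_lip: "\<bar>q s - q t\<bar> \<le> C * \<bar>s - t\<bar>" if "s \<in> {0..1}" "t \<in> {0..1}" for s t
    using Lq(2)[OF that] mult_right_mono[OF C(5), of "\<bar>s - t\<bar>"] by linarith
  have q_le: "q t \<le> C" if "t \<in> {0..1}" for t using lipschitz_bounded[OF Lq(2,1) that] C(6) by linarith
  have q_ge: "1 \<le> C * q t" if "t \<in> {0..1}" for t
  proof -
    have "1 = 1 / mq * mq" using mq by simp
    also have "\<dots> \<le> C * q t" using C(1,7) mq(1) mq(2)[OF that] by (intro mult_mono) auto
    finally show ?thesis .
  qed
  obtain c \<alpha> B \<beta> where rate: "0 < c" "0 < \<alpha>" "0 < B" "0 < \<beta>"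
    "\<And>n. 1 \<le> n \<Longrightarrow> c * real n powr (-1/2 + \<alpha>) \<le> h n" "\<And>n. 1 \<le> n \<Longrightarrow> h n \<le> B * real n powr (-1/3 - \<beta>)"
    using h_rate by blast
  \<comment> \<open>Chosen with slack so that the strict inequalities required by
    \<open>eventually_regime\<close> hold.\<close>
  define \<tau> where "\<tau> = Min {\<alpha> / 80, \<beta> / 80, 1/200}"
  have \<tau>0: "\<tau> \<le> \<alpha> / 80" "\<tau> \<le> \<beta> / 80" "\<tau> \<le> 1/200" unfolding \<tau>_def by (rule Min_le; simp)+
  have "0 < \<tau>" unfolding \<tau>_def using rate by (subst Min_gr_iff) auto
  have \<tau>: "0 < \<tau>" "40 * \<tau> < \<alpha>" "40 * \<tau> < 1/3" "24 * \<tau> < 3 * \<beta>"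
    using \<open>0 < \<tau>\<close> \<tau>0 rate(2,4) by linarith+
  define r where "r n = 400 * real n ^ 3 * exp (1 - real n powr \<tau> / 2)" for n :: nat
  have r: "r \<longlonglongrightarrow> 0" unfolding r_def using \<tau>(1) by real_asymp
  have reg: "eventually (\<lambda>n. regime K C (h n) n ?A (real n powr \<tau>) a0 N) sequentially" if "0 < N" for N
    using eventually_regime[OF K_nonneg K_int K_lip' K_supp C(1) A0 A_le A_lip a0 h_lim rate \<tau> that] .
  have Q_cont: "continuous_on {0..1} Q" by (rule DERIV_continuous_on[OF Q_deriv])
  define Q' where "Q' = (\<lambda>t. Q (max 0 (min 1 t)))"
  have Q': "Q' \<in> borel_measurable borel" "D = distr unif01 borel Q'" "\<And>t. t \<in> {0..1} \<Longrightarrow> Q' t = Q t"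
    unfolding Q'_def using distr_quantile[OF D Q_inv Q_cont] by auto
  \<comment> \<open>The pseudo-sample is the special case in which the quantile function is the
    identity and its derivative is 1.\<close>
  have idu: "unif01 = distr unif01 borel (\<lambda>t. t)" by (rule distr_id2[symmetric]) simp
  define P0 where "P0 n Sg x = PrS D n (\<lambda>b u. Zn Q q ?A K (h n) n b u) (h n) Sg x" for n Sg x
  define P1 where "P1 n Sg x = PrS unif01 n (Zstar ?A K (h n) n) (h n) Sg x" for n Sg x
  define P2 where "P2 n Sg x = PrS unif01 n (\<lambda>b u. Zn (\<lambda>u. u) (\<lambda>u. 1) ?A K (h n) n b u) (h n) Sg x" for n Sg x
  \<comment> \<open>All three laws are compared with the same grid maximum, and each costs
    \<open>err\<close>; the triangle inequality gives the factor 2.\<close>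
  have bounds: "eventually (\<lambda>n. \<forall>x. \<bar>P0 n Sg x - P1 n Sg x\<bar> \<le> 2 * (288 / real N + r n) \<and> \<bar>P0 n Sg x - P2 n Sg x\<bar> \<le> 2 * (288 / real N + r n)) sequentially"
    if N: "0 < N" and Sg: "1 \<in> Sg" "Sg \<subseteq> {1, -1}" for N Sg
    using reg[OF N]
  proof eventually_elim
    case (elim n)
    interpret R: regime K C "h n" n ?A "real n powr \<tau>" a0 N by (rule elim)
    have err: "R.err = 288 / real N + r n" by (simp add: R.err_def r_def)
    have tri: "\<bar>a - b\<bar> \<le> 2 * e" if "\<bar>a - c\<bar> \<le> e" "\<bar>b - c\<bar> \<le> e" for a b c e :: real
      using that by linarith
    show ?case
    proof
      fix x
      have 0: "\<bar>P0 n Sg x - measure R.UM {y \<in> space R.UM. R.Wmax R.grd Sg y \<le> x}\<bar> \<le> R.err"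
        unfolding P0_def by (rule R.compare_Zn[OF Sg Q' Q_deriv q_lip q_le q_ge])
      have 1: "\<bar>P1 n Sg x - measure R.UM {y \<in> space R.UM. R.Wmax R.grd Sg y \<le> x}\<bar> \<le> R.err"
        unfolding P1_def by (rule R.compare_star[OF Sg])
      have 2: "\<bar>P2 n Sg x - measure R.UM {y \<in> space R.UM. R.Wmax R.grd Sg y \<le> x}\<bar> \<le> R.err"
        unfolding P2_def by (rule R.compare_Zn[OF Sg _ idu]) (use C(1) in auto)
      show "\<bar>P0 n Sg x - P1 n Sg x\<bar> \<le> 2 * (288 / real N + r n) \<and> \<bar>P0 n Sg x - P2 n Sg x\<bar> \<le> 2 * (288 / real N + r n)"
        using tri[OF 0 1] tri[OF 0 2] unfolding err ..
    qed
  qed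
  have lim1: "(\<lambda>n. SUP x. \<bar>P0 n Sg x - P1 n Sg x\<bar>) \<longlonglongrightarrow> 0" if "1 \<in> Sg" "Sg \<subseteq> {1, -1}" for Sg
    by (rule SUP_diff_tendsto_0[OF _ r, of _ _ 288]) (auto intro: eventually_mono[OF bounds[OF _ that]])
  have lim2: "(\<lambda>n. SUP x. \<bar>P0 n Sg x - P2 n Sg x\<bar>) \<longlonglongrightarrow> 0" if "1 \<in> Sg" "Sg \<subseteq> {1, -1}" for Sg
    by (rule SUP_diff_tendsto_0[OF _ r, of _ _ 288]) (auto intro: eventually_mono[OF bounds[OF _ that]])
  show ?thesis
    unfolding PrLe_eq_PrS
    using lim1[of "{1, -1}"] lim2[of "{1, -1}"] lim1[of "{1}"] lim2[of "{1}"]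
    unfolding P0_def P1_def P2_def by auto
qed

end
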